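(* Let $(R,\mathfrak m)$ be a regular local ring, let $\mathbf x=\{x_1,\ldots,x_d\}$ be a minimal generating set of $\mathfrak m$, and let $I\subset R$ be a monomial ideal in $\mathbf x$. Then $$(I^* )^{\mathrm{sat}}=(I^{\mathrm{sat}})^*.$$ In particular, $\operatorname{depth}\operatorname{gr}_{\mathfrak m}(R/I^{\mathrm{sat}})>0$.
   Context: A monomial in $\mathbf x$ is an element $x_1^{a_1}\cdots x_d^{a_d}$ with $a_i\ge 0$ integers; a monomial ideal in $\mathbf x$ is an ideal of $R$ generated by monomials in $\mathbf x$. $\operatorname{gr}_{\mathfrak m}(R)=\bigoplus_{n\ge 0}\mathfrak m^n/\mathfrak m^{n+1}$, and $\operatorname{gr}_{\mathfrak m}(R/K)$ is the associated graded ring of $R/K$ with respect to the ideal $\mathfrak m(R/K)$. For $0\ne a\in R$ put $v(a)=\sup\{r: a\in\mathfrak m^r\}$ and let $a^*=a+\mathfrak m^{v(a)+1}\in\mathfrak m^{v(a)}/\mathfrak m^{v(a)+1}\subset\operatorname{gr}_{\mathfrak m}(R)$ be the initial form of $a$; set $0^*=0$. For an ideal $K\subset R$, the initial ideal is $K^*=(a^*\mid a\in K)\subset\operatorname{gr}_{\mathfrak m}(R)$. For an ideal $K\subset R$, $K^{\mathrm{sat}}=\bigcup_{i\ge1}(K:\mathfrak m^i)$; for an ideal $J\subset\operatorname{gr}_{\mathfrak m}(R)$, $J^{\mathrm{sat}}=\bigcup_{i\ge 1}(J:\mathfrak M^i)$ with $\mathfrak M=\bigoplus_{i>0}\mathfrak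 m^i/\mathfrak m^{i+1}$. For a standard graded ring $G$ with homogeneous maximal ideal $\mathfrak M_G$, $\operatorname{depth}(G)$ is the grade of $\mathfrak M_G$ on $G$; the zero ring is taken to have depth $\infty$. *)

theory Defs
  imports "HOL-Library.Extended_Nat" "HOL-Algebra.Ideal_Product" "HOL-Algebra.Ring_Divisibility"
begin

hide_const (open) Multiset.mult

section \<open>Ideals: powers, colons, saturation, generators\<close>

abbreviation ideal_pow :: "('a, 'b) ring_scheme \<Rightarrow> 'a set \<Rightarrow> nat \<Rightarrow> 'a set"
  where "ideal_pow R J n \<equiv> J [^]\<^bsub>ideals_set R\<^esub> n"

definition ideal_colon :: "('a, 'b) ring_scheme \<Rightarrow> 'a set \<Rightarrow> 'a set \<Rightarrow> 'a set"
  where "ideal_colon R K J = {a \<in> carrier R. \<forall>b\<in>J. a \<otimes>\<^bsub>R\<^esub> b \<in> K}"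

definition saturation :: "('a, 'b) ring_scheme \<Rightarrow> 'a set \<Rightarrow> 'a set \<Rightarrow> 'a set"
  where "saturation R J K = (\<Union>i\<in>{1..}. ideal_colon R K (ideal_pow R J i))"

definition minimal_generating_set :: "('a, 'b) ring_scheme \<Rightarrow> 'a set \<Rightarrow> 'a set \<Rightarrow> bool"
  where "minimal_generating_set R \<xx> J \<longleftrightarrow>
    \<xx> \<subseteq> carrier R \<and> genideal R \<xx> = J \<and> (\<forall>Y. Y \<subset> \<xx> \<longrightarrow> genideal R Y \<noteq> J)"

definition monomials :: "('a, 'b) ring_scheme \<Rightarrow> 'a set \<Rightarrow> 'a set"
  where "monomials R \<xx> = {finprod R (\<lambda>x. x [^]\<^bsub>R\<^esub> a x) \<xx> | a :: 'a \<Rightarrow> nat. True}"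

definition monomial_ideal :: "('a, 'b) ring_scheme \<Rightarrow> 'a set \<Rightarrow> 'a set \<Rightarrow> bool"
  where "monomial_ideal R \<xx> K \<longleftrightarrow> (\<exists>S \<subseteq> monomials R \<xx>. K = genideal R S)"


section \<open>Regular local rings\<close>

definition krull_dim :: "('a, 'b) ring_scheme \<Rightarrow> enat"
  where "krull_dim R = Sup {enat n | n. \<exists>P :: nat \<Rightarrow> 'a set.
    (\<forall>i\<le>n. primeideal (P i) R) \<and> (\<forall>i<n. P i \<subset> P (Suc i))}"

definition min_num_generators :: "('a, 'b) ring_scheme \<Rightarrow> 'a set \<Rightarrow> nat"
  where "min_num_generators R J =
    (LEAST n. \<exists>S \<subseteq> carrier R. finite S \<and> card S = n \<and> genideal R S = J)"

locale local_ring = cring R for R (structure) and \<mm> +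
  assumes maximal: "maximalideal \<mm> R"
    and unique_maximal: "maximalideal J R \<Longrightarrow> J = \<mm>"

locale regular_local_ring = local_ring R \<mm> + noetherian_ring R for R (structure) and \<mm> +
  assumes regular: "krull_dim R = enat (min_num_generators R \<mm>)"


section \<open>The associated graded ring\<close>

definition gr_component :: "('a, 'b) ring_scheme \<Rightarrow> 'a set \<Rightarrow> nat \<Rightarrow> 'a set set"
  where "gr_component R \<mm> n = (\<lambda>a. ideal_pow R \<mm> (Suc n) +>\<^bsub>R\<^esub> a) ` ideal_pow R \<mm> n"

text \<open>An element of the direct sum of the \<open>\<mm>\<^sup>n/\<mm>\<^sup>n\<^sup>+\<^sup>1\<close> is the sequence of its homogeneous components;
  the zero of \<open>\<mm>\<^sup>n/\<mm>\<^sup>n\<^sup>+\<^sup>1\<close> is the coset \<open>\<mm>\<^sup>n\<^sup>+\<^sup>1\<close> itself. The product of the classes of \<open>a \<in> \<mm>\<^sup>i\<close> and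
  \<open>b \<in> \<mm>\<^sup>j\<close> is the class of \<open>ab\<close> modulo \<open>\<mm>\<^sup>i\<^sup>+\<^sup>j\<^sup>+\<^sup>1\<close>. Sums in degree \<open>n\<close> are taken in \<open>R/\<mm>\<^sup>n\<^sup>+\<^sup>1\<close>,
  of which \<open>\<mm>\<^sup>n/\<mm>\<^sup>n\<^sup>+\<^sup>1\<close> is an additive subgroup.\<close>

definition gr :: "('a, 'b) ring_scheme \<Rightarrow> 'a set \<Rightarrow> (nat \<Rightarrow> 'a set) ring"
  where "gr R \<mm> =
    \<lparr>carrier = {f. (\<forall>n. f n \<in> gr_component R \<mm> n) \<and> finite {n. f n \<noteq> ideal_pow R \<mm> (Suc n)}},
     mult = (\<lambda>f g n. finsum (R Quot ideal_pow R \<mm> (Suc n))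
               (\<lambda>i. rcoset_mult R (ideal_pow R \<mm> (Suc n)) (f i) (g (n - i))) {..n}),
     one = (\<lambda>n. if n = 0 then ideal_pow R \<mm> (Suc 0) +>\<^bsub>R\<^esub> \<one>\<^bsub>R\<^esub> else ideal_pow R \<mm> (Suc n)),
     zero = (\<lambda>n. ideal_pow R \<mm> (Suc n)),
     add = (\<lambda>f g n. f n <+>\<^bsub>R\<^esub> g n)\<rparr>"

text \<open>The ideal of elements with vanishing degree-zero component. It is the homogeneous maximal
  ideal of \<open>gr R \<mm>\<close> when \<open>\<mm>\<close> is maximal, since then the degree-zero component is a field.\<close>

definition gr_pos :: "('a, 'b) ring_scheme \<Rightarrow> 'a set \<Rightarrow> (nat \<Rightarrow> 'a set) set"
  where "gr_pos R \<mm> = {f \<in> carrier (gr R \<mm>). f 0 = \<zero>\<^bsub>gr R \<mm>\<^esub> 0}"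

definition adic_order :: "('a, 'b) ring_scheme \<Rightarrow> 'a set \<Rightarrow> 'a \<Rightarrow> enat"
  where "adic_order R \<mm> a = Sup (enat ` {r. a \<in> ideal_pow R \<mm> r})"

text \<open>In a Noetherian local ring with maximal ideal \<open>\<mm>\<close> the order of a nonzero element is finite,
  by Krull's intersection theorem.\<close>

definition initial_form :: "('a, 'b) ring_scheme \<Rightarrow> 'a set \<Rightarrow> 'a \<Rightarrow> nat \<Rightarrow> 'a set"
  where "initial_form R \<mm> a =
    (if a = \<zero>\<^bsub>R\<^esub> then \<zero>\<^bsub>gr R \<mm>\<^esub>
     else (\<lambda>n. if enat n = adic_order R \<mm> a then ideal_pow R \<mm> (Suc n) +>\<^bsub>R\<^esub> a
               else \<zero>\<^bsub>gr R \<mm>\<^esub> n))"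

definition initial_ideal :: "('a, 'b) ring_scheme \<Rightarrow> 'a set \<Rightarrow> 'a set \<Rightarrow> (nat \<Rightarrow> 'a set) set"
  where "initial_ideal R \<mm> K = genideal (gr R \<mm>) (initial_form R \<mm> ` K)"


section \<open>Grade and depth\<close>

definition regular_sequence :: "('a, 'b) ring_scheme \<Rightarrow> 'a list \<Rightarrow> bool"
  where "regular_sequence R xs \<longleftrightarrow>
    set xs \<subseteq> carrier R \<and>
    (\<forall>i<length xs. \<forall>a\<in>carrier R.
       a \<otimes>\<^bsub>R\<^esub> xs ! i \<in> genideal R (set (take i xs)) \<longrightarrow> a \<in> genideal R (set (take i xs))) \<and>
    genideal R (set xs) \<noteq> carrier R"

text \<open>The grade of \<open>J\<close> on \<open>R\<close>, with the usual convention that the unit ideal has grade \<open>\<infinity>\<close>.\<close>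

definition grade :: "('a, 'b) ring_scheme \<Rightarrow> 'a set \<Rightarrow> enat"
  where "grade R J =
    (if J = carrier R then \<infinity>
     else Sup {enat (length xs) | xs. set xs \<subseteq> J \<and> regular_sequence R xs})"

text \<open>The zero ring has depth \<open>\<infinity>\<close> because there \<open>gr_pos R \<mm>\<close> is the unit ideal.\<close>

definition depth_gr :: "('a, 'b) ring_scheme \<Rightarrow> 'a set \<Rightarrow> enat"
  where "depth_gr R \<mm> = grade (gr R \<mm>) (gr_pos R \<mm>)"

definition quot_ideal :: "('a, 'b) ring_scheme \<Rightarrow> 'a set \<Rightarrow> 'a set \<Rightarrow> 'a set set"
  where "quot_ideal R J K = (\<lambda>a. K +>\<^bsub>R\<^esub> a) ` J"

end

theory Submission
  imports Defs "HOL-Library.Fun_Lexorder" "HOL-Library.Function_Algebras" "HOL-Algebra.UnivPoly"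
    "HOL-Algebra.Subrings"
begin

text \<open>
  In a regular local ring the monomials in a minimal generating set \<open>x\<^sub>1, \<dots>, x\<^sub>d\<close> of \<open>\<mm>\<close> are
  independent: a homogeneous relation with a unit coefficient that holds modulo a higher power of \<open>\<mm>\<close>
  has a lex-lowest monomial, all multiples of which are redundant, so the length of \<open>R/\<mm>\<^sup>L\<close> is
  \<open>O(L\<^sup>d\<^sup>-\<^sup>1)\<close>. By Artin-Rees each step of a chain of primes lowers the growth exponent of the length of
  \<open>R/(P + \<mm>\<^sup>L)\<close> by one, so then every such chain has fewer than \<open>d\<close> steps, against \<open>dim R = d\<close>.

  Independence lets one compare coefficients in lowest degree. Hence \<open>I\<^sup>*\<close> is generated by the initial
  forms of the monomials of \<open>I\<close>, and both saturations are determined by the monomials that a power of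
  every \<open>x\<^sub>j\<close> multiplies into \<open>I\<close>. The initial form of \<open>x\<^sub>1 + \<dots> + x\<^sub>d\<close> is a nonzerodivisor modulo the
  saturated initial ideal, because that ideal is the intersection over \<open>j\<close> of its saturations with
  respect to \<open>x\<^sub>j\<close>, modulo which the sum is monic in \<open>x\<^sub>j\<close>.
\<close>

section \<open>Ideals of a commutative ring\<close>

text \<open>\<open>R\<close> need not contain a field, so a monomial has no well-defined coefficient
  in an element of \<open>R\<close>. Lowest-degree terms are therefore compared through membership
  in \<open>mon_span V n\<close>, the ideal generated by monomials together with
  \<open>\<mm>^(n+1)\<close>, and all that is asked about a coefficient there is whether it is a
  unit.

  Lengths are handled in the same spirit: \<open>ideal_chain_above R A n\<close> stands for "the
  length of \<open>R/A\<close> is at least \<open>n\<close>", and one superadditive and one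
  subadditive step replace a theory of length. Growth is expressed by inequalities
  \<open>n * L \<le> C * L^k\<close> for all positive \<open>L\<close>; no Hilbert polynomial
  appears, and the extra factor \<open>L\<close> avoids the exponent \<open>k - 1\<close>.

  Regularity compares the Krull dimension with the least number of generators, whereas the given
  generating set is only irredundant. That the two cardinalities agree is an exchange argument
  resting on Nakayama's lemma.

  For the identity itself the obstacle is that initial ideals are defined by generators. They are
  first described degree by degree, by representatives in \<open>K\<close> and
  \<open>\<mm>^n\<close>, and both saturations are then tested on products with powers of single
  generators.\<close>

context ideal
begin

lemma add_mem_iff:
  assumes "a \<in> I" "b \<in> carrier R"
  shows "a \<oplus> b \<in> I \<longleftrightarrow> b \<in> I" "b \<oplus> a \<in> I \<longleftrightarrow> b \<in> I"
proof -
  have a: "a \<in> carrier R"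
    using assms Icarr by blast
  have "b \<in> I" if "a \<oplus> b \<in> I"
  proof -
    have "\<ominus> a \<oplus> (a \<oplus> b) \<in> I"
      using that assms(1) a_closed a_inv_closed by blast
    thus ?thesis
      using a assms(2) r_neg1 by simp
  qed
  thus "a \<oplus> b \<in> I \<longleftrightarrow> b \<in> I" "b \<oplus> a \<in> I \<longleftrightarrow> b \<in> I"
    using assms a a_closed add.m_comm[of a b] by auto
qed

lemma minus_closed_ideal:
  assumes "a \<in> I" "b \<in> I"
  shows "a \<ominus> b \<in> I"
  using assms by (simp add: a_minus_def a_closed a_inv_closed)

end

context cring
begin

lemma sum_mem_Idl_Un_iff:
  assumes "A \<subseteq> carrier R" "B \<subseteq> carrier R"
  shows "x \<in> Idl (A \<union> B) \<longleftrightarrow> (\<exists>a\<in>Idl A. \<exists>b\<in>Idl B. x = a \<oplus> b)"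
proof
  assume "x \<in> Idl (A \<union> B)"
  moreover have "Idl (A \<union> B) \<subseteq> Idl A <+> Idl B"
  proof (rule genideal_minimal[OF add_ideals])
    show "ideal (Idl A) R" "ideal (Idl B) R"
      using assms by (auto intro: genideal_ideal)
    have "Idl A <+> Idl B = Idl (Idl A \<union> Idl B)"
      by (rule union_genideal[OF genideal_ideal[OF assms(1)] genideal_ideal[OF assms(2)], symmetric])
    moreover have "A \<union> B \<subseteq> Idl A \<union> Idl B"
      using genideal_self[OF assms(1)] genideal_self[OF assms(2)] by blast
    moreover have "Idl A \<union> Idl B \<subseteq> carrier R"
      using ideal.Icarr[OF genideal_ideal[OF assms(1)]] ideal.Icarr[OF genideal_ideal[OF assms(2)]]
      by blast
    ultimately show "A \<union> B \<subseteq> Idl A <+> Idl B"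
      using genideal_self[of "Idl A \<union> Idl B"] by auto
  qed
  ultimately show "\<exists>a\<in>Idl A. \<exists>b\<in>Idl B. x = a \<oplus> b"
    unfolding set_add_def' by blast
next
  assume "\<exists>a\<in>Idl A. \<exists>b\<in>Idl B. x = a \<oplus> b"
  then obtain a b where *: "a \<in> Idl A" "b \<in> Idl B" "x = a \<oplus> b" by blast
  interpret U: ideal "Idl (A \<union> B)" R
    using assms by (intro genideal_ideal) auto
  have "Idl A \<subseteq> Idl (A \<union> B)" "Idl B \<subseteq> Idl (A \<union> B)"
    using assms genideal_self[of "A \<union> B"] genideal_minimal[OF U.ideal_axioms, of A]
      genideal_minimal[OF U.ideal_axioms, of B] by simp_all
  thus "x \<in> Idl (A \<union> B)" using * U.a_closed by blast
qed

lemma Idl_mono: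
  assumes "A \<subseteq> B" "B \<subseteq> carrier R"
  shows "Idl A \<subseteq> Idl B"
  using assms by (meson subset_Idl_subset)

lemma Idl_ideal:
  assumes "ideal I R" shows "Idl I = I"
proof -
  interpret I: ideal I R by fact
  show ?thesis
    using genideal_minimal[OF assms order_refl] genideal_self[OF I.a_subset] by blast
qed

lemma Idl_closed:
  assumes "A \<subseteq> carrier R" "x \<in> Idl A" shows "x \<in> carrier R"
  by (rule ideal.Icarr[OF genideal_ideal[OF assms(1)] assms(2)])

lemma mem_Idl_insert_iff:
  assumes "v \<in> carrier R" "B \<subseteq> carrier R"
  shows "x \<in> Idl (insert v B) \<longleftrightarrow> (\<exists>r\<in>carrier R. \<exists>b\<in>Idl B. x = r \<otimes> v \<oplus> b)"
proof -
  have "Idl {v} = PIdl v"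
    using cgenideal_eq_genideal assms by simp
  thus ?thesis
    using sum_mem_Idl_Un_iff[of "{v}" B x] assms unfolding cgenideal_def by auto
qed

lemma ideal_colon_ideal:
  assumes "ideal K R" "J \<subseteq> carrier R"
  shows "ideal (ideal_colon R K J) R"
proof -
  interpret K: ideal K R by fact
  show ?thesis
  proof (rule idealI[OF ring_axioms])
    show "subgroup (ideal_colon R K J) (add_monoid R)"
    proof (rule add.subgroupI)
      show "ideal_colon R K J \<subseteq> carrier R" by (auto simp: ideal_colon_def)
      have "\<zero> \<in> ideal_colon R K J"
        using assms by (auto simp: ideal_colon_def subset_iff)
      thus "ideal_colon R K J \<noteq> {}" by blast
      fix a assume a: "a \<in> ideal_colon R K J"
      thus "\<ominus> a \<in> ideal_colon R K J"
        using assms by (auto simp: ideal_colon_def subset_iff l_minus)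
      fix b assume b: "b \<in> ideal_colon R K J"
      show "a \<oplus> b \<in> ideal_colon R K J"
        using a b assms by (auto simp: ideal_colon_def subset_iff l_distr K.a_closed)
    qed
    fix a x assume "a \<in> ideal_colon R K J" "x \<in> carrier R"
    thus "x \<otimes> a \<in> ideal_colon R K J" "a \<otimes> x \<in> ideal_colon R K J"
      using assms by (auto simp: ideal_colon_def subset_iff m_assoc m_comm[of a x] K.I_l_closed)
  qed
qed

text \<open>Minimality of \<open>Idl A\<close> against the colon ideal of \<open>J\<close> by
  \<open>c\<close>; this replaces computations with explicit combinations of generators.\<close>

lemma Idl_mult_mem:
  assumes "ideal J R" "A \<subseteq> carrier R" "c \<in> carrier R"
    and "\<And>a. a \<in> A \<Longrightarrow> a \<otimes> c \<in> J" and "x \<in> Idl A"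
  shows "x \<otimes> c \<in> J"
proof -
  have "Idl A \<subseteq> ideal_colon R J {c}"
    using assms by (intro genideal_minimal ideal_colon_ideal) (auto simp: ideal_colon_def)
  thus ?thesis using assms(5) by (auto simp: ideal_colon_def)
qed

lemma Idl_mult_Idl_mem:
  assumes "ideal J R" "A \<subseteq> carrier R" "B \<subseteq> carrier R"
    and "\<And>a b. a \<in> A \<Longrightarrow> b \<in> B \<Longrightarrow> a \<otimes> b \<in> J" and "x \<in> Idl A" "y \<in> Idl B"
  shows "x \<otimes> y \<in> J"
proof (rule Idl_mult_mem[OF assms(1,2) _ _ assms(5)])
  show y: "y \<in> carrier R" using assms(3,6) Idl_closed by blast
  fix a assume a: "a \<in> A"
  have "b \<otimes> a \<in> J" if "b \<in> B" for b
    using assms(2,3) a that assms(4)[OF a that] m_comm[of a b] by (auto simp: subset_iff)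
  hence "y \<otimes> a \<in> J"
    using assms(2) a by (intro Idl_mult_mem[OF assms(1,3) _ _ assms(6)]) auto
  thus "a \<otimes> y \<in> J" using y a assms(2) by (auto simp: m_comm subset_iff)
qed

lemma ideal_pow_0: "ideal_pow R J 0 = carrier R"
  by (simp add: ideals_set_def nat_pow_def)

lemma ideal_pow_Suc: "ideal_pow R J (Suc n) = ideal_prod R (ideal_pow R J n) J"
  by (simp add: ideals_set_def nat_pow_def)

lemma ideal_pow_ideal:
  assumes "ideal J R" shows "ideal (ideal_pow R J n) R"
  by (induction n) (use assms in \<open>auto simp only: ideal_pow_0 ideal_pow_Suc intro: oneideal ideal_prod_is_ideal\<close>)

lemma ideal_pow_Suc_subset:
  assumes "ideal J R" shows "ideal_pow R J (Suc n) \<subseteq> ideal_pow R J n"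
  unfolding ideal_pow_Suc using ideal_prod_inter[OF ideal_pow_ideal assms] assms by blast

lemma ideal_pow_antimono:
  assumes "ideal J R" "m \<le> n" shows "ideal_pow R J n \<subseteq> ideal_pow R J m"
  using assms(2) by (induction n rule: dec_induct) (use ideal_pow_Suc_subset[OF assms(1)] in blast)+

lemma ideal_pow_1:
  assumes "ideal J R" shows "ideal_pow R J (Suc 0) = J"
  unfolding ideal_pow_Suc ideal_pow_0
  using assms ideal_prod_one ideal_prod_commute oneideal by metis

lemma ideal_prod_subsetI:
  assumes "ideal K R" "\<And>a b. a \<in> A \<Longrightarrow> b \<in> B \<Longrightarrow> a \<otimes> b \<in> K"
  shows "ideal_prod R A B \<subseteq> K"
proof
  interpret K: ideal K R by fact
  fix x assume "x \<in> ideal_prod R A B"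
  thus "x \<in> K" by induction (use assms(2) K.a_closed in auto)
qed

lemma ideal_pow_add:
  assumes "ideal J R"
  shows "ideal_prod R (ideal_pow R J m) (ideal_pow R J n) = ideal_pow R J (m + n)"
proof (induction n)
  case 0
  show ?case using ideal_prod_one[OF ideal_pow_ideal[OF assms]] by (simp only: ideal_pow_0 add_0_right)
next
  case (Suc n)
  thus ?case
    using ideal_prod_assoc[OF ideal_pow_ideal[OF assms, of m] ideal_pow_ideal[OF assms, of n] assms, symmetric]
    by (simp only: ideal_pow_Suc add_Suc_right)
qed

lemma ideal_pow_mult_mem:
  assumes "ideal J R" "a \<in> ideal_pow R J m" "b \<in> ideal_pow R J n"
  shows "a \<otimes> b \<in> ideal_pow R J (m + n)"
  using ideal_prod.prod[OF assms(2,3)] ideal_pow_add[OF assms(1)] by metis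

lemma ideal_pow_closed:
  assumes "ideal J R" "a \<in> ideal_pow R J n" shows "a \<in> carrier R"
  using ideal.Icarr[OF ideal_pow_ideal] assms by blast

end

text \<open>One repetition is enough: after Dickson's lemma a single equality of consecutive ideals
  already contradicts the minimality of an exponent.\<close>

lemma (in noetherian_ring) ascending_ideals_stabilize:
  fixes A :: "nat \<Rightarrow> 'a set"
  assumes "\<And>n. ideal (A n) R" "\<And>n. A n \<subseteq> A (Suc n)"
  shows "\<exists>n. A (Suc n) = A n"
proof -
  have mono: "A m \<subseteq> A n" if "m \<le> n" for m n
    using that assms(2) by (rule lift_Suc_mono_le[rotated])
  have "subset.chain {I. ideal I R} (range A)"
    unfolding subset_chain_def
  proof (intro conjI ballI)
    show "range A \<subseteq> {I. ideal I R}" using assms(1) by blast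
    fix X Y assume "X \<in> range A" "Y \<in> range A"
    then obtain m n where "X = A m" "Y = A n" by blast
    thus "X \<subseteq> Y \<or> Y \<subseteq> X" using mono linorder_linear[of m n] by blast
  qed
  from ideal_chain_is_trivial[OF _ this] obtain n where "\<Union>(range A) = A n"
    by auto
  hence "A (Suc n) = A n"
    using assms(2)[of n] by blast
  thus ?thesis ..
qed

section \<open>Noetherian local rings\<close>

locale noetherian_local_ring = local_ring R \<mm> + noetherian_ring R for R (structure) and \<mm>
begin

sublocale max: maximalideal \<mm> R
  by (rule maximal)

lemma one_notin_max: "\<one> \<notin> \<mm>"
  using max.I_notcarr max.one_imp_carrier by auto

text \<open>\<open>unique_maximal\<close> speaks only of ideals known to be maximal, so one above
  \<open>J\<close> has to be found. Zorn's lemma provides it: in a Noetherian ring the union of a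
  nonempty chain of ideals belongs to the chain and hence stays proper.\<close>

lemma proper_ideal_subset_max:
  assumes "ideal J R" "\<one> \<notin> J"
  shows "J \<subseteq> \<mm>"
proof -
  define S where "S = {K. ideal K R \<and> \<one> \<notin> K \<and> J \<subseteq> K}"
  have "\<exists>M\<in>S. \<forall>X\<in>S. M \<subseteq> X \<longrightarrow> X = M"
  proof (rule subset_Zorn_nonempty)
    show "S \<noteq> {}" using assms by (auto simp: S_def)
    fix C assume C: "C \<noteq> {}" "subset.chain S C"
    hence "subset.chain {I. ideal I R} C"
      unfolding subset_chain_def S_def by blast
    from ideal_chain_is_trivial[OF C(1) this] show "\<Union>C \<in> S"
      using C unfolding subset_chain_def by blast
  qed
  then obtain M where M: "M \<in> S" "\<And>X. X \<in> S \<Longrightarrow> M \<subseteq> X \<Longrightarrow> X = M" by blast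
  have "maximalideal M R"
  proof (rule maximalidealI)
    show "ideal M R" "carrier R \<noteq> M" using M(1) by (auto simp: S_def)
    fix K assume K: "ideal K R" "M \<subseteq> K" "K \<subseteq> carrier R"
    show "K = M \<or> K = carrier R"
      using M K ideal.one_imp_carrier[OF K(1)] by (auto simp: S_def)
  qed
  hence "M = \<mm>" by (rule unique_maximal)
  thus ?thesis using M(1) by (auto simp: S_def)
qed

lemma unit_if_notin_max:
  assumes "a \<in> carrier R" "a \<notin> \<mm>"
  shows "a \<in> Units R"
proof -
  have "\<one> \<in> PIdl a"
    using proper_ideal_subset_max[OF cgenideal_ideal[OF assms(1)]] cgenideal_self assms by blast
  then obtain b where "b \<in> carrier R" "\<one> = b \<otimes> a" by (auto simp: cgenideal_def)
  thus ?thesis using assms(1) by (auto simp: Units_def m_comm intro!: bexI[of _ b])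
qed

text \<open>Half of a recurring dichotomy: a coefficient in \<mm> pushes its term into the next
  power of \<mm>, and for any other coefficient this lemma solves for the term.\<close>

lemma unit_cancel:
  assumes "a \<in> carrier R" "a \<notin> \<mm>" "ideal J R" "v \<in> carrier R" "a \<otimes> v \<in> J"
  shows "v \<in> J"
proof -
  interpret J: ideal J R by fact
  have a: "a \<in> Units R" by (rule unit_if_notin_max) fact+
  have "inv a \<otimes> (a \<otimes> v) \<in> J" using a assms by (auto intro: J.I_l_closed)
  thus ?thesis using a assms by (simp add: m_assoc[symmetric])
qed

lemma one_minus_notin_max:
  assumes "a \<in> \<mm>" shows "\<one> \<ominus> a \<notin> \<mm>"
proof
  assume "\<one> \<ominus> a \<in> \<mm>"
  hence "(\<one> \<ominus> a) \<oplus> a \<in> \<mm>" using assms max.a_closed by blast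
  moreover have "(\<one> \<ominus> a) \<oplus> a = \<one>"
    using max.Icarr[OF assms] by (simp add: a_minus_def a_assoc l_neg)
  ultimately show False using one_notin_max by simp
qed

end

section \<open>Chains of ideals\<close>

text \<open>Counts strict inclusions, so it says that the length of \<open>R/A\<close> is at least
  \<open>n\<close>; the top ideal may be all of \<open>R\<close>. As a mere existence statement it
  requires neither finiteness of length nor uniqueness of composition lengths.\<close>

definition ideal_chain_above :: "('a, 'b) ring_scheme \<Rightarrow> 'a set \<Rightarrow> nat \<Rightarrow> bool"
  where "ideal_chain_above R A n \<longleftrightarrow>
    (\<exists>C. (\<forall>i\<le>n. ideal (C i) R) \<and> A \<subseteq> C 0 \<and> (\<forall>i<n. C i \<subset> C (Suc i)))"

lemma ideal_chain_above_mono: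
  assumes "ideal_chain_above R A n" "B \<subseteq> A"
  shows "ideal_chain_above R B n"
  using assms unfolding ideal_chain_above_def by (meson order_trans)

lemma chain_bot_subset:
  fixes C :: "nat \<Rightarrow> 'a set"
  assumes "\<And>i. i < n \<Longrightarrow> C i \<subset> C (Suc i)" "k \<le> n"
  shows "C 0 \<subseteq> C k"
  using assms(2)
proof (induction k)
  case (Suc k)
  thus ?case using assms(1)[of k] by auto
qed simp

context cring
begin

lemma ideal_chain_above_0:
  assumes "A \<subseteq> carrier R" shows "ideal_chain_above R A 0"
  unfolding ideal_chain_above_def using assms oneideal by auto

text \<open>Superadditivity of length for 0 -> R/(A : y) -> R/A -> R/(A + yR) -> 0, where the first
  map is multiplication by \<open>y\<close>. The chain above the colon ideal is carried to the
  ideals \<open>D i * y + A\<close>, which stay inside \<open>A + yR\<close>, and is then continued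
  by the chain above \<open>A + yR\<close>.\<close>

lemma ideal_chain_above_add:
  assumes A: "ideal A R" and y: "y \<in> carrier R"
    and p: "ideal_chain_above R (Idl (insert y A)) p"
    and q: "ideal_chain_above R (ideal_colon R A {y}) q"
  shows "ideal_chain_above R A (p + q)"
proof -
  interpret A: ideal A R by fact
  obtain C where C: "\<And>i. i \<le> p \<Longrightarrow> ideal (C i) R" "Idl (insert y A) \<subseteq> C 0"
      "\<And>i. i < p \<Longrightarrow> C i \<subset> C (Suc i)"
    using p unfolding ideal_chain_above_def by auto
  obtain D where D: "\<And>i. i \<le> q \<Longrightarrow> ideal (D i) R" "ideal_colon R A {y} \<subseteq> D 0"
      "\<And>i. i < q \<Longrightarrow> D i \<subset> D (Suc i)"
    using q unfolding ideal_chain_above_def by auto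
  define E where "E i = Idl ((\<lambda>b. b \<otimes> y) ` D i \<union> A)" for i
  have Dc: "D i \<subseteq> carrier R" if "i \<le> q" for i
    using ideal.Icarr[OF D(1)[OF that]] by blast
  have sub: "(\<lambda>b. b \<otimes> y) ` D i \<union> A \<subseteq> carrier R" if "i \<le> q" for i
    using Dc[OF that] y A.a_subset by auto
  have Eid: "ideal (E i) R" if "i \<le> q" for i
    unfolding E_def using sub[OF that] by (rule genideal_ideal)
  have yA: "insert y A \<subseteq> carrier R" using y A.a_subset by auto
  have Esub: "E i \<subseteq> Idl (insert y A)" if "i \<le> q" for i
  proof -
    interpret Y: ideal "Idl (insert y A)" R by (rule genideal_ideal[OF yA])
    show ?thesis unfolding E_def
    proof (rule genideal_minimal[OF Y.ideal_axioms])
      show "(\<lambda>b. b \<otimes> y) ` D i \<union> A \<subseteq> Idl (insert y A)"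
        using genideal_self[OF yA] Dc[OF that] Y.I_l_closed by auto
    qed
  qed
  have AE: "A \<subseteq> E i" if "i \<le> q" for i
    unfolding E_def using genideal_self[OF sub[OF that]] by auto
  have Estrict: "E i \<subset> E (Suc i)" if i: "i < q" for i
  proof -
    have "D i \<subseteq> D (Suc i)" using D(3)[OF i] by auto
    hence 1: "E i \<subseteq> E (Suc i)"
      unfolding E_def using i by (intro Idl_mono sub) auto
    obtain b where b: "b \<in> D (Suc i)" "b \<notin> D i" using D(3)[OF i] by auto
    have bc: "b \<in> carrier R" using b(1) Dc[of "Suc i"] i by auto
    have "b \<otimes> y \<in> E (Suc i)"
      unfolding E_def using genideal_self[OF sub[of "Suc i"]] i b(1) by auto
    moreover have "b \<otimes> y \<notin> E i"
    proof
      assume "b \<otimes> y \<in> E i"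
      \<comment> \<open>\<open>D i * y\<close> is already an ideal, so an element of
        \<open>E i\<close> is \<open>c * y + a\<close> with \<open>c\<close> in \<open>D i\<close>
        itself. Then \<open>(b - c) * y\<close> lies in \<open>A\<close>, which puts
        \<open>b - c\<close> into the bottom ideal \<open>D 0\<close>.\<close>
      moreover have "Idl ((\<lambda>b. b \<otimes> y) ` D i) = (\<lambda>b. b \<otimes> y) ` D i"
      proof (rule Idl_ideal)
        interpret Di: ideal "D i" R using D(1) i by simp
        show "ideal ((\<lambda>b. b \<otimes> y) ` D i) R"
        proof (rule idealI[OF ring_axioms])
          show "subgroup ((\<lambda>b. b \<otimes> y) ` D i) (add_monoid R)"
          proof (rule add.subgroupI)
            show "(\<lambda>b. b \<otimes> y) ` D i \<subseteq> carrier R" using sub[of i] i by auto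
            show "(\<lambda>b. b \<otimes> y) ` D i \<noteq> {}" using Di.zero_closed by blast
            fix a assume a: "a \<in> (\<lambda>b. b \<otimes> y) ` D i"
            then obtain a' where a': "a' \<in> D i" "a = a' \<otimes> y" by auto
            hence "\<ominus> a = (\<ominus> a') \<otimes> y" using Di.Icarr y by (simp add: l_minus)
            thus "\<ominus> a \<in> (\<lambda>b. b \<otimes> y) ` D i" using a' Di.a_inv_closed by auto
            fix b assume "b \<in> (\<lambda>b. b \<otimes> y) ` D i"
            then obtain b' where b': "b' \<in> D i" "b = b' \<otimes> y" by auto
            hence "a \<oplus> b = (a' \<oplus> b') \<otimes> y" using a' Di.Icarr y by (simp add: l_distr)
            thus "a \<oplus> b \<in> (\<lambda>b. b \<otimes> y) ` D i" using a' b' Di.a_closed by auto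
          qed
          fix a x assume a: "a \<in> (\<lambda>b. b \<otimes> y) ` D i" and x: "x \<in> carrier R"
          then obtain a' where a': "a' \<in> D i" "a = a' \<otimes> y" by auto
          hence "x \<otimes> a = (x \<otimes> a') \<otimes> y" using Di.Icarr y x by (simp add: m_assoc)
          thus 1: "x \<otimes> a \<in> (\<lambda>b. b \<otimes> y) ` D i" using a' Di.I_l_closed x by auto
          have "a \<in> carrier R" using a' Di.Icarr y by auto
          thus "a \<otimes> x \<in> (\<lambda>b. b \<otimes> y) ` D i" using 1 x by (simp add: m_comm)
        qed
      qed
      ultimately obtain c a where c: "c \<in> D i" "a \<in> A" "b \<otimes> y = c \<otimes> y \<oplus> a"
        unfolding E_def using sum_mem_Idl_Un_iff[of "(\<lambda>b. b \<otimes> y) ` D i" A "b \<otimes> y"]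
          sub[of i] i Idl_ideal[OF A.ideal_axioms] by auto
      interpret Di: ideal "D i" R using D(1) i by simp
      have cc: "c \<in> carrier R" "a \<in> carrier R" using c Di.Icarr A.Icarr by auto
      have "(b \<ominus> c) \<otimes> y = (c \<otimes> y \<oplus> a) \<ominus> c \<otimes> y"
        using cc bc y c(3) by (simp add: a_minus_def l_distr l_minus)
      also have "\<dots> = a"
        using cc y by (simp add: a_minus_def add.m_comm[of "c \<otimes> y" a] a_assoc r_neg)
      finally have "(b \<ominus> c) \<otimes> y = a" .
      hence "b \<ominus> c \<in> D 0"
        using D(2) bc cc c(2) by (auto simp: ideal_colon_def)
      moreover have "D 0 \<subseteq> D i"
        using chain_bot_subset[of q D i, OF D(3)] i by simp
      ultimately have "(b \<ominus> c) \<oplus> c \<in> D i" using c(1) Di.a_closed by blast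
      moreover have "(b \<ominus> c) \<oplus> c = b" using bc cc by (simp add: a_minus_def a_assoc l_neg)
      ultimately show False using b(2) by simp
    qed
    ultimately show ?thesis using 1 by blast
  qed
  \<comment> \<open>\<open>E q\<close> and \<open>C 0\<close> may coincide, so the concatenation
    goes from \<open>E q\<close> straight to \<open>C 1\<close>; there remain \<open>q\<close>
    inclusions among the \<open>E i\<close> and \<open>p\<close> after them.\<close>
  define F where "F i = (if i \<le> q then E i else C (i - q))" for i
  have C0: "C 0 \<subseteq> C i" if "i \<le> p" for i
    using chain_bot_subset[of p C, OF C(3) that] .
  have "F i \<subset> F (Suc i)" if i: "i < q + p" for i
  proof -
    consider "i < q" | "i = q" | "i > q" by linarith
    thus ?thesis
    proof cases
      case 1 thus ?thesis unfolding F_def using Estrict by simp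
    next
      case 2
      hence "p > 0" using i by simp
      hence "E q \<subset> C (Suc 0)" using C(2) C(3)[of 0] Esub[of q] by auto
      thus ?thesis unfolding F_def using 2 by (simp add: Suc_diff_le)
    next
      case 3
      thus ?thesis unfolding F_def using C(3)[of "i - q"] i by (simp add: Suc_diff_le)
    qed
  qed
  moreover have "ideal (F i) R" if "i \<le> q + p" for i
    unfolding F_def using that Eid C(1) by auto
  moreover have "A \<subseteq> F 0" unfolding F_def using AE by auto
  ultimately show ?thesis unfolding ideal_chain_above_def by (metis add.commute)
qed

end

context noetherian_local_ring
begin

text \<open>Since \<mm> kills \<open>v\<close> modulo \<open>A\<close>, adding \<open>v\<close>
  costs at most one unit of length. The ideals generated by \<open>C i\<close> and \<open>v\<close>
  still increase strictly, except at the single step where \<open>v\<close> enters the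
  chain.\<close>

lemma ideal_chain_above_insert:
  assumes A: "A \<subseteq> carrier R" and v: "v \<in> carrier R"
    and mv: "\<And>a. a \<in> \<mm> \<Longrightarrow> a \<otimes> v \<in> A"
    and chain: "ideal_chain_above R A (Suc n)"
  shows "ideal_chain_above R (Idl (insert v A)) n"
proof -
  obtain C where C: "\<And>i. i \<le> Suc n \<Longrightarrow> ideal (C i) R" "A \<subseteq> C 0"
      "\<And>i. i < Suc n \<Longrightarrow> C i \<subset> C (Suc i)"
    using chain unfolding ideal_chain_above_def by auto
  have Cc: "C i \<subseteq> carrier R" if "i \<le> Suc n" for i
    using ideal.Icarr[OF C(1)[OF that]] by blast
  have C0: "A \<subseteq> C i" if "i \<le> Suc n" for i
    using chain_bot_subset[of "Suc n" C, OF C(3) that] C(2) by blast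
  have strict: "Idl (insert v (C i)) \<subset> Idl (insert v (C (Suc i)))"
    if i: "i < Suc n" and "v \<notin> C (Suc i)" for i
  proof -
    interpret Ci: ideal "C i" R using C(1) i by simp
    interpret Cs: ideal "C (Suc i)" R using C(1) i by simp
    have vs: "insert v (C i) \<subseteq> carrier R" "insert v (C (Suc i)) \<subseteq> carrier R"
      using v Cc i by auto
    obtain c where c: "c \<in> C (Suc i)" "c \<notin> C i" using C(3)[OF i] by auto
    have "c \<in> Idl (insert v (C (Suc i)))" using c genideal_self[OF vs(2)] by auto
    moreover have "c \<notin> Idl (insert v (C i))"
    proof
      assume "c \<in> Idl (insert v (C i))"
      then obtain r b where rb: "r \<in> carrier R" "b \<in> C i" "c = r \<otimes> v \<oplus> b"
        using mem_Idl_insert_iff[OF v Ci.a_subset] Idl_ideal[OF Ci.ideal_axioms] by auto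
      show False
      proof (cases "r \<in> \<mm>")
        case True
        hence "r \<otimes> v \<in> C i" using mv C0[of i] i by auto
        thus False using rb c(2) Ci.a_closed by simp
      next
        case False
        have "b \<in> C (Suc i)" using rb(2) C(3)[OF i] by auto
        hence "r \<otimes> v \<in> C (Suc i)" using rb c(1) v Cs.add_mem_iff(2)[of b "r \<otimes> v"] by simp
        thus False using unit_cancel[OF rb(1) False Cs.ideal_axioms v] that(2) by blast
      qed
    qed
    moreover have "Idl (insert v (C i)) \<subseteq> Idl (insert v (C (Suc i)))"
      using C(3)[OF i] vs by (intro Idl_mono) auto
    ultimately show ?thesis by blast
  qed
  \<comment> \<open>From the step at which \<open>v\<close> enters, the index is shifted by one, so
    that the inclusion that collapses is skipped.\<close>
  define D where "D i = (if v \<in> C (Suc i) then C (Suc i) else Idl (insert v (C i)))" for i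
  have Did: "ideal (D i) R" if "i \<le> n" for i
    unfolding D_def using that C(1)[of "Suc i"] v Cc[of i] by (auto intro!: genideal_ideal)
  have "D i \<subset> D (Suc i)" if i: "i < n" for i
  proof -
    have le: "C (Suc i) \<subset> C (Suc (Suc i))" using C(3) i by simp
    have sub: "Idl (insert v (C (Suc i))) \<subseteq> C (Suc (Suc i))" if "v \<in> C (Suc (Suc i))"
      using le that i by (intro genideal_minimal C(1)) auto
    show ?thesis
      unfolding D_def using strict[of i] le sub i by auto
  qed
  moreover have "Idl (insert v A) \<subseteq> D 0"
  proof (rule genideal_minimal[OF Did])
    show "insert v A \<subseteq> D 0"
      unfolding D_def using C0[of 1] C0[of 0] genideal_self[of "insert v (C 0)"] v Cc[of 0] by auto
  qed simp
  ultimately show ?thesis unfolding ideal_chain_above_def using Did by blast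
qed

lemma ideal_chain_above_finite:
  assumes "finite V" "V \<subseteq> carrier R" "A \<subseteq> carrier R"
    and "\<And>a v. a \<in> \<mm> \<Longrightarrow> v \<in> V \<Longrightarrow> a \<otimes> v \<in> A"
    and "ideal_chain_above R A n"
  shows "ideal_chain_above R (Idl (V \<union> A)) (n - card V)"
  using assms
proof (induction V)
  case empty
  then obtain C where C: "\<And>i. i \<le> n \<Longrightarrow> ideal (C i) R" "A \<subseteq> C 0" "\<And>i. i < n \<Longrightarrow> C i \<subset> C (Suc i)"
    unfolding ideal_chain_above_def by auto
  moreover have "Idl A \<subseteq> C 0" using C by (intro genideal_minimal) auto
  ultimately show ?case unfolding ideal_chain_above_def by auto
next
  case (insert v V)
  have VA: "V \<union> A \<subseteq> carrier R" using insert.prems by auto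
  have v: "v \<in> carrier R" using insert.prems by auto
  have IH: "ideal_chain_above R (Idl (V \<union> A)) (n - card V)"
    using insert by auto
  have eq: "Idl (insert v (Idl (V \<union> A))) = Idl (insert v (V \<union> A))"
  proof (rule subset_antisym)
    have c: "insert v (V \<union> A) \<subseteq> carrier R" "insert v (Idl (V \<union> A)) \<subseteq> carrier R"
      using v VA Idl_closed[OF VA] by auto
    show "Idl (insert v (Idl (V \<union> A))) \<subseteq> Idl (insert v (V \<union> A))"
      using c Idl_mono[of "V \<union> A" "insert v (V \<union> A)"] genideal_self[OF c(1)]
      by (intro genideal_minimal genideal_ideal) auto
    show "Idl (insert v (V \<union> A)) \<subseteq> Idl (insert v (Idl (V \<union> A)))"
      using c genideal_self[OF VA] by (intro Idl_mono) auto
  qed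
  show ?case
  proof (cases "n - card V")
    \<comment> \<open>Truncated subtraction: once \<open>n\<close> is used up, the claim is the
      trivial chain without inclusions.\<close>
    case 0
    have "Idl (insert v V \<union> A) \<subseteq> carrier R"
      using Idl_closed[of "insert v V \<union> A"] v VA by auto
    moreover have "n - card (insert v V) = 0" using 0 insert.hyps by simp
    ultimately show ?thesis using ideal_chain_above_0 by simp
  next
    case (Suc k)
    have "ideal_chain_above R (Idl (insert v (Idl (V \<union> A)))) k"
    proof (rule ideal_chain_above_insert[OF _ v])
      show "Idl (V \<union> A) \<subseteq> carrier R" using Idl_closed[OF VA] by blast
      show "ideal_chain_above R (Idl (V \<union> A)) (Suc k)" using IH Suc by simp
      fix a assume "a \<in> \<mm>"
      thus "a \<otimes> v \<in> Idl (V \<union> A)" using insert.prems(3) genideal_self[OF VA] insert.prems by auto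
    qed
    moreover have "k = n - card (insert v V)" using Suc insert.hyps by simp
    ultimately show ?thesis using eq by simp
  qed
qed

end

section \<open>Exponent vectors\<close>

text \<open>Total functions that vanish from \<open>d\<close> on, so that pointwise addition and the
  lexicographic order \<open>less_fun\<close> apply as they stand.\<close>

definition exponents :: "nat \<Rightarrow> (nat \<Rightarrow> nat) set"
  where "exponents d = {u. \<forall>i\<ge>d. u i = 0}"

definition degree :: "nat \<Rightarrow> (nat \<Rightarrow> nat) \<Rightarrow> nat"
  where "degree d u = sum u {..<d}"

definition exponents_deg :: "nat \<Rightarrow> nat \<Rightarrow> (nat \<Rightarrow> nat) set"
  where "exponents_deg d n = {u \<in> exponents d. degree d u = n}"

definition single_exponent :: "nat \<Rightarrow> nat \<Rightarrow> nat \<Rightarrow> nat"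
  where "single_exponent j N = (\<lambda>i. if i = j then N else 0)"

lemma exponents_add: "u \<in> exponents d \<Longrightarrow> v \<in> exponents d \<Longrightarrow> u + v \<in> exponents d"
  by (simp add: exponents_def)

lemma degree_add: "degree d (u + v) = degree d u + degree d v"
  by (simp add: degree_def sum.distrib)

lemma exponents_deg_add:
  "u \<in> exponents_deg d m \<Longrightarrow> v \<in> exponents_deg d n \<Longrightarrow> u + v \<in> exponents_deg d (m + n)"
  by (simp add: exponents_deg_def exponents_add degree_add)

lemma single_exponent_in: "j < d \<Longrightarrow> single_exponent j N \<in> exponents_deg d N"
  by (auto simp: exponents_deg_def exponents_def degree_def single_exponent_def)

lemma exponents_deg_subset: "exponents_deg d n \<subseteq> exponents d"
  by (auto simp: exponents_deg_def)

lemma exponents_le_degree: "u \<in> exponents d \<Longrightarrow> u i \<le> degree d u"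
  unfolding exponents_def degree_def
  by (cases "i < d") (auto intro: member_le_sum)

lemma finite_exponents_deg: "finite (exponents_deg d n)"
proof (rule finite_subset)
  show "exponents_deg d n \<subseteq> {u. \<forall>i. (i \<in> {..<d} \<longrightarrow> u i \<in> {..n}) \<and> (i \<notin> {..<d} \<longrightarrow> u i = 0)}"
    using exponents_le_degree by (auto simp: exponents_deg_def exponents_def)
  show "finite \<dots>" by (rule finite_set_of_finite_funs) auto
qed

lemma card_exponents_box:
  assumes "\<And>j. j < d \<Longrightarrow> finite (A j)"
  shows "finite {u \<in> exponents d. \<forall>j<d. u j \<in> A j}" (is "finite ?S")
    and "card {u \<in> exponents d. \<forall>j<d. u j \<in> A j} \<le> (\<Prod>j<d. card (A j))"
proof -
  have inj: "inj_on (\<lambda>u. restrict u {..<d}) ?S"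
  proof (rule inj_onI)
    fix u v assume *: "u \<in> ?S" "v \<in> ?S" "restrict u {..<d} = restrict v {..<d}"
    show "u = v"
    proof
      fix i show "u i = v i"
      proof (cases "i < d")
        case True
        have "restrict u {..<d} i = restrict v {..<d} i" using *(3) by simp
        thus ?thesis using True by simp
      qed (use *(1,2) in \<open>simp add: exponents_def\<close>)
    qed
  qed
  have sub: "(\<lambda>u. restrict u {..<d}) ` ?S \<subseteq> PiE {..<d} A"
    by (rule image_subsetI, subst restrict_PiE_iff) simp
  have fin: "finite (PiE {..<d} A)" using assms by (intro finite_PiE) auto
  show "finite ?S" using inj sub fin by (meson finite_imageD finite_subset)
  have "card ?S \<le> card (PiE {..<d} A)" by (rule card_inj_on_le[OF inj sub fin])
  thus "card ?S \<le> (\<Prod>j<d. card (A j))" by (simp add: card_PiE)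
qed

lemma less_fun_add: "less_fun u v \<Longrightarrow> less_fun (u + w) (v + w)" for u v w :: "nat \<Rightarrow> nat"
  unfolding less_fun_def by auto

lemma less_fun_exponents_total:
  assumes "u \<in> exponents d" "v \<in> exponents d" "u \<noteq> v"
  shows "less_fun u v \<or> less_fun v u"
proof -
  have "{k. u k \<noteq> v k} \<subseteq> {..<d}"
  proof
    fix k assume "k \<in> {k. u k \<noteq> v k}"
    thus "k \<in> {..<d}" using assms(1,2) by (cases "k < d") (auto simp: exponents_def)
  qed
  hence "finite {k. u k \<noteq> v k}" using finite_subset by blast
  thus ?thesis using less_fun_trichotomy[of u v] assms(3) by blast
qed

lemma exponents_lex_least:
  assumes "finite V" "V \<noteq> {}" "V \<subseteq> exponents d"
  obtains u where "u \<in> V" "\<And>v. v \<in> V \<Longrightarrow> v \<noteq> u \<Longrightarrow> less_fun u v"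
proof -
  have "asymp_on V (less_fun :: (nat \<Rightarrow> nat) \<Rightarrow> _)" by (intro asymp_onI less_fun_asym)
  moreover have "transp_on V (less_fun :: (nat \<Rightarrow> nat) \<Rightarrow> _)"
    by (intro transp_onI) (rule less_fun_trans)
  ultimately obtain u where u: "u \<in> V" "\<forall>v\<in>V. v \<noteq> u \<longrightarrow> \<not> less_fun v u"
    using Finite_Set.bex_min_element[OF assms(1) _ _ assms(2)] by blast
  have "less_fun u v" if "v \<in> V" "v \<noteq> u" for v
    using that u assms(3) less_fun_exponents_total[of u d v] by auto
  with u(1) show ?thesis by (rule that)
qed

section \<open>Dickson's lemma\<close>

lemma nat_seq_incseq_subseq:
  fixes s :: "nat \<Rightarrow> nat"
  shows "\<exists>r. strict_mono r \<and> (\<forall>k. s (r k) \<le> s (r (Suc k)))"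
proof -
  obtain f where f: "strict_mono f" "monoseq (\<lambda>n. s (f n))"
    using seq_monosub[of s] by blast
  from f(2) consider "\<And>m n. m \<le> n \<Longrightarrow> s (f m) \<le> s (f n)" | "\<And>m n. m \<le> n \<Longrightarrow> s (f n) \<le> s (f m)"
    unfolding monoseq_def by blast
  thus ?thesis
  proof cases
    case 1
    thus ?thesis using f(1) by (intro exI[of _ f]) auto
  next
    case 2
    \<comment> \<open>From an index at which the minimum is attained, a nonincreasing sequence is
      constant.\<close>
    obtain k0 where k0: "\<And>k. s (f k0) \<le> s (f k)"
      using ex_has_least_nat[of "\<lambda>_. True" _ "\<lambda>k. s (f k)"] by auto
    have "strict_mono (\<lambda>k. f (k + k0))" using f(1) by (simp add: strict_mono_def)
    moreover have "s (f (k + k0)) \<le> s (f (Suc k + k0))" for k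
      using 2[of k0 "k + k0"] k0[of "Suc k + k0"] by simp
    ultimately show ?thesis by (intro exI[of _ "\<lambda>k. f (k + k0)"]) auto
  qed
qed

lemma dickson:
  fixes s :: "nat \<Rightarrow> nat \<Rightarrow> nat"
  shows "\<exists>r. strict_mono r \<and> (\<forall>i<d. \<forall>k. s (r k) i \<le> s (r (Suc k)) i)"
proof (induction d)
  case 0
  show ?case by (intro exI[of _ id]) (simp add: strict_mono_def)
next
  case (Suc d)
  then obtain r where r: "strict_mono r" "\<And>i k. i < d \<Longrightarrow> s (r k) i \<le> s (r (Suc k)) i" by blast
  obtain f where f: "strict_mono f" "\<And>k. s (r (f k)) d \<le> s (r (f (Suc k))) d"
    using nat_seq_incseq_subseq[of "\<lambda>k. s (r k) d"] by blast
  have "s (r (f k)) i \<le> s (r (f (Suc k))) i" if "i < d" for i k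
    using lift_Suc_mono_le[of "\<lambda>k. s (r k) i" "f k" "f (Suc k)"] r(2)[OF that] f(1)
    by (simp add: strict_mono_less_eq)
  hence "s (r (f k)) i \<le> s (r (f (Suc k))) i" if "i < Suc d" for i k
    using that f(2) less_Suc_eq by auto
  moreover have "strict_mono (r \<circ> f)" using r(1) f(1) by (rule strict_mono_o)
  ultimately show ?case unfolding comp_def by (intro exI[of _ "\<lambda>k. r (f k)"]) auto
qed

text \<open>\<open>N\<close> collects the exponents that have no other exponent below them with the
  same value of \<open>L\<close>. An infinite \<open>N\<close> would contain, by Dickson's lemma, a
  sequence of distinct exponents each of which divides the next; the chain condition makes
  \<open>L\<close> repeat a value there, against minimality. The constant \<open>c\<close> bounds
  the degrees in the finite set \<open>N\<close> and becomes the Artin-Rees constant.\<close>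

lemma monotone_on_exponents_finitely_determined:
  fixes L :: "(nat \<Rightarrow> nat) \<Rightarrow> 'b set"
  assumes mono: "\<And>u v. u \<in> exponents d \<Longrightarrow> v \<in> exponents d \<Longrightarrow> L u \<subseteq> L (u + v)"
    and acc: "\<And>s :: nat \<Rightarrow> nat \<Rightarrow> nat. (\<And>k. s k \<in> exponents d) \<Longrightarrow>
      (\<And>k. L (s k) \<subseteq> L (s (Suc k))) \<Longrightarrow> \<exists>k. L (s (Suc k)) = L (s k)"
  shows "\<exists>c. \<forall>u\<in>exponents d. \<exists>t\<in>exponents d. \<exists>v\<in>exponents d.
    u = t + v \<and> degree d t \<le> c \<and> L t = L u"
proof -
  define N where "N = {u \<in> exponents d. \<forall>t\<in>exponents d. \<forall>v\<in>exponents d. u = t + v \<longrightarrow> L t = L u \<longrightarrow> t = u}"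
  have split: "\<exists>v\<in>exponents d. u = t + v"
    if "t \<in> exponents d" "u \<in> exponents d" "\<And>i. i < d \<Longrightarrow> t i \<le> u i" for t u
  proof
    show "u = t + (\<lambda>i. u i - t i)"
    proof
      fix i show "u i = (t + (\<lambda>i. u i - t i)) i"
        using that by (cases "i < d") (auto simp: exponents_def)
    qed
    show "(\<lambda>i. u i - t i) \<in> exponents d" using that by (auto simp: exponents_def)
  qed
  have "finite N"
  proof (rule ccontr)
    assume "infinite N"
    then obtain s :: "nat \<Rightarrow> nat \<Rightarrow> nat" where s: "inj s" "range s \<subseteq> N"
      using infinite_countable_subset by blast
    obtain r where r: "strict_mono r" "\<And>i k. i < d \<Longrightarrow> s (r k) i \<le> s (r (Suc k)) i"
      using dickson[of d s] by blast
    have sN: "s k \<in> N" for k using s by auto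
    hence sE: "s k \<in> exponents d" for k by (auto simp: N_def)
    have sp: "\<exists>v\<in>exponents d. s (r (Suc k)) = s (r k) + v" for k
      by (rule split) (use sE r(2) in auto)
    hence "L (s (r k)) \<subseteq> L (s (r (Suc k)))" for k using mono sE by metis
    with acc[of "\<lambda>k. s (r k)"] sE obtain k where k: "L (s (r (Suc k))) = L (s (r k))" by auto
    have "\<forall>t\<in>exponents d. \<forall>v\<in>exponents d. s (r (Suc k)) = t + v \<longrightarrow>
        L t = L (s (r (Suc k))) \<longrightarrow> t = s (r (Suc k))"
      using sN[of "r (Suc k)"] by (simp add: N_def)
    hence "s (r k) = s (r (Suc k))" using k sE sp[of k] by metis
    hence "r k = r (Suc k)" using s(1) by (simp add: inj_eq)
    thus False using r(1) by (metis n_not_Suc_n strict_mono_eq)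
  qed
  then obtain c where c: "\<And>t. t \<in> N \<Longrightarrow> degree d t \<le> c"
    using finite_nat_set_iff_bounded_le[of "degree d ` N"] by auto
  have "\<exists>t\<in>N. \<exists>v\<in>exponents d. u = t + v \<and> L t = L u" if "u \<in> exponents d" for u
    using that
  proof (induction "degree d u" arbitrary: u rule: less_induct)
    case less
    show ?case
    proof (cases "u \<in> N")
      case True
      have "(0 :: nat \<Rightarrow> nat) \<in> exponents d" by (simp add: exponents_def)
      thus ?thesis using True by (intro bexI[of _ u] bexI[of _ 0]) auto
    next
      case False
      then obtain t v where tv: "t \<in> exponents d" "v \<in> exponents d" "u = t + v" "L t = L u" "t \<noteq> u"
        using less.prems by (auto simp: N_def)
      have "v \<noteq> 0" using tv by auto
      then obtain i where i: "v i \<noteq> 0" by (auto simp: fun_eq_iff)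
      have "degree d v > 0" using exponents_le_degree[OF tv(2), of i] i by simp
      hence "degree d t < degree d u" using tv(3) degree_add by simp
      then obtain t' v' where t': "t' \<in> N" "v' \<in> exponents d" "t = t' + v'" "L t' = L t"
        using less.hyps tv(1) by blast
      have "u = t' + (v' + v)" using t' tv by (simp add: add.assoc)
      thus ?thesis using t' tv exponents_add by metis
    qed
  qed
  moreover have "N \<subseteq> exponents d" by (auto simp: N_def)
  ultimately show ?thesis using c by (intro exI[of _ c]) blast
qed

section \<open>Monomials in generators of the maximal ideal\<close>

locale generated_local_ring = noetherian_local_ring R \<mm> for R (structure) and \<mm> +
  fixes x :: "nat \<Rightarrow> 'a" and d :: nat
  assumes x_closed: "i < d \<Longrightarrow> x i \<in> carrier R"
    and max_eq: "\<mm> = Idl (x ` {..<d})"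
begin

definition mon :: "(nat \<Rightarrow> nat) \<Rightarrow> 'a"
  where "mon u = (\<Otimes>i\<in>{..<d}. x i [^] u i)"

lemma mon_closed [simp, intro]: "mon u \<in> carrier R"
  unfolding mon_def using x_closed by (intro finprod_closed) auto

lemma mon_image_closed [simp, intro]: "mon ` V \<subseteq> carrier R"
  by auto

lemma mon_add: "mon (u + v) = mon u \<otimes> mon v"
proof -
  have "mon (u + v) = (\<Otimes>i\<in>{..<d}. x i [^] u i \<otimes> x i [^] v i)"
    unfolding mon_def using x_closed by (intro finprod_cong') (auto simp: nat_pow_mult)
  also have "\<dots> = mon u \<otimes> mon v"
    unfolding mon_def using x_closed by (intro finprod_multf) auto
  finally show ?thesis .
qed

lemma mon_single: "j < d \<Longrightarrow> mon (single_exponent j N) = x j [^] N"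
proof -
  assume j: "j < d"
  have "mon (single_exponent j N) = (\<Otimes>i\<in>{..<d}. if j = i then x j [^] N else \<one>)"
    unfolding mon_def single_exponent_def using x_closed j by (intro finprod_cong') auto
  also have "\<dots> = x j [^] N"
    using x_closed j by (intro finprod_singleton) auto
  finally show ?thesis .
qed

lemma pow_ideal [simp, intro]: "ideal (ideal_pow R \<mm> n) R"
  by (rule ideal_pow_ideal[OF max.is_ideal])

lemma pow_closed: "ideal_pow R \<mm> n \<subseteq> carrier R"
  using ideal_pow_closed[OF max.is_ideal] by blast

lemma max_pow_eq: "ideal_pow R \<mm> n = Idl (mon ` exponents_deg d n)"
proof (induction n)
  case 0
  have "(\<lambda>_. 0) \<in> exponents_deg d 0" by (auto simp: exponents_deg_def exponents_def degree_def)
  moreover have "mon (\<lambda>_. 0) = \<one>" unfolding mon_def using x_closed by (simp add: finprod_one_eqI)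
  ultimately have "\<one> \<in> mon ` exponents_deg d 0" by force
  hence "\<one> \<in> Idl (mon ` exponents_deg d 0)" using genideal_self[OF mon_image_closed] by blast
  thus ?case
    using ideal.one_imp_carrier[OF genideal_ideal[OF mon_image_closed]] by (simp only: ideal_pow_0)
next
  case (Suc n)
  have xc: "x ` {..<d} \<subseteq> carrier R" using x_closed by auto
  have id: "ideal (Idl (mon ` exponents_deg d n)) R" for n by (rule genideal_ideal[OF mon_image_closed])
  show ?case unfolding ideal_pow_Suc Suc
  proof
    show "ideal_prod R (Idl (mon ` exponents_deg d n)) \<mm> \<subseteq> Idl (mon ` exponents_deg d (Suc n))"
    proof (rule ideal_prod_subsetI[OF id])
      fix a b assume ab: "a \<in> Idl (mon ` exponents_deg d n)" "b \<in> \<mm>"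
      show "a \<otimes> b \<in> Idl (mon ` exponents_deg d (Suc n))"
      proof (rule Idl_mult_Idl_mem[OF id mon_image_closed xc _ ab(1) ab(2)[unfolded max_eq]])
        fix s t assume "s \<in> mon ` exponents_deg d n" "t \<in> x ` {..<d}"
        then obtain u j where "s = mon u" "u \<in> exponents_deg d n" "t = x j" "j < d" by auto
        moreover from this have "s \<otimes> t = mon (u + single_exponent j 1)"
          using mon_single[of j 1] x_closed by (simp add: mon_add)
        ultimately have "s \<otimes> t \<in> mon ` exponents_deg d (Suc n)"
          using exponents_deg_add[of u d n "single_exponent j 1" 1] single_exponent_in by auto
        thus "s \<otimes> t \<in> Idl (mon ` exponents_deg d (Suc n))"
          using genideal_self[OF mon_image_closed] by blast
      qed
    qed
    show "Idl (mon ` exponents_deg d (Suc n)) \<subseteq> ideal_prod R (Idl (mon ` exponents_deg d n)) \<mm>"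
    proof (rule genideal_minimal[OF ideal_prod_is_ideal[OF id max.is_ideal]]; rule)
      fix a assume "a \<in> mon ` exponents_deg d (Suc n)"
      then obtain u where u: "u \<in> exponents_deg d (Suc n)" "a = mon u" by auto
      have "\<exists>j<d. u j > 0"
      proof (rule ccontr)
        assume "\<not> (\<exists>j<d. u j > 0)"
        hence "degree d u = 0" by (auto simp: degree_def)
        thus False using u by (simp add: exponents_deg_def)
      qed
      then obtain j where j: "j < d" "u j > 0" by blast
      define v where "v = (\<lambda>i. if i = j then u j - 1 else u i)"
      have eq: "u = v + single_exponent j 1"
        using j by (auto simp: v_def single_exponent_def fun_eq_iff)
      have "v \<in> exponents d" using u j by (auto simp: v_def exponents_def exponents_deg_def)
      moreover have "degree d v + 1 = degree d u"
        using eq degree_add[of d v "single_exponent j 1"] single_exponent_in[OF j(1), of 1]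
        by (simp add: exponents_deg_def)
      ultimately have "v \<in> exponents_deg d n" using u by (simp add: exponents_deg_def)
      hence "mon v \<in> Idl (mon ` exponents_deg d n)" using genideal_self[OF mon_image_closed] by blast
      moreover have "x j \<in> \<mm>" unfolding max_eq using genideal_self[OF xc] j by auto
      moreover have "a = mon v \<otimes> x j"
        using u eq mon_single[OF j(1), of 1] x_closed[OF j(1)] mon_add[of v "single_exponent j 1"] by simp
      ultimately show "a \<in> ideal_prod R (Idl (mon ` exponents_deg d n)) \<mm>"
        by (auto intro: ideal_prod.prod)
    qed
  qed
qed

lemma mon_in_pow: "u \<in> exponents_deg d n \<Longrightarrow> mon u \<in> ideal_pow R \<mm> n"
  unfolding max_pow_eq using genideal_self[OF mon_image_closed] by blast

section \<open>Lexicographic coefficient ideals and the Artin-Rees lemma\<close>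

definition lex_above :: "(nat \<Rightarrow> nat) \<Rightarrow> (nat \<Rightarrow> nat) set"
  where "lex_above u = {v \<in> exponents_deg d (degree d u). less_fun u v}"

lemma lex_above_add:
  assumes "v \<in> lex_above u" "w \<in> exponents d"
  shows "v + w \<in> lex_above (u + w)"
  using assms unfolding lex_above_def exponents_deg_def
  by (auto simp: exponents_add degree_add less_fun_add)

lemma Idl_lex_above_mult:
  assumes "a \<in> Idl (mon ` lex_above u)" "w \<in> exponents d"
  shows "a \<otimes> mon w \<in> Idl (mon ` lex_above (u + w))"
proof (rule Idl_mult_mem[OF _ _ _ _ assms(1)])
  show "ideal (Idl (mon ` lex_above (u + w))) R" by (rule genideal_ideal) auto
  fix b assume "b \<in> mon ` lex_above u"
  hence "b \<otimes> mon w \<in> mon ` lex_above (u + w)"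
    using lex_above_add[OF _ assms(2)] by (auto simp: mon_add[symmetric])
  thus "b \<otimes> mon w \<in> Idl (mon ` lex_above (u + w))" using genideal_self[OF mon_image_closed] by blast
qed auto

text \<open>The coefficients at \<open>mon u\<close> of the elements of \<open>B\<close> that are lex-lowest there form an ideal
  growing with \<open>u\<close>; by Noetherianity and Dickson's lemma finitely many of these ideals suffice.\<close>

lemma artin_rees:
  assumes B: "ideal B R"
  shows "\<exists>c. \<forall>n. B \<inter> ideal_pow R \<mm> n \<subseteq> ideal_prod R (ideal_pow R \<mm> (n - c)) B"
proof -
  interpret B: ideal B R by fact
  have Bc: "B \<subseteq> carrier R" by (rule B.a_subset)
  define L where "L u = ideal_colon R (Idl (B \<union> mon ` lex_above u)) {mon u}" for u
  have gens: "B \<union> mon ` V \<subseteq> carrier R" for V using Bc by auto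
  have BM: "ideal (Idl (B \<union> mon ` V)) R" for V using gens by (rule genideal_ideal)
  have L_ideal: "ideal (L u) R" for u
    unfolding L_def by (rule ideal_colon_ideal[OF BM]) auto
  have L_mono: "L u \<subseteq> L (u + w)" if "w \<in> exponents d" for u w
  proof
    fix a assume "a \<in> L u"
    hence a: "a \<in> carrier R" "a \<otimes> mon u \<in> Idl (B \<union> mon ` lex_above u)"
      by (auto simp: L_def ideal_colon_def)
    have "(a \<otimes> mon u) \<otimes> mon w \<in> Idl (B \<union> mon ` lex_above (u + w))"
    proof (rule Idl_mult_mem[OF BM gens _ _ a(2)])
      fix b assume "b \<in> B \<union> mon ` lex_above u"
      hence "b \<otimes> mon w \<in> B \<union> mon ` lex_above (u + w)"
        using lex_above_add[OF _ that] B.I_r_closed by (auto simp: mon_add[symmetric])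
      thus "b \<otimes> mon w \<in> Idl (B \<union> mon ` lex_above (u + w))" using genideal_self[OF gens] by blast
    qed auto
    thus "a \<in> L (u + w)" using a(1) by (simp add: L_def ideal_colon_def mon_add m_assoc)
  qed
  obtain c where c: "\<And>u. u \<in> exponents d \<Longrightarrow> \<exists>t\<in>exponents d. \<exists>v\<in>exponents d.
      u = t + v \<and> degree d t \<le> c \<and> L t = L u"
    using monotone_on_exponents_finitely_determined[of d L, OF L_mono ascending_ideals_stabilize[OF L_ideal]]
    by blast
  \<comment> \<open>\<open>W\<close> is an upper set of the lexicographic order in degree
    \<open>n\<close>, so removing its lowest exponent \<open>u\<close> leaves exactly
    \<open>lex_above u\<close>, and the induction peels off one exponent at a time. The lemma is the
    case where \<open>W\<close> consists of all exponents of degree \<open>n\<close>.\<close>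
  have main: "b \<in> ideal_prod R (ideal_pow R \<mm> (n - c)) B"
    if "W \<subseteq> exponents_deg d n" "\<And>u v. u \<in> W \<Longrightarrow> v \<in> lex_above u \<Longrightarrow> v \<in> W"
      "b \<in> B" "b \<in> Idl (mon ` W)" for n W b
    using that
  proof (induction "card W" arbitrary: W b rule: less_induct)
    case less
    let ?P = "ideal_prod R (ideal_pow R \<mm> (n - c)) B"
    interpret P: ideal ?P R by (rule ideal_prod_is_ideal[OF pow_ideal B])
    have fin: "finite W" using less.prems(1) finite_exponents_deg finite_subset by blast
    show ?case
    proof (cases "W = {}")
      case True
      have "Idl {} \<subseteq> {\<zero>}" by (rule genideal_minimal[OF zeroideal]) auto
      thus ?thesis using less.prems(4) True P.zero_closed by auto
    next
      case False
      obtain u where u: "u \<in> W" "\<And>v. v \<in> W \<Longrightarrow> v \<noteq> u \<Longrightarrow> less_fun u v"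
        using exponents_lex_least[OF fin False] less.prems(1) exponents_deg_subset by blast
      have degu: "degree d u = n" "u \<in> exponents d" using u(1) less.prems(1) by (auto simp: exponents_deg_def)
      have la: "lex_above u = W - {u}"
      proof
        show "lex_above u \<subseteq> W - {u}"
          using less.prems(2)[OF u(1)] less_fun_irrefl[of u] by (auto simp: lex_above_def)
        show "W - {u} \<subseteq> lex_above u"
          using u(2) less.prems(1) degu by (auto simp: lex_above_def)
      qed
      have ideal_la: "ideal (Idl (mon ` lex_above v)) R" for v by (rule genideal_ideal) auto
      interpret lu: ideal "Idl (mon ` lex_above u)" R by (rule ideal_la)
      have "mon ` W = insert (mon u) (mon ` lex_above u)" using la u(1) by auto
      then obtain r s where r: "r \<in> carrier R" and s: "s \<in> Idl (mon ` lex_above u)"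
          and b: "b = r \<otimes> mon u \<oplus> s"
        using less.prems(4) mem_Idl_insert_iff[of "mon u" "mon ` lex_above u" b] by auto
      have sc: "s \<in> carrier R" using s lu.Icarr by blast
      have bc: "b \<in> carrier R" using b r sc by simp
      have "r \<otimes> mon u = b \<oplus> (\<ominus> s)"
        using b r sc by (simp add: a_assoc r_neg)
      moreover have "b \<in> Idl B" using less.prems(3) Idl_ideal[OF B] by simp
      moreover have "\<ominus> s \<in> Idl (mon ` lex_above u)" using s by simp
      ultimately have "r \<otimes> mon u \<in> Idl (B \<union> mon ` lex_above u)"
        using sum_mem_Idl_Un_iff[OF Bc mon_image_closed] by blast
      hence "r \<in> L u" using r by (simp add: L_def ideal_colon_def)
      moreover obtain t v where tv: "t \<in> exponents d" "v \<in> exponents d" "u = t + v"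
          "degree d t \<le> c" "L t = L u"
        using c[OF degu(2)] by blast
      ultimately have "r \<in> L t" by simp
      \<comment> \<open>The coefficient \<open>r\<close> is already realised at the smaller exponent
        \<open>t\<close> by some \<open>bt\<close> in \<open>B\<close>. Subtracting
        \<open>bt \<otimes> mon v\<close> from \<open>b\<close> removes the term at
        \<open>u\<close>, and \<open>v\<close> has degree at least \<open>n - c\<close>.\<close>
      hence "r \<otimes> mon t \<in> Idl (B \<union> mon ` lex_above t)"
        by (simp add: L_def ideal_colon_def)
      then obtain bt st where bt: "bt \<in> B" and st: "st \<in> Idl (mon ` lex_above t)"
          and eq: "r \<otimes> mon t = bt \<oplus> st"
        using sum_mem_Idl_Un_iff[OF Bc mon_image_closed] Idl_ideal[OF B] by metis
      have btc: "bt \<in> carrier R" "st \<in> carrier R" using bt st B.Icarr ideal.Icarr[OF ideal_la] by auto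
      have "r \<otimes> mon u = (r \<otimes> mon t) \<otimes> mon v" using r tv(3) by (simp add: mon_add m_assoc)
      also have "\<dots> = bt \<otimes> mon v \<oplus> st \<otimes> mon v" using eq btc by (simp add: l_distr)
      finally have b2: "b = bt \<otimes> mon v \<oplus> (st \<otimes> mon v \<oplus> s)"
        using b btc sc by (simp add: a_assoc)
      define b' where "b' = st \<otimes> mon v \<oplus> s"
      have "st \<otimes> mon v \<in> Idl (mon ` lex_above u)"
        using Idl_lex_above_mult[OF st tv(2)] tv(3) by simp
      hence b'l: "b' \<in> Idl (mon ` lex_above u)" unfolding b'_def using s by simp
      have "b' \<in> carrier R" using b'l lu.Icarr by blast
      moreover have "bt \<otimes> mon v \<in> B" using bt B.I_r_closed by simp
      ultimately have b'B: "b' \<in> B"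
        using b2 less.prems(3) B.add_mem_iff(1)[of "bt \<otimes> mon v" b'] by (simp add: b'_def)
      have "b' \<in> ?P"
      proof (rule less.hyps[OF _ _ _ b'B b'l])
        show "card (lex_above u) < card W" unfolding la using u(1) fin by (rule card_Diff1_less[rotated])
        show "lex_above u \<subseteq> exponents_deg d n" using la less.prems(1) by auto
        fix w z assume wz: "w \<in> lex_above u" "z \<in> lex_above w"
        hence "z \<in> W" using la less.prems(2) by blast
        moreover have "z \<noteq> u"
          using wz less_fun_asym[of u w] by (auto simp: lex_above_def)
        ultimately show "z \<in> lex_above u" using la by auto
      qed
      moreover have "bt \<otimes> mon v \<in> ?P"
      proof -
        have "n = degree d t + degree d v" using degu tv(3) degree_add by metis
        hence "n - c \<le> degree d v" using tv(4) by simp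
        hence "mon v \<in> ideal_pow R \<mm> (n - c)"
          using mon_in_pow[of v "degree d v"] tv(2) ideal_pow_antimono[OF max.is_ideal, of "n - c" "degree d v"]
          by (auto simp: exponents_deg_def)
        hence "mon v \<otimes> bt \<in> ?P" using bt by (rule ideal_prod.prod)
        thus ?thesis using btc by (simp add: m_comm)
      qed
      ultimately show ?thesis using b2 b'_def by simp
    qed
  qed
  have "B \<inter> ideal_pow R \<mm> n \<subseteq> ideal_prod R (ideal_pow R \<mm> (n - c)) B" for n
    using main[of "exponents_deg d n" n] unfolding max_pow_eq[of n] by (auto simp: lex_above_def exponents_deg_def)
  thus ?thesis by blast
qed

text \<open>Artin-Rees for the ideal \<open>P + yR\<close>: write \<open>z * y = p + q\<close> with
  \<open>q\<close> in \<open>\<mm>^n\<close>. Then \<open>q\<close> also lies in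
  \<open>P + yR\<close>, so \<open>q = w * y + p'\<close> with \<open>w\<close> in
  \<open>\<mm>^(n - c)\<close>, and primality removes \<open>y\<close> from
  \<open>(z - w) * y\<close>, an element of \<open>P\<close>.\<close>

lemma prime_colon_pow:
  assumes P: "primeideal P R" and y: "y \<in> carrier R" "y \<notin> P"
  shows "\<exists>c. \<forall>n z. z \<in> carrier R \<longrightarrow> z \<otimes> y \<in> Idl (P \<union> ideal_pow R \<mm> n) \<longrightarrow>
    z \<in> Idl (P \<union> ideal_pow R \<mm> (n - c))"
proof -
  interpret P: primeideal P R by fact
  have yP: "insert y P \<subseteq> carrier R" using y P.a_subset by auto
  interpret B: ideal "Idl (insert y P)" R by (rule genideal_ideal[OF yP])
  have PB: "P \<subseteq> Idl (insert y P)" "y \<in> Idl (insert y P)" using genideal_self[OF yP] by auto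
  obtain c where c: "\<And>n. Idl (insert y P) \<inter> ideal_pow R \<mm> n
      \<subseteq> ideal_prod R (ideal_pow R \<mm> (n - c)) (Idl (insert y P))"
    using artin_rees[OF B.ideal_axioms] by blast
  have prod: "\<exists>w\<in>ideal_pow R \<mm> k. \<exists>p\<in>P. s = w \<otimes> y \<oplus> p"
    if "s \<in> ideal_prod R (ideal_pow R \<mm> k) (Idl (insert y P))" for s k
    using that
  proof induction
    case (prod i j)
    then obtain r p where rp: "r \<in> carrier R" "p \<in> P" "j = r \<otimes> y \<oplus> p"
      using mem_Idl_insert_iff[OF y(1) P.a_subset] Idl_ideal[OF P.ideal_axioms] by auto
    interpret k: ideal "ideal_pow R \<mm> k" R by (rule pow_ideal)
    have "i \<in> carrier R" "p \<in> carrier R" using prod rp k.Icarr P.Icarr by auto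
    hence "i \<otimes> j = (i \<otimes> r) \<otimes> y \<oplus> i \<otimes> p" using rp y by (simp add: r_distr m_assoc)
    moreover have "i \<otimes> r \<in> ideal_pow R \<mm> k" using prod rp k.I_r_closed by simp
    moreover have "i \<otimes> p \<in> P" using rp \<open>i \<in> carrier R\<close> P.I_l_closed by simp
    ultimately show ?case by blast
  next
    case (sum s1 s2)
    interpret k: ideal "ideal_pow R \<mm> k" R by (rule pow_ideal)
    from sum obtain w1 p1 w2 p2 where *: "w1 \<in> ideal_pow R \<mm> k" "p1 \<in> P" "s1 = w1 \<otimes> y \<oplus> p1"
        "w2 \<in> ideal_pow R \<mm> k" "p2 \<in> P" "s2 = w2 \<otimes> y \<oplus> p2" by blast
    hence cc: "w1 \<in> carrier R" "w2 \<in> carrier R" "p1 \<in> carrier R" "p2 \<in> carrier R"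
      using k.Icarr P.Icarr by auto
    have "s1 \<oplus> s2 = (w1 \<oplus> w2) \<otimes> y \<oplus> (p1 \<oplus> p2)"
      unfolding * using cc y by (simp add: l_distr a_ac)
    moreover have "w1 \<oplus> w2 \<in> ideal_pow R \<mm> k" "p1 \<oplus> p2 \<in> P" using * k.a_closed P.a_closed by auto
    ultimately show ?case by blast
  qed
  have "z \<in> Idl (P \<union> ideal_pow R \<mm> (n - c))"
    if z: "z \<in> carrier R" "z \<otimes> y \<in> Idl (P \<union> ideal_pow R \<mm> n)" for n z
  proof -
    interpret n: ideal "ideal_pow R \<mm> n" R by (rule pow_ideal)
    interpret k: ideal "ideal_pow R \<mm> (n - c)" R by (rule pow_ideal)
    obtain p q where pq: "p \<in> P" "q \<in> ideal_pow R \<mm> n" "z \<otimes> y = p \<oplus> q"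
      using z sum_mem_Idl_Un_iff[OF P.a_subset n.a_subset] Idl_ideal[OF P.ideal_axioms]
        Idl_ideal[OF n.ideal_axioms] by metis
    have pqc: "p \<in> carrier R" "q \<in> carrier R" using pq P.Icarr n.Icarr by auto
    have "z \<otimes> y \<in> Idl (insert y P)" using PB z B.I_l_closed by simp
    hence "q \<in> Idl (insert y P)" using pq(3) PB pq(1) B.add_mem_iff(1)[of p q] pqc by auto
    then obtain w p' where w: "w \<in> ideal_pow R \<mm> (n - c)" "p' \<in> P" "q = w \<otimes> y \<oplus> p'"
      using c pq(2) prod by blast
    have wc: "w \<in> carrier R" "p' \<in> carrier R" using w k.Icarr P.Icarr by auto
    have "(z \<ominus> w) \<otimes> y = z \<otimes> y \<ominus> w \<otimes> y"
      using z y wc by (simp add: a_minus_def l_distr l_minus)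
    also have "\<dots> = (p \<oplus> p' \<oplus> w \<otimes> y) \<ominus> w \<otimes> y"
      unfolding pq(3) w(3) using pqc wc y by (simp add: a_ac)
    also have "\<dots> = p \<oplus> p'"
      using pqc wc y by (simp add: a_minus_def a_assoc r_neg)
    finally have "(z \<ominus> w) \<otimes> y \<in> P" using pq w P.a_closed by simp
    hence "z \<ominus> w \<in> P" using P.I_prime[of "z \<ominus> w" y] z y wc by auto
    moreover have "z = (z \<ominus> w) \<oplus> w" using z wc by (simp add: a_minus_def a_assoc l_neg)
    ultimately show ?thesis
      using w(1) sum_mem_Idl_Un_iff[OF P.a_subset k.a_subset] Idl_ideal[OF P.ideal_axioms]
        Idl_ideal[OF k.ideal_axioms] by metis
  qed
  thus ?thesis by blast
qed

lemma Un_pow_closed: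
  assumes "ideal P R" shows "P \<union> ideal_pow R \<mm> n \<subseteq> carrier R"
proof -
  interpret P: ideal P R by fact
  show ?thesis using P.a_subset pow_closed by auto
qed

text \<open>For \<open>y\<close> in \<open>Q\<close> but not in \<open>P\<close>, the length of \<open>R/(Q + \<mm>\<^sup>L)\<close> is at most the difference of the
  lengths of \<open>R/(P + \<mm>\<^sup>L)\<close> and \<open>R/(P + \<mm>\<^sup>L\<^sup>-\<^sup>c)\<close>; these differences telescope.\<close>

lemma ideal_chain_above_prime_step:
  assumes P: "primeideal P R" and Q: "ideal Q R" and PQ: "P \<subset> Q"
  shows "\<exists>c. \<forall>N J n. ideal_chain_above R (Idl (Q \<union> ideal_pow R \<mm> N)) n \<longrightarrow>
    ideal_chain_above R (Idl (P \<union> ideal_pow R \<mm> (N + J * c))) (J * n)"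
proof -
  interpret P: primeideal P R by fact
  interpret Q: ideal Q R by fact
  obtain y where y: "y \<in> Q" "y \<notin> P" using PQ by auto
  have yc: "y \<in> carrier R" using y Q.Icarr by blast
  obtain c where c: "\<And>n z. z \<in> carrier R \<Longrightarrow> z \<otimes> y \<in> Idl (P \<union> ideal_pow R \<mm> n) \<Longrightarrow>
      z \<in> Idl (P \<union> ideal_pow R \<mm> (n - c))"
    using prime_colon_pow[OF P yc y(2)] by blast
  have gP: "P \<union> ideal_pow R \<mm> n \<subseteq> carrier R" for n by (rule Un_pow_closed[OF P.ideal_axioms])
  have gQ: "Q \<union> ideal_pow R \<mm> n \<subseteq> carrier R" for n by (rule Un_pow_closed[OF Q])
  have "ideal_chain_above R (Idl (P \<union> ideal_pow R \<mm> (N + J * c))) (J * n)"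
    if ch: "ideal_chain_above R (Idl (Q \<union> ideal_pow R \<mm> N)) n" for N J n
  proof (induction J)
    case 0
    show ?case using ideal_chain_above_0[of "Idl (P \<union> ideal_pow R \<mm> N)"] Idl_closed[OF gP] by auto
  next
    case (Suc J)
    \<comment> \<open>\<open>K - c = N + J * c\<close>, so the colon ideal by \<open>y\<close> lies
      in the ideal of the induction hypothesis, which contributes \<open>J * n\<close>; the other
      \<open>n\<close> inclusions are the given chain above \<open>Q + \<mm>^N\<close>.\<close>
    define K where "K = N + Suc J * c"
    let ?A = "Idl (P \<union> ideal_pow R \<mm> K)"
    interpret A: ideal ?A R by (rule genideal_ideal[OF gP])
    have "Idl (insert y ?A) \<subseteq> Idl (Q \<union> ideal_pow R \<mm> N)"
    proof (rule genideal_minimal[OF genideal_ideal[OF gQ]])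
      have "P \<union> ideal_pow R \<mm> K \<subseteq> Q \<union> ideal_pow R \<mm> N"
        using PQ ideal_pow_antimono[OF max.is_ideal, of N K] by (auto simp: K_def)
      hence "?A \<subseteq> Idl (Q \<union> ideal_pow R \<mm> N)" by (rule Idl_mono[OF _ gQ])
      moreover have "y \<in> Idl (Q \<union> ideal_pow R \<mm> N)" using y genideal_self[OF gQ] by auto
      ultimately show "insert y ?A \<subseteq> Idl (Q \<union> ideal_pow R \<mm> N)" by auto
    qed
    hence 1: "ideal_chain_above R (Idl (insert y ?A)) n" by (rule ideal_chain_above_mono[OF ch])
    have "ideal_colon R ?A {y} \<subseteq> Idl (P \<union> ideal_pow R \<mm> (N + J * c))"
      using c[of _ K] by (auto simp: ideal_colon_def K_def)
    hence 2: "ideal_chain_above R (ideal_colon R ?A {y}) (J * n)" by (rule ideal_chain_above_mono[OF Suc.IH])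
    show ?case using ideal_chain_above_add[OF A.ideal_axioms yc 1 2] by (simp add: K_def)
  qed
  thus ?thesis by blast
qed

text \<open>By induction along the primes, the length of \<open>R/(P i + \<mm>^L)\<close> times
  \<open>L^(i+1)\<close> is at most a constant times \<open>L^k\<close>. For the last prime the
  length is at least one, because \<open>P e\<close> is contained in \<mm>; hence
  \<open>L^(e+1)\<close> is at most a constant times \<open>L^k\<close> for all positive
  \<open>L\<close>.\<close>

lemma prime_chain_length_bound:
  assumes prime: "\<And>i. i \<le> e \<Longrightarrow> primeideal (P i) R" and strict: "\<And>i. i < e \<Longrightarrow> P i \<subset> P (Suc i)"
    and bound: "\<And>L n. L > 0 \<Longrightarrow> ideal_chain_above R (ideal_pow R \<mm> L) n \<Longrightarrow> n * L \<le> C * L ^ k"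
  shows "e < k"
proof -
  have id: "ideal (P i) R" if "i \<le> e" for i using prime[OF that] by (rule primeideal.axioms)
  have "\<exists>C. \<forall>L n. L > 0 \<longrightarrow> ideal_chain_above R (Idl (P i \<union> ideal_pow R \<mm> L)) n \<longrightarrow> n * L ^ Suc i \<le> C * L ^ k"
    if "i \<le> e" for i
    using that
  proof (induction i)
    case 0
    have "ideal_pow R \<mm> L \<subseteq> Idl (P 0 \<union> ideal_pow R \<mm> L)" for L
      using genideal_self[OF Un_pow_closed[OF id[of 0]]] by auto
    hence "n * L \<le> C * L ^ k"
      if "L > 0" "ideal_chain_above R (Idl (P 0 \<union> ideal_pow R \<mm> L)) n" for L n
      using bound[OF that(1) ideal_chain_above_mono[OF that(2)]] by simp
    thus ?case by (intro exI[of _ C]) simp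
  next
    case (Suc i)
    then obtain C where C: "\<And>L n. L > 0 \<Longrightarrow> ideal_chain_above R (Idl (P i \<union> ideal_pow R \<mm> L)) n
        \<Longrightarrow> n * L ^ Suc i \<le> C * L ^ k" by auto
    obtain c where c: "\<And>N J n. ideal_chain_above R (Idl (P (Suc i) \<union> ideal_pow R \<mm> N)) n \<Longrightarrow>
        ideal_chain_above R (Idl (P i \<union> ideal_pow R \<mm> (N + J * c))) (J * n)"
      using ideal_chain_above_prime_step[OF prime[of i] id[of "Suc i"] strict[of i]] Suc.prems by auto
    \<comment> \<open>Taking \<open>J = L\<close> in the prime step compares with \<open>P i\<close>
      at precision \<open>L + L * c\<close>: the chain becomes \<open>L\<close> times longer, which
      is the gained factor, while \<open>(1 + c) * L\<close> in place of \<open>L\<close> only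
      changes the constant.\<close>
    have "n * L ^ Suc (Suc i) \<le> (C * (1 + c) ^ k) * L ^ k"
      if L: "L > 0" and ch: "ideal_chain_above R (Idl (P (Suc i) \<union> ideal_pow R \<mm> L)) n" for L n
    proof -
      have "n * L ^ Suc (Suc i) = (L * n) * L ^ Suc i" by simp
      also have "\<dots> \<le> (L * n) * (L + L * c) ^ Suc i" by (intro mult_left_mono power_mono) auto
      also have "\<dots> \<le> C * (L + L * c) ^ k" by (rule C[OF _ c[OF ch]]) (use L in auto)
      also have "L + L * c = (1 + c) * L" by simp
      also have "C * ((1 + c) * L) ^ k = (C * (1 + c) ^ k) * L ^ k" by (simp only: power_mult_distrib mult.assoc)
      finally show ?thesis .
    qed
    thus ?case by blast
  qed
  then obtain C where C: "\<And>L n. L > 0 \<Longrightarrow> ideal_chain_above R (Idl (P e \<union> ideal_pow R \<mm> L)) n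
      \<Longrightarrow> n * L ^ Suc e \<le> C * L ^ k" by blast
  interpret Pe: primeideal "P e" R using prime by simp
  have "\<one> \<notin> P e" using Pe.I_notcarr Pe.one_imp_carrier by blast
  hence "P e \<subseteq> \<mm>" by (rule proper_ideal_subset_max[OF Pe.ideal_axioms])
  have ge1: "1 * L ^ Suc e \<le> C * L ^ k" if "L > 0" for L
  proof (rule C[OF that])
    have "ideal_pow R \<mm> L \<subseteq> \<mm>"
      using ideal_pow_antimono[OF max.is_ideal, of 1 L] ideal_pow_1[OF max.is_ideal] that by auto
    hence "Idl (P e \<union> ideal_pow R \<mm> L) \<subseteq> \<mm>"
      using \<open>P e \<subseteq> \<mm>\<close> by (intro genideal_minimal max.is_ideal) auto
    moreover have "\<mm> \<subset> carrier R" using max.a_subset max.I_notcarr by auto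
    ultimately show "ideal_chain_above R (Idl (P e \<union> ideal_pow R \<mm> L)) 1"
      unfolding ideal_chain_above_def
      by (intro exI[of _ "\<lambda>i. if i = 0 then \<mm> else carrier R"]) (auto intro: max.is_ideal oneideal)
  qed
  show "e < k"
  proof (rule ccontr)
    assume "\<not> e < k"
    \<comment> \<open>The value \<open>L = C + 1\<close> already violates the inequality when
      \<open>k \<le> e\<close>.\<close>
    hence "(C + 1) ^ k \<le> (C + 1) ^ e" by (intro power_increasing) auto
    hence "(C + 1) * (C + 1) ^ k \<le> (C + 1) * (C + 1) ^ e" by (rule mult_left_mono) simp
    hence "(C + 1) * (C + 1) ^ k \<le> (C + 1) ^ Suc e" by (simp only: power_Suc)
    moreover have "(C + 1) * (C + 1) ^ k > C * (C + 1) ^ k" by simp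
    ultimately show False using ge1[of "C + 1"] by linarith
  qed
qed

text \<open>For \<open>V\<close> in degree \<open>n\<close> this is the preimage of the span of
  these monomials in \<open>\<mm>^n/\<mm>^(n+1)\<close> over the residue field. Coefficients count
  only modulo \<mm>, and no quotient has to be formed.\<close>

definition mon_span :: "(nat \<Rightarrow> nat) set \<Rightarrow> nat \<Rightarrow> 'a set"
  where "mon_span V n = Idl (mon ` V \<union> ideal_pow R \<mm> (Suc n))"

lemma mon_span_gens: "mon ` V \<union> ideal_pow R \<mm> n \<subseteq> carrier R"
  using pow_closed by auto

lemma mon_span_ideal: "ideal (mon_span V n) R"
  unfolding mon_span_def by (rule genideal_ideal[OF mon_span_gens])

lemma mon_span_closed: "mon_span V n \<subseteq> carrier R"
  unfolding mon_span_def using Idl_closed[OF mon_span_gens] by blast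

lemma mon_span_mono: "V \<subseteq> W \<Longrightarrow> mon_span V n \<subseteq> mon_span W n"
  unfolding mon_span_def by (rule Idl_mono[OF _ mon_span_gens]) auto

lemma mon_in_span: "u \<in> V \<Longrightarrow> mon u \<in> mon_span V n"
  unfolding mon_span_def using genideal_self[OF mon_span_gens] by blast

lemma pow_subset_span: "ideal_pow R \<mm> (Suc n) \<subseteq> mon_span V n"
  unfolding mon_span_def using genideal_self[OF mon_span_gens] by blast

lemma mon_span_minimal:
  assumes "ideal J R" "\<And>u. u \<in> V \<Longrightarrow> mon u \<in> J" "ideal_pow R \<mm> (Suc n) \<subseteq> J"
  shows "mon_span V n \<subseteq> J"
  unfolding mon_span_def using assms by (intro genideal_minimal) auto

lemma mem_mon_span_insert_iff:
  "a \<in> mon_span (insert u V) n \<longleftrightarrow> (\<exists>r\<in>carrier R. \<exists>b\<in>mon_span V n. a = r \<otimes> mon u \<oplus> b)"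
  unfolding mon_span_def using mem_Idl_insert_iff[OF mon_closed mon_span_gens, of a u V "Suc n"] by simp

lemma pow_subset_mon_span_exponents: "ideal_pow R \<mm> n \<subseteq> mon_span (exponents_deg d n) n"
  unfolding max_pow_eq[of n] by (intro genideal_minimal mon_span_ideal) (auto intro: mon_in_span)

lemma mon_span_mult_mon:
  assumes "a \<in> mon_span V n" "w \<in> exponents_deg d k"
  shows "a \<otimes> mon w \<in> mon_span ((\<lambda>v. v + w) ` V) (n + k)"
  using assms(1) unfolding mon_span_def[of V]
proof (rule Idl_mult_mem[OF mon_span_ideal mon_span_gens, rotated 2])
  fix b assume "b \<in> mon ` V \<union> ideal_pow R \<mm> (Suc n)"
  thus "b \<otimes> mon w \<in> mon_span ((\<lambda>v. v + w) ` V) (n + k)"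
  proof
    assume "b \<in> mon ` V"
    thus ?thesis by (auto simp: mon_add[symmetric] intro!: mon_in_span)
  next
    assume "b \<in> ideal_pow R \<mm> (Suc n)"
    hence "b \<otimes> mon w \<in> ideal_pow R \<mm> (Suc n + k)"
      using ideal_pow_mult_mem[OF max.is_ideal _ mon_in_pow[OF assms(2)]] by blast
    thus ?thesis using pow_subset_span[of "n + k"] by auto
  qed
qed auto

lemma max_mult_mon:
  assumes "a \<in> \<mm>" "u \<in> exponents_deg d n"
  shows "a \<otimes> mon u \<in> ideal_pow R \<mm> (Suc n)"
  using ideal_pow_mult_mem[OF max.is_ideal, of a 1 "mon u" n] mon_in_pow[OF assms(2)]
    ideal_pow_1[OF max.is_ideal] assms(1) by simp

text \<open>Linear independence over the residue field in every \<open>\<mm>^n/\<mm>^(n+1)\<close>.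
  As the monomials generate these spaces, it expresses that \<open>gr R \<mm>\<close> is a
  polynomial ring in \<open>d\<close> variables over the residue field.\<close>

definition independent_monomials :: bool
  where "independent_monomials \<longleftrightarrow>
    (\<forall>n. \<forall>u\<in>exponents_deg d n. mon u \<notin> mon_span (exponents_deg d n - {u}) n)"

text \<open>In a dependence modulo \<open>\<mm>^(n+1)\<close>, terms with a coefficient in \<mm>
  vanish and are dropped one by one. As soon as the lex-lowest remaining monomial has a unit
  coefficient, the relation is solved for it; \<open>mon u\<close> itself has coefficient one, so
  this must happen.\<close>

lemma lex_leading_monomial:
  assumes "\<not> independent_monomials"
  shows "\<exists>w\<in>exponents d. mon w \<in> mon_span (lex_above w) (degree d w)"
proof (rule ccontr)
  assume contra: "\<not> ?thesis"
  from assms obtain n u where u: "u \<in> exponents_deg d n" "mon u \<in> mon_span (exponents_deg d n - {u}) n"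
    unfolding independent_monomials_def by blast
  have "False" if "finite V" "V \<subseteq> exponents_deg d n - {u}" "mon u \<in> mon_span V n" for V
    using that
  proof (induction V rule: finite_psubset_induct)
    case (psubset V)
    have V: "V \<subseteq> exponents_deg d n" "u \<notin> V" using psubset.prems by auto
    obtain w where w: "w \<in> insert u V" "\<And>v. v \<in> insert u V \<Longrightarrow> v \<noteq> w \<Longrightarrow> less_fun w v"
      using exponents_lex_least[of "insert u V" d] psubset.hyps V u(1) exponents_deg_subset by blast
    have wd: "w \<in> exponents_deg d n" using w(1) V u(1) by auto
    hence wdeg: "degree d w = n" "w \<in> exponents d" by (auto simp: exponents_deg_def)
    have sub: "insert u V - {w} \<subseteq> lex_above w"
      using w(2) V u(1) wdeg by (auto simp: lex_above_def)
    have not: "mon w \<notin> mon_span (insert u V - {w}) n"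
      using contra wdeg mon_span_mono[OF sub, of n] by auto
    show False
    proof (cases "w = u")
      case True
      thus False using not psubset.prems(2) V by simp
    next
      case False
      hence wV: "w \<in> V" using w by auto
      then obtain r b where rb: "r \<in> carrier R" "b \<in> mon_span (V - {w}) n" "mon u = r \<otimes> mon w \<oplus> b"
        using psubset.prems(2) mem_mon_span_insert_iff[of "mon u" w "V - {w}" n] insert_Diff[OF wV] by metis
      show False
      proof (cases "r \<in> \<mm>")
        case True
        interpret S: ideal "mon_span (V - {w}) n" R by (rule mon_span_ideal)
        have "r \<otimes> mon w \<in> mon_span (V - {w}) n"
          using max_mult_mon[OF True wd] pow_subset_span by blast
        hence "mon u \<in> mon_span (V - {w}) n" using rb by simp
        thus False using psubset.IH[of "V - {w}"] wV psubset.prems by auto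
      next
        case r: False
        interpret S: ideal "mon_span (insert u V - {w}) n" R by (rule mon_span_ideal)
        have "b \<in> mon_span (insert u V - {w}) n"
          using rb(2) mon_span_mono[of "V - {w}" "insert u V - {w}" n] by auto
        moreover have "r \<otimes> mon w \<oplus> b \<in> mon_span (insert u V - {w}) n"
          using mon_in_span[of u "insert u V - {w}" n] False rb(3) by auto
        ultimately have "r \<otimes> mon w \<in> mon_span (insert u V - {w}) n"
          using S.add_mem_iff(2)[of b "r \<otimes> mon w"] rb(1) by simp
        thus False using not unit_cancel[OF rb(1) r mon_span_ideal] by blast
      qed
    qed
  qed
  thus False using u(2) finite_exponents_deg[of d n] by (metis finite_Diff order_refl)
qed

text \<open>Exactly the monomials not divisible by \<open>mon w\<close>, those to which the relation
  for \<open>mon w\<close> cannot be applied.\<close>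

definition standard_exponents :: "(nat \<Rightarrow> nat) \<Rightarrow> nat \<Rightarrow> (nat \<Rightarrow> nat) set"
  where "standard_exponents w n = {u \<in> exponents_deg d n. \<exists>i<d. u i < w i}"

text \<open>The lexicographic order respects addition, so applying the relation to a multiple of
  \<open>mon w\<close> yields only lex-higher monomials of the same degree. There are finitely many
  of these, and the rewriting ends.\<close>

lemma pow_subset_standard_span:
  assumes w: "w \<in> exponents d" "mon w \<in> mon_span (lex_above w) (degree d w)"
  shows "ideal_pow R \<mm> n \<subseteq> mon_span (standard_exponents w n) n"
proof -
  interpret S: ideal "mon_span (standard_exponents w n) n" R by (rule mon_span_ideal)
  have "mon u \<in> mon_span (standard_exponents w n) n" if "u \<in> exponents_deg d n" for u
    using that
  proof (induction "card (lex_above u)" arbitrary: u rule: less_induct)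
    case less
    have deg: "degree d u = n" "u \<in> exponents d" using less.prems by (auto simp: exponents_deg_def)
    show ?case
    proof (cases "\<exists>i<d. u i < w i")
      case True
      thus ?thesis using less.prems by (intro mon_in_span) (auto simp: standard_exponents_def)
    next
      case False
      define v where "v = (\<lambda>i. u i - w i)"
      have uv: "u = w + v"
      proof
        fix i show "u i = (w + v) i"
          using False w(1) by (cases "i < d") (auto simp: v_def exponents_def)
      qed
      have "v \<in> exponents d" using deg(2) by (simp add: v_def exponents_def)
      hence v: "v \<in> exponents_deg d (degree d v)" by (simp add: exponents_deg_def)
      have dn: "degree d w + degree d v = n" using deg uv degree_add by metis
      have "mon u \<in> mon_span ((\<lambda>z. z + v) ` lex_above w) n"
        using mon_span_mult_mon[OF w(2) v] uv dn by (simp add: mon_add)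
      moreover have "mon_span ((\<lambda>z. z + v) ` lex_above w) n \<subseteq> mon_span (standard_exponents w n) n"
      proof (rule mon_span_minimal[OF S.ideal_axioms _ pow_subset_span])
        fix z assume "z \<in> (\<lambda>z. z + v) ` lex_above w"
        hence z: "z \<in> lex_above u" using lex_above_add v uv by (auto simp: exponents_deg_def)
        hence "z \<in> exponents_deg d n" using deg by (simp add: lex_above_def)
        moreover have "card (lex_above z) < card (lex_above u)"
        proof (rule psubset_card_mono)
          show "finite (lex_above u)"
            unfolding lex_above_def using finite_exponents_deg by simp
          have "lex_above z \<subseteq> lex_above u"
            using z less_fun_trans by (auto simp: lex_above_def exponents_deg_def)
          moreover have "z \<notin> lex_above z" by (simp add: lex_above_def less_fun_irrefl)
          ultimately show "lex_above z \<subset> lex_above u" using z by auto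
        qed
        ultimately show "mon z \<in> mon_span (standard_exponents w n) n" using less.hyps by blast
      qed
      ultimately show ?thesis by blast
    qed
  qed
  thus ?thesis unfolding max_pow_eq[of n] by (intro genideal_minimal S.ideal_axioms) auto
qed

text \<open>A standard exponent of degree below \<open>L\<close> has some coordinate
  \<open>i\<close> below \<open>w i\<close> and all others below \<open>L\<close>, at most
  \<open>w i * L^(d-1)\<close> choices for each \<open>i\<close>.\<close>

lemma standard_exponents_count:
  "(\<Sum>n<L. card (standard_exponents w n)) * L \<le> (\<Sum>i<d. w i) * L ^ d"
proof -
  have fin: "finite (standard_exponents w n)" for n
    unfolding standard_exponents_def using finite_exponents_deg by simp
  let ?B = "\<lambda>i. {u \<in> exponents d. \<forall>j<d. u j \<in> (if j = i then {..<w i} else {..<L})}"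
  have finB: "finite (?B i)" for i by (rule card_exponents_box(1)) auto
  have "(\<Sum>n<L. card (standard_exponents w n)) = card (\<Union>n\<in>{..<L}. standard_exponents w n)"
    by (rule card_UN_disjoint[symmetric]) (auto simp: fin, auto simp: standard_exponents_def exponents_deg_def)
  also have "\<dots> \<le> card (\<Union>i\<in>{..<d}. ?B i)"
  proof (rule card_mono)
    show "finite (\<Union>i\<in>{..<d}. ?B i)" using finB by auto
    show "(\<Union>n\<in>{..<L}. standard_exponents w n) \<subseteq> (\<Union>i\<in>{..<d}. ?B i)"
    proof
      fix u assume "u \<in> (\<Union>n\<in>{..<L}. standard_exponents w n)"
      then obtain i where u: "u \<in> exponents d" "degree d u < L" "i < d" "u i < w i"
        by (auto simp: standard_exponents_def exponents_deg_def)
      have "u j < L" for j using exponents_le_degree[OF u(1), of j] u(2) by simp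
      hence "u \<in> ?B i" using u by auto
      thus "u \<in> (\<Union>i\<in>{..<d}. ?B i)" using u(3) by blast
    qed
  qed
  also have "\<dots> \<le> (\<Sum>i<d. card (?B i))" by (rule card_UN_le) simp
  finally have "(\<Sum>n<L. card (standard_exponents w n)) * L \<le> (\<Sum>i<d. card (?B i) * L)"
    by (simp add: sum_distrib_right[symmetric])
  also have "\<dots> \<le> (\<Sum>i<d. w i * L ^ d)"
  proof (rule sum_mono)
    fix i assume i: "i \<in> {..<d}"
    have "card (?B i) \<le> (\<Prod>j<d. card (if j = i then {..<w i} else {..<L}))"
      by (rule card_exponents_box(2)) auto
    also have "\<dots> = (\<Prod>j<d. if j = i then w i else L)" by (intro prod.cong) auto
    also have "\<dots> = w i * L ^ (d - 1)"
    proof -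
      have "{..<d} \<inter> - {i} = {..<d} - {i}" "{..<d} \<inter> {i} = {i}" using i by auto
      thus ?thesis using i by (simp add: prod.If_cases)
    qed
    finally have "card (?B i) * L \<le> w i * L ^ (d - 1) * L" by simp
    also have "\<dots> = w i * L ^ d" using i by (cases d) auto
    finally show "card (?B i) * L \<le> w i * L ^ d" .
  qed
  finally show ?thesis by (simp add: sum_distrib_right)
qed

text \<open>\<open>\<mm>^L\<close> arises from \<open>\<mm>^(L+1)\<close> by adding the standard
  monomials of degree \<open>L\<close>. Each of them is killed by \<mm> modulo
  \<open>\<mm>^(L+1)\<close> and so shortens a chain by at most one.\<close>

lemma ideal_chain_above_pow_le:
  assumes w: "w \<in> exponents d" "mon w \<in> mon_span (lex_above w) (degree d w)"
    and "ideal_chain_above R (ideal_pow R \<mm> L) n"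
  shows "n \<le> (\<Sum>k<L. card (standard_exponents w k))"
  using assms(3)
proof (induction L arbitrary: n)
  case 0
  then obtain C where C: "\<And>i. i \<le> n \<Longrightarrow> ideal (C i) R" "carrier R \<subseteq> C 0" "\<And>i. i < n \<Longrightarrow> C i \<subset> C (Suc i)"
    unfolding ideal_chain_above_def ideal_pow_0 by auto
  have "n = 0"
  proof (rule ccontr)
    assume "n \<noteq> 0"
    hence "C 0 \<subset> C 1" "ideal (C 1) R" using C(3)[of 0] C(1)[of 1] by auto
    thus False using C(2) ideal.Icarr[of "C 1" R] by blast
  qed
  thus ?case by simp
next
  case (Suc L)
  let ?V = "standard_exponents w L"
  have fin: "finite ?V" unfolding standard_exponents_def using finite_exponents_deg by simp
  have "ideal_chain_above R (Idl (mon ` ?V \<union> ideal_pow R \<mm> (Suc L))) (n - card (mon ` ?V))"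
  proof (rule ideal_chain_above_finite[OF _ _ pow_closed])
    show "ideal_chain_above R (ideal_pow R \<mm> (Suc L)) n" by (rule Suc.prems)
    fix a v assume "a \<in> \<mm>" "v \<in> mon ` ?V"
    thus "a \<otimes> v \<in> ideal_pow R \<mm> (Suc L)"
      using max_mult_mon by (auto simp: standard_exponents_def)
  qed (use fin in auto)
  hence "ideal_chain_above R (ideal_pow R \<mm> L) (n - card (mon ` ?V))"
    by (rule ideal_chain_above_mono) (use pow_subset_standard_span[OF w] in \<open>simp add: mon_span_def\<close>)
  hence "n - card (mon ` ?V) \<le> (\<Sum>k<L. card (standard_exponents w k))" by (rule Suc.IH)
  moreover have "card (mon ` ?V) \<le> card ?V" using fin by (rule card_image_le)
  ultimately show ?case by simp
qed

theorem independent_monomials_if_prime_chain: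
  assumes "\<And>i. i \<le> d \<Longrightarrow> primeideal (P i) R" and "\<And>i. i < d \<Longrightarrow> P i \<subset> P (Suc i)"
  shows "independent_monomials"
proof (rule ccontr)
  assume "\<not> independent_monomials"
  then obtain w where w: "w \<in> exponents d" "mon w \<in> mon_span (lex_above w) (degree d w)"
    using lex_leading_monomial by blast
  have "d < d"
  proof (rule prime_chain_length_bound[of d P, OF assms])
    fix L n assume "ideal_chain_above R (ideal_pow R \<mm> L) n"
    hence "n * L \<le> (\<Sum>k<L. card (standard_exponents w k)) * L"
      using ideal_chain_above_pow_le[OF w] by simp
    also have "\<dots> \<le> (\<Sum>i<d. w i) * L ^ d" by (rule standard_exponents_count)
    finally show "n * L \<le> (\<Sum>i<d. w i) * L ^ d" .
  qed
  thus False by simp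
qed

end

section \<open>Minimal generating sets of the maximal ideal\<close>

context noetherian_local_ring
begin

text \<open>Nakayama's lemma for the cyclic module \<open>\<mm>/(B)\<close> generated by
  \<open>t\<close>. The elements congruent to a member of \<open>\<mm> t\<close> modulo
  \<open>(B)\<close> form an ideal that contains \<open>Y\<close>, hence all of \<mm>. Applied to
  \<open>t\<close>, this puts \<open>(1 - a) * t\<close> into \<open>(B)\<close>, and
  \<open>1 - a\<close> is a unit.\<close>

lemma nakayama_generator:
  assumes B: "B \<subseteq> carrier R" "B \<subseteq> \<mm>" and t: "t \<in> \<mm>"
    and gen: "Idl (insert t B) = \<mm>" and sub: "\<And>y. y \<in> Y \<Longrightarrow> \<exists>a\<in>\<mm>. \<exists>b\<in>Idl B. y = a \<otimes> t \<oplus> b"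
    and Y: "Y \<subseteq> carrier R" "Idl Y = \<mm>"
  shows "Idl B = \<mm>"
proof -
  interpret B: ideal "Idl B" R by (rule genideal_ideal[OF B(1)])
  have tc: "t \<in> carrier R" using t max.Icarr by blast
  have at: "(\<lambda>a. a \<otimes> t) ` \<mm> \<subseteq> carrier R" using tc max.Icarr by auto
  have "\<exists>a\<in>\<mm>. t \<ominus> a \<otimes> t \<in> Idl B"
  proof -
    have "\<mm> \<subseteq> {y \<in> carrier R. \<exists>a\<in>\<mm>. y \<ominus> a \<otimes> t \<in> Idl B}" (is "_ \<subseteq> ?K")
      unfolding Y(2)[symmetric]
    proof (rule genideal_minimal)
      show "Y \<subseteq> {y \<in> carrier R. \<exists>a\<in>Idl Y. y \<ominus> a \<otimes> t \<in> Idl B}"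
      proof
        fix y assume y: "y \<in> Y"
        obtain a b where ab: "a \<in> \<mm>" "b \<in> Idl B" "y = a \<otimes> t \<oplus> b" using sub[OF y] by blast
        have "a \<in> carrier R" "b \<in> carrier R" using ab max.Icarr B.Icarr by auto
        hence "y \<ominus> a \<otimes> t = b" using ab(3) tc by (simp add: a_minus_def a_ac r_neg)
        hence "y \<ominus> a \<otimes> t \<in> Idl B" using ab(2) by simp
        thus "y \<in> {y \<in> carrier R. \<exists>a\<in>Idl Y. y \<ominus> a \<otimes> t \<in> Idl B}"
          unfolding Y(2) using y Y(1) ab(1) by blast
      qed
      show "ideal {y \<in> carrier R. \<exists>a\<in>Idl Y. y \<ominus> a \<otimes> t \<in> Idl B} R"
        unfolding Y(2)
      proof (rule idealI[OF ring_axioms])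
        show "subgroup ?K (add_monoid R)"
        proof (rule add.subgroupI)
          show "?K \<noteq> {}"
            using tc B.zero_closed max.zero_closed by (intro ex_in_conv[THEN iffD1] exI[of _ \<zero>]) (auto intro!: bexI[of _ \<zero>] simp: a_minus_def)
          fix y assume "y \<in> ?K"
          then obtain a where a: "y \<in> carrier R" "a \<in> \<mm>" "y \<ominus> a \<otimes> t \<in> Idl B" by auto
          have ac: "a \<in> carrier R" using a max.Icarr by auto
          have "(\<ominus> y) \<ominus> (\<ominus> a) \<otimes> t = \<ominus> (y \<ominus> a \<otimes> t)"
            using a(1) ac tc by (simp add: a_minus_def l_minus minus_add)
          hence "(\<ominus> y) \<ominus> (\<ominus> a) \<otimes> t \<in> Idl B" using a(3) by simp
          moreover have "\<ominus> a \<in> \<mm>" using a(2) by simp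
          ultimately show "\<ominus> y \<in> ?K" using a(1) by blast
          fix z assume "z \<in> ?K"
          then obtain b where b: "z \<in> carrier R" "b \<in> \<mm>" "z \<ominus> b \<otimes> t \<in> Idl B" by auto
          have bc: "b \<in> carrier R" using b max.Icarr by auto
          have "(y \<oplus> z) \<ominus> (a \<oplus> b) \<otimes> t = (y \<ominus> a \<otimes> t) \<oplus> (z \<ominus> b \<otimes> t)"
            using a(1) b(1) ac bc tc by (simp add: a_minus_def l_distr minus_add a_ac)
          hence "(y \<oplus> z) \<ominus> (a \<oplus> b) \<otimes> t \<in> Idl B" using a(3) b(3) by simp
          moreover have "a \<oplus> b \<in> \<mm>" using a(2) b(2) by simp
          ultimately show "y \<oplus> z \<in> ?K" using a(1) b(1) by blast
        qed auto
        fix y r assume "y \<in> ?K" and r: "r \<in> carrier R"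
        then obtain a where a: "y \<in> carrier R" "a \<in> \<mm>" "y \<ominus> a \<otimes> t \<in> Idl B" by auto
        have ac: "a \<in> carrier R" using a max.Icarr by auto
        have "r \<otimes> y \<ominus> (r \<otimes> a) \<otimes> t = r \<otimes> (y \<ominus> a \<otimes> t)"
          using a(1) ac tc r by (simp add: a_minus_def r_distr m_assoc r_minus)
        hence "r \<otimes> y \<ominus> (r \<otimes> a) \<otimes> t \<in> Idl B" using a(3) r B.I_l_closed by simp
        moreover have "r \<otimes> a \<in> \<mm>" using a(2) r max.I_l_closed by simp
        ultimately show "r \<otimes> y \<in> ?K" using a(1) r by blast
        thus "y \<otimes> r \<in> ?K" using a(1) r by (simp add: m_comm)
      qed
    qed
    thus ?thesis using t by auto
  qed
  then obtain a where a: "a \<in> \<mm>" "t \<ominus> a \<otimes> t \<in> Idl B" by blast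
  have ac: "a \<in> carrier R" using a max.Icarr by auto
  have "t \<ominus> a \<otimes> t = (\<one> \<ominus> a) \<otimes> t" using ac tc by (simp add: a_minus_def l_distr l_minus)
  hence "t \<in> Idl B"
    using unit_cancel[of "\<one> \<ominus> a" "Idl B" t] one_minus_notin_max[OF a(1)] a(2) ac tc B.ideal_axioms by auto
  hence "Idl (insert t B) \<subseteq> Idl B"
    using genideal_self[OF B(1)] by (intro genideal_minimal B.ideal_axioms) auto
  moreover have "Idl B \<subseteq> \<mm>" using B by (intro genideal_minimal max.is_ideal) auto
  ultimately show ?thesis using gen by auto
qed

text \<open>Among the generating sets of least cardinality let \<open>T0\<close> have the fewest
  elements outside \<open>Y\<close>. If \<open>t\<close> is such an element, then by Nakayama some
  \<open>y\<close> in \<open>Y\<close> has a unit coefficient at \<open>t\<close> and can be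
  exchanged for it, which brings \<open>T0\<close> closer to \<open>Y\<close>. So \<open>T0\<close>
  lies in \<open>Y\<close> and equals it by irredundance.\<close>

lemma card_irredundant_le:
  assumes Y: "minimal_generating_set R Y \<mm>"
    and T: "finite T" "T \<subseteq> carrier R" "Idl T = \<mm>"
  shows "card Y \<le> card T"
proof -
  have Yc: "Y \<subseteq> carrier R" "Idl Y = \<mm>" "\<And>Z. Z \<subset> Y \<Longrightarrow> Idl Z \<noteq> \<mm>"
    using Y by (auto simp: minimal_generating_set_def)
  define gens where "gens n T \<longleftrightarrow> finite T \<and> T \<subseteq> carrier R \<and> Idl T = \<mm> \<and> card T = n" for n T
  define n where "n = (LEAST n. \<exists>T. gens n T)"
  have ex: "\<exists>n T. gens n T" using T by (auto simp: gens_def)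
  have n1: "\<exists>T. gens n T" unfolding n_def using ex by (rule LeastI_ex)
  have n2: "n \<le> card T" if "finite T" "T \<subseteq> carrier R" "Idl T = \<mm>" for T
    unfolding n_def by (rule Least_le) (use that in \<open>auto simp: gens_def\<close>)
  have "\<exists>T. gens n T \<and> (\<forall>T'. gens n T' \<longrightarrow> card (T' - Y) \<ge> card (T - Y))"
    using n1 ex_has_least_nat[of "gens n" _ "\<lambda>T. card (T - Y)"] by blast
  then obtain T0 where T0: "gens n T0" "\<And>T'. gens n T' \<Longrightarrow> card (T' - Y) \<ge> card (T0 - Y)" by blast
  have T0': "finite T0" "T0 \<subseteq> carrier R" "Idl T0 = \<mm>" "card T0 = n" using T0(1) by (auto simp: gens_def)
  have "T0 \<subseteq> Y"
  proof (rule ccontr)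
    assume "\<not> T0 \<subseteq> Y"
    then obtain t where t: "t \<in> T0" "t \<notin> Y" by auto
    define B where "B = T0 - {t}"
    have Bc: "B \<subseteq> carrier R" using T0' by (auto simp: B_def)
    have T0m: "T0 \<subseteq> \<mm>" using genideal_self[OF T0'(2)] T0'(3) by simp
    have T0i: "T0 = insert t B" using t by (auto simp: B_def)
    have cB: "card B < n" using T0' t unfolding B_def by (metis card_Diff1_less)
    have fB: "finite B" using T0' by (simp add: B_def)
    have Bn: "Idl B \<noteq> \<mm>" using n2[OF fB Bc] cB by auto
    have tc: "t \<in> carrier R" using t T0' by auto
    have "\<not> (\<forall>y\<in>Y. \<exists>a\<in>\<mm>. \<exists>b\<in>Idl B. y = a \<otimes> t \<oplus> b)"
      using nakayama_generator[OF Bc, of t Y] T0m T0i T0'(3) Yc Bn by auto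
    then obtain y where y: "y \<in> Y" "\<not> (\<exists>a\<in>\<mm>. \<exists>b\<in>Idl B. y = a \<otimes> t \<oplus> b)" by blast
    have yc: "y \<in> carrier R" using y Yc by auto
    have ym: "y \<in> \<mm>" using y genideal_self[OF Yc(1)] Yc(2) by auto
    then obtain a b where ab: "a \<in> carrier R" "b \<in> Idl B" "y = a \<otimes> t \<oplus> b"
      using T0'(3) T0i mem_Idl_insert_iff[OF tc Bc, of y] by auto
    have a: "a \<notin> \<mm>" using y ab by blast
    have yB: "insert y B \<subseteq> carrier R" using yc Bc by auto
    interpret yB: ideal "Idl (insert y B)" R by (rule genideal_ideal[OF yB])
    have "b \<in> Idl (insert y B)" using ab(2) Idl_mono[OF _ yB, of B] by auto
    moreover have "y \<in> Idl (insert y B)" using genideal_self[OF yB] by auto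
    ultimately have "a \<otimes> t \<in> Idl (insert y B)"
      using yB.add_mem_iff(2)[of b "a \<otimes> t"] ab tc by simp
    hence "t \<in> Idl (insert y B)" using unit_cancel[OF ab(1) a yB.ideal_axioms tc] by blast
    hence "T0 \<subseteq> Idl (insert y B)" using T0i genideal_self[OF yB] by auto
    hence "\<mm> \<subseteq> Idl (insert y B)" using T0'(3) genideal_minimal[OF yB.ideal_axioms] by metis
    moreover have "Idl (insert y B) \<subseteq> \<mm>"
      using ym T0m T0i by (intro genideal_minimal max.is_ideal) auto
    ultimately have gen: "Idl (insert y B) = \<mm>" by auto
    have "card (insert y B) \<le> n" using cB fB by (simp add: card_insert_if)
    hence "gens n (insert y B)" using n2[of "insert y B"] gen fB yB by (auto simp: gens_def)
    hence "card (insert y B - Y) \<ge> card (T0 - Y)" by (rule T0(2))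
    moreover have "insert y B - Y \<subset> T0 - Y" using y t by (auto simp: B_def)
    hence "card (insert y B - Y) < card (T0 - Y)" using T0' by (intro psubset_card_mono) auto
    ultimately show False by simp
  qed
  hence "T0 = Y" using Yc(3)[of T0] T0'(3) by auto
  thus ?thesis using n2[OF T] T0' by simp
qed

end

section \<open>Monomial ideals\<close>

context cring
begin

lemma saturation_ideal:
  assumes J: "ideal J R" and K: "ideal K R"
  shows "ideal (saturation R J K) R"
proof -
  have powc: "ideal_pow R J i \<subseteq> carrier R" for i using ideal_pow_closed[OF J] by blast
  have C: "ideal (ideal_colon R K (ideal_pow R J i)) R" for i
    by (rule ideal_colon_ideal[OF K powc])
  have mono: "ideal_colon R K (ideal_pow R J i) \<subseteq> ideal_colon R K (ideal_pow R J k)" if "i \<le> k" for i k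
    using ideal_pow_antimono[OF J that] unfolding ideal_colon_def by blast
  have mem: "a \<in> saturation R J K \<longleftrightarrow> (\<exists>i\<ge>1. a \<in> ideal_colon R K (ideal_pow R J i))" for a
    by (auto simp: saturation_def)
  show ?thesis
  proof (rule idealI[OF ring_axioms])
    show "subgroup (saturation R J K) (add_monoid R)"
    proof (rule add.subgroupI)
      show "saturation R J K \<subseteq> carrier R" unfolding saturation_def ideal_colon_def by blast
      show "saturation R J K \<noteq> {}"
        using mem additive_subgroup.zero_closed[OF ideal.axioms(1)[OF C[of 1]]] by blast
      fix a assume "a \<in> saturation R J K"
      then obtain i where i: "i \<ge> 1" "a \<in> ideal_colon R K (ideal_pow R J i)" using mem by blast
      interpret Ci: ideal "ideal_colon R K (ideal_pow R J i)" R by (rule C)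
      show "\<ominus> a \<in> saturation R J K" using mem i Ci.a_inv_closed by blast
      fix b assume "b \<in> saturation R J K"
      then obtain k where k: "k \<ge> 1" "b \<in> ideal_colon R K (ideal_pow R J k)" using mem by blast
      interpret Cm: ideal "ideal_colon R K (ideal_pow R J (max i k))" R by (rule C)
      have "a \<oplus> b \<in> ideal_colon R K (ideal_pow R J (max i k))"
        using mono[of i "max i k"] mono[of k "max i k"] i(2) k(2)
        by (intro Cm.a_closed) (meson max.cobounded1 max.cobounded2 subsetD)+
      thus "a \<oplus> b \<in> saturation R J K" using mem i(1) by (meson max.coboundedI1)
    qed
    fix a x assume "a \<in> saturation R J K" and x: "x \<in> carrier R"
    then obtain i where i: "i \<ge> 1" "a \<in> ideal_colon R K (ideal_pow R J i)" using mem by blast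
    interpret Ci: ideal "ideal_colon R K (ideal_pow R J i)" R by (rule C)
    show "x \<otimes> a \<in> saturation R J K" "a \<otimes> x \<in> saturation R J K"
      using mem i Ci.I_l_closed[OF i(2) x] Ci.I_r_closed[OF i(2) x] by blast+
  qed
qed

end

section \<open>Supports and comparison of coefficients\<close>

locale independent_generators = generated_local_ring +
  assumes independent: "independent_monomials"
begin

lemma mon_notin_span:
  assumes "u \<in> exponents_deg d n" "V \<subseteq> exponents_deg d n" "u \<notin> V"
  shows "mon u \<notin> mon_span V n"
proof -
  have "V \<subseteq> exponents_deg d n - {u}" using assms by auto
  thus ?thesis using independent assms(1) mon_span_mono unfolding independent_monomials_def by blast
qed

text \<open>If \<open>v\<close> were missing from \<open>T\<close>, then \<open>mon v\<close> could
  be solved for in terms of the monomials of \<open>W\<close> and \<open>T\<close>, against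
  independence.\<close>

lemma unit_coefficient_mem:
  assumes v: "v \<in> exponents_deg d n" "v \<notin> W" and W: "W \<subseteq> exponents_deg d n"
    and T: "T \<subseteq> exponents_deg d n"
    and r: "r \<in> carrier R" "r \<notin> \<mm>" and b: "b \<in> mon_span W n" and a: "r \<otimes> mon v \<oplus> b \<in> mon_span T n"
  shows "v \<in> T"
proof (rule ccontr)
  assume "v \<notin> T"
  interpret M: ideal "mon_span (W \<union> T) n" R by (rule mon_span_ideal)
  have "b \<in> mon_span (W \<union> T) n" "r \<otimes> mon v \<oplus> b \<in> mon_span (W \<union> T) n"
    using a b mon_span_mono[of W "W \<union> T" n] mon_span_mono[of T "W \<union> T" n] by auto
  hence "r \<otimes> mon v \<in> mon_span (W \<union> T) n"
    using M.add_mem_iff(2)[of b "r \<otimes> mon v"] r by simp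
  hence "mon v \<in> mon_span (W \<union> T) n" using unit_cancel[OF r M.ideal_axioms] by simp
  thus False using mon_notin_span[of v n "W \<union> T"] v W T \<open>v \<notin> T\<close> by simp
qed

text \<open>Coefficients are not unique, so a support is chosen: a set \<open>V\<close> of least
  cardinality whose span contains \<open>a\<close>. A coefficient in \<mm> would put its term into
  \<open>\<mm>^(n+1)\<close>, and its exponent could be left out.\<close>

lemma support_exists:
  assumes "a \<in> ideal_pow R \<mm> n"
  obtains V where "V \<subseteq> exponents_deg d n" "a \<in> mon_span V n"
    "\<And>v. v \<in> V \<Longrightarrow> \<exists>r\<in>carrier R. \<exists>b\<in>mon_span (V - {v}) n. r \<notin> \<mm> \<and> a = r \<otimes> mon v \<oplus> b"
proof -
  let ?Q = "\<lambda>V. V \<subseteq> exponents_deg d n \<and> a \<in> mon_span V n"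
  have "\<exists>V. ?Q V" using assms pow_subset_mon_span_exponents by blast
  then obtain V where V: "?Q V" "\<And>W. ?Q W \<Longrightarrow> card V \<le> card W"
    using ex_has_least_nat[of ?Q _ card] by blast
  have fin: "finite V" using V(1) finite_exponents_deg finite_subset by blast
  have "\<exists>r\<in>carrier R. \<exists>b\<in>mon_span (V - {v}) n. r \<notin> \<mm> \<and> a = r \<otimes> mon v \<oplus> b" if v: "v \<in> V" for v
  proof -
    interpret M: ideal "mon_span (V - {v}) n" R by (rule mon_span_ideal)
    obtain r b where rb: "r \<in> carrier R" "b \<in> mon_span (V - {v}) n" "a = r \<otimes> mon v \<oplus> b"
      using V(1) mem_mon_span_insert_iff[of a v "V - {v}" n] insert_Diff[OF v] by metis
    have "r \<notin> \<mm>"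
    proof
      assume "r \<in> \<mm>"
      hence "r \<otimes> mon v \<in> mon_span (V - {v}) n"
        using max_mult_mon[of r v n] pow_subset_span V(1) v by blast
      hence "?Q (V - {v})" using rb V(1) by auto
      hence "card V \<le> card (V - {v})" by (rule V(2))
      thus False using fin v by (metis card_Diff1_less not_le)
    qed
    thus ?thesis using rb by blast
  qed
  thus ?thesis using that V(1) by blast
qed

lemma single_exponent_mem [simp]: "j < d \<Longrightarrow> single_exponent j N \<in> exponents d"
  using single_exponent_in exponents_deg_subset by blast

text \<open>The exponent sets of monomial ideals. Taking all monomials of the ideal instead of
  generators keeps every product of an \<open>x i\<close> with a listed monomial in the
  list.\<close>

definition upward_closed :: "(nat \<Rightarrow> nat) set \<Rightarrow> bool"
  where "upward_closed S \<longleftrightarrow> S \<subseteq> exponents d \<and> (\<forall>u\<in>S. \<forall>v\<in>exponents d. u + v \<in> S)"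

lemma Idl_mon_subset_pow:
  assumes "\<And>u. u \<in> V \<Longrightarrow> u \<in> exponents d \<and> n \<le> degree d u"
  shows "Idl (mon ` V) \<subseteq> ideal_pow R \<mm> n"
proof (rule genideal_minimal[OF pow_ideal])
  show "mon ` V \<subseteq> ideal_pow R \<mm> n"
    using assms mon_in_pow[of _ "degree d _"] ideal_pow_antimono[OF max.is_ideal, of n]
    by (fastforce simp: exponents_deg_def)
qed

text \<open>The lowest degree \<open>j\<close> is raised step by step: when the part in degree
  \<open>j\<close> lies in \<open>\<mm>^(j+1)\<close>, independence forces its coefficients into
  \<mm>, and \<mm> times a monomial of \<open>S\<close> is generated by monomials of
  \<open>S\<close> of the next degree. It follows that the monomials of \<open>S\<close> span the
  initial ideal in degree \<open>n\<close>.\<close>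

lemma monomial_ideal_inter_pow:
  assumes S: "upward_closed S" and a: "a \<in> Idl (mon ` S)" "a \<in> ideal_pow R \<mm> n"
  shows "a \<in> mon_span (S \<inter> exponents_deg d n) n"
proof -
  define U where "U j = {u \<in> S. j \<le> degree d u}" for j
  have U: "U j \<subseteq> exponents d" for j using S by (auto simp: U_def upward_closed_def)
  have low: "b \<in> Idl (mon ` U (Suc j))"
    if "finite V" "V \<subseteq> S \<inter> exponents_deg d j" "b \<in> Idl (mon ` V)" "b \<in> ideal_pow R \<mm> (Suc j)" for V b j
    using that
  proof (induction V arbitrary: b)
    case empty
    interpret M: ideal "Idl (mon ` U (Suc j))" R by (rule genideal_ideal) auto
    have "Idl {} \<subseteq> {\<zero>}" by (rule genideal_minimal[OF zeroideal]) auto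
    thus ?case using empty M.zero_closed by auto
  next
    case (insert v V)
    interpret M: ideal "Idl (mon ` U (Suc j))" R by (rule genideal_ideal) auto
    interpret p: ideal "ideal_pow R \<mm> (Suc j)" R by (rule pow_ideal)
    obtain r b' where rb: "r \<in> carrier R" "b' \<in> Idl (mon ` V)" "b = r \<otimes> mon v \<oplus> b'"
      using insert.prems(2) mem_Idl_insert_iff[of "mon v" "mon ` V" b] by auto
    have b'c: "b' \<in> carrier R" using Idl_closed[OF mon_image_closed rb(2)] .
    have v: "v \<in> S" "v \<in> exponents_deg d j" "v \<in> exponents d" and V: "V \<subseteq> exponents_deg d j"
      using insert.prems(1) by (auto simp: exponents_deg_def)
    have "b' \<in> mon_span V j"
      using rb(2) Idl_mono[OF Un_upper1 mon_span_gens[of V "Suc j"]] unfolding mon_span_def by blast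
    moreover have "r \<otimes> mon v \<oplus> b' \<in> mon_span {} j"
      using rb(3) insert.prems(3) pow_subset_span by auto
    ultimately have r: "r \<in> \<mm>"
      using unit_coefficient_mem[OF v(2) insert.hyps(2) V _ rb(1)] by blast
    have rv: "r \<otimes> mon v \<in> ideal_pow R \<mm> (Suc j)" by (rule max_mult_mon[OF r v(2)])
    hence "b' \<in> ideal_pow R \<mm> (Suc j)"
      using p.add_mem_iff(1)[OF rv b'c] rb(3) insert.prems(3) by simp
    hence "b' \<in> Idl (mon ` U (Suc j))" using insert rb(2) by blast
    moreover have "r \<otimes> mon v \<in> Idl (mon ` U (Suc j))"
    proof (rule Idl_mult_mem[OF M.ideal_axioms _ mon_closed _ r[unfolded max_eq]])
      show "x ` {..<d} \<subseteq> carrier R" using x_closed by auto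
      fix y assume "y \<in> x ` {..<d}"
      then obtain i where i: "i < d" "y = x i" by auto
      hence "y \<otimes> mon v = mon (v + single_exponent i 1)"
        using mon_single[of i 1] x_closed by (simp add: mon_add m_comm)
      moreover have "v + single_exponent i 1 \<in> U (Suc j)"
        using S v i exponents_deg_add[OF v(2) single_exponent_in[OF i(1), of 1]]
        by (auto simp: U_def upward_closed_def exponents_deg_def)
      ultimately show "y \<otimes> mon v \<in> Idl (mon ` U (Suc j))"
        using genideal_self[OF mon_image_closed] by auto
    qed
    ultimately show ?case using rb(3) by simp
  qed
  have "a \<in> Idl (mon ` U j)" if "j \<le> n" for j
    using that
  proof (induction j)
    case 0
    have "U 0 = S" by (auto simp: U_def)
    thus ?case using a(1) by simp
  next
    case (Suc j)
    have "mon ` U j = mon ` (S \<inter> exponents_deg d j) \<union> mon ` U (Suc j)"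
      using S by (auto simp: U_def upward_closed_def exponents_deg_def image_Un[symmetric] intro!: arg_cong[of _ _ "image mon"])
    then obtain b e where be: "b \<in> Idl (mon ` (S \<inter> exponents_deg d j))" "e \<in> Idl (mon ` U (Suc j))" "a = b \<oplus> e"
      using Suc sum_mem_Idl_Un_iff[of "mon ` (S \<inter> exponents_deg d j)" "mon ` U (Suc j)" a] by auto
    interpret M: ideal "Idl (mon ` U (Suc j))" R by (rule genideal_ideal) auto
    interpret p: ideal "ideal_pow R \<mm> (Suc j)" R by (rule pow_ideal)
    have "e \<in> ideal_pow R \<mm> (Suc j)"
      using be(2) Idl_mon_subset_pow[of "U (Suc j)" "Suc j"] U by (auto simp: U_def)
    moreover have "a \<in> ideal_pow R \<mm> (Suc j)"
      using a(2) ideal_pow_antimono[OF max.is_ideal Suc.prems] by blast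
    moreover have "b \<in> carrier R" using be(1) Idl_closed[OF mon_image_closed] by blast
    ultimately have "b \<in> ideal_pow R \<mm> (Suc j)" using p.add_mem_iff(2)[of e b] be(3) by simp
    hence "b \<in> Idl (mon ` U (Suc j))"
      using low[of "S \<inter> exponents_deg d j" j b] finite_exponents_deg be(1) by auto
    thus ?case using be by simp
  qed
  hence "a \<in> Idl (mon ` U n)" by simp
  moreover have "Idl (mon ` U n) \<subseteq> mon_span (S \<inter> exponents_deg d n) n"
  proof (rule genideal_minimal[OF mon_span_ideal], rule)
    fix y assume "y \<in> mon ` U n"
    then obtain u where u: "y = mon u" "u \<in> S" "n \<le> degree d u" "u \<in> exponents d"
      using U by (auto simp: U_def)
    show "y \<in> mon_span (S \<inter> exponents_deg d n) n"
    proof (cases "degree d u = n")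
      case True
      thus ?thesis using u by (auto intro!: mon_in_span simp: exponents_deg_def)
    next
      case False
      hence "y \<in> ideal_pow R \<mm> (Suc n)"
        using u mon_in_pow[of u "degree d u"] ideal_pow_antimono[OF max.is_ideal, of "Suc n" "degree d u"]
        by (auto simp: exponents_deg_def)
      thus ?thesis using pow_subset_span by blast
    qed
  qed
  ultimately show ?thesis by blast
qed

text \<open>These exponents will turn out to describe the saturation of the monomial ideal of
  \<open>S\<close>; pure powers of the generators suffice as a test.\<close>

definition saturated_exponents :: "(nat \<Rightarrow> nat) set \<Rightarrow> (nat \<Rightarrow> nat) set"
  where "saturated_exponents S = {v \<in> exponents d. \<exists>N. \<forall>j<d. v + single_exponent j N \<in> S}"

text \<open>Multiplication by \<open>x j [^] N\<close> shifts exponents injectively, so a unit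
  coefficient of \<open>a\<close> at \<open>v\<close> reappears at
  \<open>v + single_exponent j N\<close>, which must then belong to \<open>S\<close>. As the
  products are needed only modulo \<open>\<mm>^(p+N+1)\<close>, this serves both the saturation of
  the ideal and that of its initial ideal.\<close>

lemma mem_span_saturated:
  assumes "a \<in> ideal_pow R \<mm> p"
    and "\<And>j. j < d \<Longrightarrow> a \<otimes> x j [^] N \<in> mon_span (S \<inter> exponents_deg d (p + N)) (p + N)"
  shows "a \<in> mon_span (saturated_exponents S \<inter> exponents_deg d p) p"
proof -
  obtain V where V: "V \<subseteq> exponents_deg d p" "a \<in> mon_span V p"
    "\<And>v. v \<in> V \<Longrightarrow> \<exists>r\<in>carrier R. \<exists>b\<in>mon_span (V - {v}) p. r \<notin> \<mm> \<and> a = r \<otimes> mon v \<oplus> b"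
    using support_exists[OF assms(1)] by blast
  have "v + single_exponent j N \<in> S" if v: "v \<in> V" and j: "j < d" for v j
  proof -
    let ?e = "single_exponent j N"
    have e: "?e \<in> exponents_deg d N" by (rule single_exponent_in[OF j])
    obtain r b where rb: "r \<in> carrier R" "b \<in> mon_span (V - {v}) p" "r \<notin> \<mm>" "a = r \<otimes> mon v \<oplus> b"
      using V(3)[OF v] by blast
    have bc: "b \<in> carrier R" using rb(2) mon_span_closed by blast
    have "a \<otimes> x j [^] N = r \<otimes> mon (v + ?e) \<oplus> b \<otimes> mon ?e"
      using rb bc j by (simp add: mon_single[symmetric] l_distr mon_add m_assoc)
    hence "r \<otimes> mon (v + ?e) \<oplus> b \<otimes> mon ?e \<in> mon_span (S \<inter> exponents_deg d (p + N)) (p + N)"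
      using assms(2)[OF j] by simp
    hence "v + ?e \<in> S \<inter> exponents_deg d (p + N)"
    proof (rule unit_coefficient_mem[rotated -1])
      show "b \<otimes> mon ?e \<in> mon_span ((\<lambda>z. z + ?e) ` (V - {v})) (p + N)"
        by (rule mon_span_mult_mon[OF rb(2) e])
      show "v + ?e \<in> exponents_deg d (p + N)" using v V(1) e exponents_deg_add by blast
      show "v + ?e \<notin> (\<lambda>z. z + ?e) ` (V - {v})" by (auto simp: fun_eq_iff)
      show "(\<lambda>z. z + ?e) ` (V - {v}) \<subseteq> exponents_deg d (p + N)" using V(1) e exponents_deg_add by blast
    qed (use rb in auto)
    thus ?thesis by blast
  qed
  hence "V \<subseteq> saturated_exponents S \<inter> exponents_deg d p"
    using V(1) by (auto simp: saturated_exponents_def exponents_deg_def)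
  thus ?thesis using V(2) mon_span_mono by blast
qed

lemma mon_saturated_mem:
  assumes S: "upward_closed S" and v: "v \<in> saturated_exponents S"
  shows "mon v \<in> saturation R \<mm> (Idl (mon ` S))"
proof -
  obtain N where N: "\<And>j. j < d \<Longrightarrow> v + single_exponent j N \<in> S" and vE: "v \<in> exponents d"
    using v by (auto simp: saturated_exponents_def)
  interpret I: ideal "Idl (mon ` S)" R by (rule genideal_ideal) auto
  \<comment> \<open>Pigeonhole: a monomial of degree \<open>d * N + 1\<close> has some exponent at
    least \<open>N\<close>. The added one also provides the positive power required by
    \<open>saturation\<close> when \<open>d * N = 0\<close>.\<close>
  have "mon v \<otimes> b \<in> Idl (mon ` S)" if "b \<in> ideal_pow R \<mm> (d * N + 1)" for b
  proof -
    have bc: "b \<in> carrier R" using that pow_closed by blast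
    have "b \<otimes> mon v \<in> Idl (mon ` S)"
    proof (rule Idl_mult_mem[OF I.ideal_axioms mon_image_closed mon_closed _ that[unfolded max_pow_eq]])
      fix y assume "y \<in> mon ` exponents_deg d (d * N + 1)"
      then obtain u where u: "u \<in> exponents_deg d (d * N + 1)" "y = mon u" by auto
      have "\<exists>j<d. N \<le> u j"
      proof (rule ccontr)
        assume "\<not> (\<exists>j<d. N \<le> u j)"
        hence "sum u {..<d} \<le> (\<Sum>j<d. N)" by (intro sum_mono) (auto simp: not_le less_imp_le)
        thus False using u(1) by (simp add: exponents_deg_def degree_def)
      qed
      then obtain j where j: "j < d" "N \<le> u j" by blast
      define w where "w = (\<lambda>i. u i - single_exponent j N i)"
      have "u + v = (v + single_exponent j N) + w"
        using j(2) by (auto simp: w_def single_exponent_def fun_eq_iff)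
      moreover have "w \<in> exponents d" using u(1) by (simp add: w_def exponents_def exponents_deg_def)
      ultimately have "u + v \<in> S" using N[OF j(1)] S by (auto simp: upward_closed_def)
      thus "y \<otimes> mon v \<in> Idl (mon ` S)"
        using genideal_self[OF mon_image_closed, of S] u(2) by (auto simp: mon_add[symmetric])
    qed
    thus ?thesis using bc by (simp add: m_comm)
  qed
  hence "mon v \<in> ideal_colon R (Idl (mon ` S)) (ideal_pow R \<mm> (d * N + 1))"
    by (simp add: ideal_colon_def)
  thus ?thesis unfolding saturation_def by (intro UN_I[of "d * N + 1"]) auto
qed

lemma saturation_inter_pow:
  assumes S: "upward_closed S" and b: "b \<in> saturation R \<mm> (Idl (mon ` S))" "b \<in> ideal_pow R \<mm> p"
  shows "b \<in> mon_span (saturated_exponents S \<inter> exponents_deg d p) p"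
proof -
  obtain i where i: "\<And>c. c \<in> ideal_pow R \<mm> i \<Longrightarrow> b \<otimes> c \<in> Idl (mon ` S)"
    using b(1) by (auto simp: saturation_def ideal_colon_def)
  show ?thesis
  proof (rule mem_span_saturated[OF b(2)])
    fix j assume j: "j < d"
    have xj: "x j [^] i \<in> ideal_pow R \<mm> i"
      using mon_in_pow[OF single_exponent_in[OF j, of i]] mon_single[OF j] by simp
    show "b \<otimes> x j [^] i \<in> mon_span (S \<inter> exponents_deg d (p + i)) (p + i)"
      by (rule monomial_ideal_inter_pow[OF S i[OF xj] ideal_pow_mult_mem[OF max.is_ideal b(2) xj]])
  qed
qed

section \<open>Cancelling the sum of the generators\<close>

lemma mon_span_mult_linear:
  assumes b: "b \<in> mon_span V n" and A: "A \<subseteq> {..<d}" and c: "c \<in> Idl (x ` A)"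
  shows "b \<otimes> c \<in> mon_span {v + single_exponent i 1 | v i. v \<in> V \<and> i \<in> A} (Suc n)"
proof (rule Idl_mult_Idl_mem[OF mon_span_ideal mon_span_gens _ _ b[unfolded mon_span_def] c])
  show "x ` A \<subseteq> carrier R" using x_closed A by auto
  fix s t assume s: "s \<in> mon ` V \<union> ideal_pow R \<mm> (Suc n)" and "t \<in> x ` A"
  then obtain i where i: "i \<in> A" "t = x i" "i < d" using A by auto
  hence t: "t = mon (single_exponent i 1)" using mon_single[of i 1] x_closed by simp
  show "s \<otimes> t \<in> mon_span {v + single_exponent i 1 | v i. v \<in> V \<and> i \<in> A} (Suc n)"
    using s
  proof
    assume "s \<in> mon ` V"
    then obtain v where v: "v \<in> V" "s = mon v" by blast
    have "v + single_exponent i 1 \<in> {v + single_exponent i 1 | v i. v \<in> V \<and> i \<in> A}"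
      using v(1) i(1) by blast
    thus ?thesis unfolding t v(2) mon_add[symmetric] by (rule mon_in_span)
  next
    assume "s \<in> ideal_pow R \<mm> (Suc n)"
    hence "s \<otimes> t \<in> ideal_pow R \<mm> (Suc n + 1)"
      unfolding t using mon_in_pow[OF single_exponent_in[OF i(3), of 1]]
      by (rule ideal_pow_mult_mem[OF max.is_ideal])
    thus ?thesis using pow_subset_span[of "Suc n"] by auto
  qed
qed

definition linear_sum :: 'a
  where "linear_sum = (\<Oplus>i\<in>{..<d}. x i)"

lemma finsum_mem_Idl:
  assumes "A \<subseteq> {..<d}" shows "(\<Oplus>i\<in>A. x i) \<in> Idl (x ` A)"
proof -
  have c: "x ` A \<subseteq> carrier R" using assms x_closed by auto
  interpret I: ideal "Idl (x ` A)" R by (rule genideal_ideal[OF c])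
  have "finite A" using assms finite_subset by blast
  moreover have "(\<Oplus>i\<in>B. x i) \<in> Idl (x ` A)" if "finite B" "B \<subseteq> A" for B
    using that
  proof (induction B)
    case (insert i B)
    have "x \<in> B \<rightarrow> carrier R" "x i \<in> carrier R" using c insert.prems by auto
    hence "(\<Oplus>i\<in>insert i B. x i) = x i \<oplus> (\<Oplus>i\<in>B. x i)" using insert.hyps by (intro finsum_insert) auto
    moreover have "x i \<in> Idl (x ` A)" using genideal_self[OF c] insert.prems by auto
    ultimately show ?case using insert I.a_closed by simp
  qed (use I.zero_closed in simp)
  ultimately show ?thesis by blast
qed

lemma linear_sum_mem: "linear_sum \<in> \<mm>"
  unfolding linear_sum_def using finsum_mem_Idl[of "{..<d}"] max_eq by simp

text \<open>Modulo the monomials that a power of \<open>x j\<close> multiplies into \<open>S\<close>, \<open>linear_sum\<close> is monic in \<open>x j\<close>.\<close>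

lemma linear_sum_cancel:
  assumes S: "upward_closed S" and a: "a \<in> ideal_pow R \<mm> n"
    and prod: "a \<otimes> linear_sum \<in> mon_span (saturated_exponents S \<inter> exponents_deg d (Suc n)) (Suc n)"
  shows "a \<in> mon_span (saturated_exponents S \<inter> exponents_deg d n) n"
proof -
  obtain V where V: "V \<subseteq> exponents_deg d n" "a \<in> mon_span V n"
    "\<And>v. v \<in> V \<Longrightarrow> \<exists>r\<in>carrier R. \<exists>b\<in>mon_span (V - {v}) n. r \<notin> \<mm> \<and> a = r \<otimes> mon v \<oplus> b"
    using support_exists[OF a] by blast
  have finV: "finite V" using V(1) finite_exponents_deg finite_subset by blast
  let ?e = "\<lambda>i. single_exponent i 1"
  \<comment> \<open>The exponents of the saturation with respect to \<open>x j\<close> alone, a set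
    from which \<open>x j\<close> can be divided out.\<close>
  define Q where "Q j = {v \<in> exponents d. \<exists>N. v + single_exponent j N \<in> S}" for j
  have Q_up: "v + w \<in> Q j" if v: "v \<in> Q j" and w: "w \<in> exponents d" for v w j
  proof -
    obtain N where N: "v + single_exponent j N \<in> S" "v \<in> exponents d" using v by (auto simp: Q_def)
    have "(v + w) + single_exponent j N = (v + single_exponent j N) + w" by (simp add: ac_simps)
    hence "(v + w) + single_exponent j N \<in> S" using N S w by (auto simp: upward_closed_def)
    moreover have "v + w \<in> exponents d" using N(2) w by (rule exponents_add)
    ultimately show ?thesis unfolding Q_def by blast
  qed
  have Q_single: "v \<in> Q j" if v: "v + ?e j \<in> Q j" and vE: "v \<in> exponents d" for v j
  proof -
    obtain N where N: "v + ?e j + single_exponent j N \<in> S" using v by (auto simp: Q_def)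
    have "v + ?e j + single_exponent j N = v + single_exponent j (Suc N)"
      by (auto simp: single_exponent_def fun_eq_iff)
    hence "v + single_exponent j (Suc N) \<in> S" using N by simp
    thus ?thesis using vE unfolding Q_def by blast
  qed
  have VQ: "V \<subseteq> Q j" if j: "j < d" for j
  proof (rule ccontr)
    assume "\<not> V \<subseteq> Q j"
    hence ne: "V - Q j \<noteq> {}" by auto
    \<comment> \<open>A largest \<open>j\<close>-th coordinate makes \<open>u\<close> leading in
      \<open>x j\<close> among the offending exponents. If \<open>u + ?e j\<close> also arose from
      some \<open>v\<close> times another generator, then \<open>v\<close> would have a larger
      \<open>j\<close>-th coordinate, hence lie in \<open>Q j\<close>, and so would
      \<open>u\<close>.\<close>
    have "\<exists>u\<in>V - Q j. \<forall>v\<in>V - Q j. v j \<le> u j"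
    proof -
      have "Max ((\<lambda>v. v j) ` (V - Q j)) \<in> (\<lambda>v. v j) ` (V - Q j)" using finV ne by (intro Max_in) auto
      then obtain u where "u \<in> V - Q j" "u j = Max ((\<lambda>v. v j) ` (V - Q j))" by auto
      thus ?thesis using finV by (intro bexI[of _ u]) auto
    qed
    then obtain u where u: "u \<in> V" "u \<notin> Q j" "\<And>v. v \<in> V \<Longrightarrow> v \<notin> Q j \<Longrightarrow> v j \<le> u j" by blast
    have uE: "u \<in> exponents_deg d n" "u \<in> exponents d" using u V(1) by (auto simp: exponents_deg_def)
    obtain r b where rb: "r \<in> carrier R" "b \<in> mon_span (V - {u}) n" "r \<notin> \<mm>" "a = r \<otimes> mon u \<oplus> b"
      using V(3)[OF u(1)] by blast
    have bc: "b \<in> carrier R" using rb(2) mon_span_closed by blast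
    define l where "l = (\<Oplus>i\<in>{..<d} - {j}. x i)"
    have xc: "x \<in> {..<d} - {j} \<rightarrow> carrier R" using x_closed by auto
    have lc: "l \<in> carrier R" unfolding l_def by (rule finsum_closed[OF xc])
    have lsum: "linear_sum = x j \<oplus> l"
      unfolding linear_sum_def l_def
      using finsum_insert[of "{..<d} - {j}" j x] xc x_closed[OF j] j by (simp add: insert_absorb)
    have lsc: "linear_sum \<in> carrier R" using linear_sum_mem max.Icarr by blast
    have xj: "x j = mon (?e j)" using mon_single[OF j, of 1] x_closed[OF j] by simp
    define T1 where "T1 = {v + ?e i | v i. v \<in> {u} \<and> i \<in> {..<d} - {j}}"
    define T2 where "T2 = {v + ?e i | v i. v \<in> V - {u} \<and> i \<in> {..<d}}"
    have m1: "mon u \<otimes> l \<in> mon_span T1 (Suc n)"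
      unfolding T1_def l_def by (rule mon_span_mult_linear[OF mon_in_span _ finsum_mem_Idl]) auto
    have m2: "b \<otimes> linear_sum \<in> mon_span T2 (Suc n)"
      unfolding T2_def linear_sum_def by (rule mon_span_mult_linear[OF rb(2) _ finsum_mem_Idl]) auto
    interpret M: ideal "mon_span (T1 \<union> T2) (Suc n)" R by (rule mon_span_ideal)
    have rest: "r \<otimes> (mon u \<otimes> l) \<oplus> b \<otimes> linear_sum \<in> mon_span (T1 \<union> T2) (Suc n)"
    proof (rule M.a_closed[OF M.I_l_closed[OF _ rb(1)]])
      show "mon u \<otimes> l \<in> mon_span (T1 \<union> T2) (Suc n)"
        using m1 mon_span_mono[of T1 "T1 \<union> T2" "Suc n"] by auto
      show "b \<otimes> linear_sum \<in> mon_span (T1 \<union> T2) (Suc n)"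
        using m2 mon_span_mono[of T2 "T1 \<union> T2" "Suc n"] by auto
    qed
    have "a \<otimes> linear_sum = r \<otimes> mon u \<otimes> linear_sum \<oplus> b \<otimes> linear_sum"
      using rb bc lsc by (simp add: l_distr)
    also have "r \<otimes> mon u \<otimes> linear_sum = r \<otimes> mon (u + ?e j) \<oplus> r \<otimes> (mon u \<otimes> l)"
      unfolding lsum xj mon_add using rb(1) lc by (simp add: r_distr m_assoc)
    finally have eq: "a \<otimes> linear_sum = r \<otimes> mon (u + ?e j) \<oplus> (r \<otimes> (mon u \<otimes> l) \<oplus> b \<otimes> linear_sum)"
      using rb bc lsc lc by (simp add: a_assoc)
    have "u + ?e j \<in> saturated_exponents S \<inter> exponents_deg d (Suc n)"
    proof (rule unit_coefficient_mem[OF _ _ _ _ rb(1,3) rest prod[unfolded eq]])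
      have add1: "v + ?e i \<in> exponents_deg d (Suc n)" if "v \<in> exponents_deg d n" "i < d" for v i
        using exponents_deg_add[OF that(1) single_exponent_in[OF that(2), of 1]] by simp
      show "u + ?e j \<in> exponents_deg d (Suc n)" by (rule add1[OF uE(1) j])
      show "T1 \<union> T2 \<subseteq> exponents_deg d (Suc n)"
        using add1 uE(1) V(1) by (auto simp: T1_def T2_def)
      show "u + ?e j \<notin> T1 \<union> T2"
      proof
        assume "u + ?e j \<in> T1 \<union> T2"
        thus False
        proof
          assume "u + ?e j \<in> T1"
          then obtain i where i: "i \<noteq> j" "u + ?e j = u + ?e i" by (auto simp: T1_def)
          show False using fun_cong[OF i(2), of j] i(1) by (simp add: single_exponent_def)
        next
          assume "u + ?e j \<in> T2"
          then obtain v i where v: "v \<in> V" "v \<noteq> u" "i < d" "u + ?e j = v + ?e i" by (auto simp: T2_def)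
          have ij: "i \<noteq> j"
          proof
            assume "i = j"
            hence "v = u" using v(4) by (auto simp: fun_eq_iff)
            thus False using v(2) by simp
          qed
          hence "v j = u j + 1" using fun_cong[OF v(4), of j] by (simp add: single_exponent_def)
          hence "v \<in> Q j" using u(3)[of v] v(1) by force
          hence "u + ?e j \<in> Q j" unfolding v(4) using v(3) by (intro Q_up) auto
          thus False using Q_single uE(2) u(2) by blast
        qed
      qed
    qed auto
    hence "u + ?e j \<in> Q j" using j by (auto simp: saturated_exponents_def Q_def)
    thus False using Q_single uE(2) u(2) by blast
  qed
  have "V \<subseteq> saturated_exponents S"
  proof
    fix v assume v: "v \<in> V"
    hence vE: "v \<in> exponents d" using V(1) exponents_deg_subset by blast
    have "\<forall>j. \<exists>N. j < d \<longrightarrow> v + single_exponent j N \<in> S" using VQ v by (auto simp: Q_def)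
    then obtain N where N: "\<And>j. j < d \<Longrightarrow> v + single_exponent j (N j) \<in> S" by metis
    \<comment> \<open>A common exponent for all \<open>j\<close>: the sum dominates each
      \<open>N j\<close>, and upward closure absorbs the difference.\<close>
    define M where "M = (\<Sum>j<d. N j)"
    have "v + single_exponent j M \<in> S" if j: "j < d" for j
    proof -
      have "N j \<le> M" unfolding M_def using j by (intro member_le_sum) auto
      hence "v + single_exponent j M = (v + single_exponent j (N j)) + single_exponent j (M - N j)"
        by (auto simp: single_exponent_def fun_eq_iff)
      thus ?thesis using N[OF j] S j by (auto simp: upward_closed_def)
    qed
    thus "v \<in> saturated_exponents S" using vE by (auto simp: saturated_exponents_def)
  qed
  hence "mon_span V n \<subseteq> mon_span (saturated_exponents S \<inter> exponents_deg d n) n"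
    using V(1) by (intro mon_span_mono) auto
  thus ?thesis using V(2) by blast
qed

end

section \<open>The associated graded ring\<close>

text \<open>Formulated for an arbitrary ideal, because it is instantiated with \<open>R\<close> and
  \<mm> and, for the depth, with a quotient of \<open>R\<close> and the image of \<mm>.\<close>

locale adic_ring = cring R for R (structure) +
  fixes J :: "'a set"
  assumes J_ideal: "ideal J R"
begin

text \<open>\<open>pow (Suc n)\<close> is itself a \<open>[^]\<close> term, in the monoid of ideals,
  and has to stay folded.\<close>

declare Group.nat_pow_Suc [simp del]

abbreviation pow :: "nat \<Rightarrow> 'a set"
  where "pow \<equiv> ideal_pow R J"

definition cls :: "nat \<Rightarrow> 'a \<Rightarrow> 'a set"
  where "cls n a = pow (Suc n) +> a"

text \<open>The Rees algebra, the sum of the \<open>J^n T^n\<close> inside the polynomial ring over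
  \<open>R\<close>. Its quotient map onto the associated graded ring is
  \<open>gr_of\<close>.\<close>

definition rees :: "(nat \<Rightarrow> 'a) set"
  where "rees = {a \<in> up R. \<forall>n. a n \<in> pow n}"

definition gr_of :: "(nat \<Rightarrow> 'a) \<Rightarrow> nat \<Rightarrow> 'a set"
  where "gr_of a = (\<lambda>n. cls n (a n))"

definition gr_single :: "nat \<Rightarrow> 'a \<Rightarrow> nat \<Rightarrow> 'a set"
  where "gr_single n a = gr_of (\<lambda>k. if k = n then a else \<zero>)"

lemma pow_ideal: "ideal (pow n) R"
  by (rule ideal_pow_ideal[OF J_ideal])

lemma pow_closed: "a \<in> pow n \<Longrightarrow> a \<in> carrier R"
  by (rule ideal_pow_closed[OF J_ideal])

lemma zero_in_pow: "\<zero> \<in> pow n"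
  using pow_ideal additive_subgroup.zero_closed ideal.axioms(1) by metis

lemma cls_eq_iff: "a \<in> carrier R \<Longrightarrow> b \<in> carrier R \<Longrightarrow> cls n a = cls n b \<longleftrightarrow> a \<ominus> b \<in> pow (Suc n)"
  unfolding cls_def using quotient_eq_iff_same_a_r_cos[OF pow_ideal] by blast

lemma cls_zero: "cls n \<zero> = pow (Suc n)"
  unfolding cls_def by (rule a_rcos_zero[OF pow_ideal zero_in_pow])

lemma cls_eq_pow_iff: "a \<in> carrier R \<Longrightarrow> cls n a = pow (Suc n) \<longleftrightarrow> a \<in> pow (Suc n)"
  using cls_eq_iff[of a \<zero> n] unfolding cls_zero by (simp add: a_minus_def)

lemma cls_add: "a \<in> carrier R \<Longrightarrow> b \<in> carrier R \<Longrightarrow> cls n a <+> cls n b = cls n (a \<oplus> b)"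
  unfolding cls_def by (rule ideal.a_rcos_sum[OF pow_ideal])

lemma rees_up: "a \<in> rees \<Longrightarrow> a \<in> up R"
  by (simp add: rees_def)

lemma rees_pow: "a \<in> rees \<Longrightarrow> a n \<in> pow n"
  by (simp add: rees_def)

lemma rees_closed: "a \<in> rees \<Longrightarrow> a n \<in> carrier R"
  using rees_pow pow_closed by blast

lemma reesI:
  assumes "\<And>n. a n \<in> pow n" "\<And>n. n > N \<Longrightarrow> a n = \<zero>"
  shows "a \<in> rees"
  unfolding rees_def using assms pow_closed by (auto intro!: mem_upI bound.intro)

lemma rees_single: "a \<in> pow n \<Longrightarrow> (\<lambda>k. if k = n then a else \<zero>) \<in> rees"
  by (rule reesI[of _ n]) (auto simp: zero_in_pow)

lemma gr_carrier: "carrier (gr R J) = gr_of ` rees"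
proof
  show "gr_of ` rees \<subseteq> carrier (gr R J)"
  proof
    fix f assume "f \<in> gr_of ` rees"
    then obtain a where a: "a \<in> rees" "f = gr_of a" by blast
    obtain N where "bound \<zero> N a" using bound_upD[OF rees_up[OF a(1)]] by blast
    hence "{n. f n \<noteq> pow (Suc n)} \<subseteq> {..N}"
      using a(2) cls_zero unfolding gr_of_def bound_def by (auto simp: not_le[symmetric])
    hence "finite {n. f n \<noteq> pow (Suc n)}" using finite_subset by blast
    thus "f \<in> carrier (gr R J)"
      using rees_pow[OF a(1)] a(2) by (auto simp: gr_def gr_component_def gr_of_def cls_def)
  qed
  show "carrier (gr R J) \<subseteq> gr_of ` rees"
  proof
    fix f assume f: "f \<in> carrier (gr R J)"
    hence "\<forall>n. \<exists>a. a \<in> pow n \<and> f n = cls n a" "finite {n. f n \<noteq> pow (Suc n)}"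
      by (auto simp: gr_def gr_component_def cls_def)
    then obtain a where a: "\<And>n. a n \<in> pow n" "\<And>n. f n = cls n (a n)" by metis
    define b where "b n = (if f n = pow (Suc n) then \<zero> else a n)" for n
    obtain N where N: "\<And>n. f n \<noteq> pow (Suc n) \<Longrightarrow> n \<le> N"
      using \<open>finite {n. f n \<noteq> pow (Suc n)}\<close> finite_nat_set_iff_bounded_le by auto
    have "b \<in> rees"
      by (rule reesI[of _ N]) (use a(1) zero_in_pow N in \<open>auto simp: b_def not_le[symmetric]\<close>)
    moreover have "f = gr_of b" using a(2) cls_zero by (auto simp: gr_of_def b_def fun_eq_iff)
    ultimately show "f \<in> gr_of ` rees" by blast
  qed
qed

lemma gr_of_closed: "a \<in> rees \<Longrightarrow> gr_of a \<in> carrier (gr R J)"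
  using gr_carrier by blast

lemma gr_repE:
  assumes "f \<in> carrier (gr R J)"
  obtains a where "a \<in> rees" "f = gr_of a"
  using assms gr_carrier by blast

lemma gr_zero: "\<zero>\<^bsub>gr R J\<^esub> = (\<lambda>n. pow (Suc n))"
  by (simp add: gr_def)

lemma gr_of_zero: "gr_of (\<lambda>n. \<zero>) = \<zero>\<^bsub>gr R J\<^esub>"
  unfolding gr_zero gr_of_def cls_zero ..

lemma gr_of_add:
  assumes "a \<in> rees" "b \<in> rees"
  shows "gr_of a \<oplus>\<^bsub>gr R J\<^esub> gr_of b = gr_of (\<lambda>n. a n \<oplus> b n)"
  using rees_closed assms by (simp add: gr_def gr_of_def cls_add)

lemma rees_add: "a \<in> rees \<Longrightarrow> b \<in> rees \<Longrightarrow> (\<lambda>n. a n \<oplus> b n) \<in> rees"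
  using up_add_closed additive_subgroup.a_closed[OF ideal.axioms(1)[OF pow_ideal]]
  by (auto simp: rees_def)

lemma rees_neg: "a \<in> rees \<Longrightarrow> (\<lambda>n. \<ominus> a n) \<in> rees"
  using up_a_inv_closed additive_subgroup.a_inv_closed[OF ideal.axioms(1)[OF pow_ideal]]
  by (auto simp: rees_def)

lemma rees_mult_coeff:
  assumes "a \<in> rees" "b \<in> rees"
  shows "(\<Oplus>i\<in>{..n}. a i \<otimes> b (n - i)) \<in> pow n"
proof -
  interpret p: ideal "pow n" R by (rule pow_ideal)
  have summand: "a i \<otimes> b (n - i) \<in> pow n" if "i \<le> n" for i
    using ideal_pow_mult_mem[OF J_ideal rees_pow[OF assms(1), of i] rees_pow[OF assms(2), of "n - i"]] that by simp
  have "(\<Oplus>i\<in>{..m}. a i \<otimes> b (n - i)) \<in> pow n" if "m \<le> n" for m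
    using that
  proof (induction m)
    case 0
    thus ?case using summand[of 0] rees_closed assms by simp
  next
    case (Suc m)
    thus ?case using summand[of "Suc m"] rees_closed assms by (simp add: p.a_closed)
  qed
  thus ?thesis by blast
qed

lemma rees_mult:
  assumes "a \<in> rees" "b \<in> rees"
  shows "(\<lambda>n. \<Oplus>i\<in>{..n}. a i \<otimes> b (n - i)) \<in> rees"
  unfolding rees_def using up_mult_closed[OF rees_up rees_up] assms rees_mult_coeff by auto

text \<open>The factors are cosets of two ideals and the modulus is a third one. The union that
  defines \<open>rcoset_mult\<close> still is a single coset, since changing representatives changes
  the product only by elements of \<open>J^(i+k+1)\<close>.\<close>

lemma rcoset_mult_cls:
  assumes a: "a \<in> pow i" and b: "b \<in> pow k"
  shows "rcoset_mult R (pow (Suc (i + k))) (cls i a) (cls k b) = cls (i + k) (a \<otimes> b)"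
proof -
  interpret n: ideal "pow (Suc (i + k))" R by (rule pow_ideal)
  interpret Pi: ideal "pow (Suc i)" R by (rule pow_ideal)
  interpret Pk: ideal "pow (Suc k)" R by (rule pow_ideal)
  have ac: "a \<in> carrier R" "b \<in> carrier R" using a b pow_closed by auto
  have eq: "cls (i + k) (a' \<otimes> b') = cls (i + k) (a \<otimes> b)" if "a' \<in> cls i a" "b' \<in> cls k b" for a' b'
  proof -
    obtain s t where st: "s \<in> pow (Suc i)" "a' = s \<oplus> a" "t \<in> pow (Suc k)" "b' = t \<oplus> b"
      using \<open>a' \<in> cls i a\<close> \<open>b' \<in> cls k b\<close> unfolding cls_def a_r_coset_def' by blast
    have c: "s \<in> carrier R" "t \<in> carrier R" using st pow_closed by auto
    have "s \<otimes> (t \<oplus> b) \<in> pow (Suc i + k)"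
      using st(1) ideal_pow_mult_mem[OF J_ideal st(1), of "t \<oplus> b" k] b
        ideal_pow_Suc_subset[OF J_ideal, of k] st(3)
        additive_subgroup.a_closed[OF ideal.axioms(1)[OF pow_ideal[of k]]] by blast
    moreover have "a \<otimes> t \<in> pow (i + Suc k)" by (rule ideal_pow_mult_mem[OF J_ideal a st(3)])
    ultimately have "s \<otimes> (t \<oplus> b) \<oplus> a \<otimes> t \<in> pow (Suc (i + k))" using n.a_closed by simp
    moreover have "a' \<otimes> b' \<ominus> a \<otimes> b = s \<otimes> (t \<oplus> b) \<oplus> a \<otimes> t"
    proof -
      have "a' \<otimes> b' = (s \<otimes> (t \<oplus> b) \<oplus> a \<otimes> t) \<oplus> a \<otimes> b"
        unfolding st(2,4) using c ac by (simp add: l_distr r_distr a_ac)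
      thus ?thesis using c ac by (simp add: a_minus_def a_assoc r_neg)
    qed
    ultimately show ?thesis using cls_eq_iff[of "a' \<otimes> b'" "a \<otimes> b" "i + k"] st c ac by simp
  qed
  have "a \<in> cls i a" "b \<in> cls k b"
    unfolding cls_def using Pi.a_rcos_self Pk.a_rcos_self ac by auto
  thus ?thesis unfolding rcoset_mult_def cls_def[of "i + k", symmetric] using eq by blast
qed

lemma gr_of_mult:
  assumes "a \<in> rees" "b \<in> rees"
  shows "gr_of a \<otimes>\<^bsub>gr R J\<^esub> gr_of b = gr_of (\<lambda>n. \<Oplus>i\<in>{..n}. a i \<otimes> b (n - i))"
proof
  fix n
  interpret h: ring_hom_ring R "R Quot pow (Suc n)" "(+>) (pow (Suc n))"
    by (rule ideal.rcos_ring_hom_ring[OF pow_ideal])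
  have "(gr_of a \<otimes>\<^bsub>gr R J\<^esub> gr_of b) n
      = (\<Oplus>\<^bsub>R Quot pow (Suc n)\<^esub>i\<in>{..n}. rcoset_mult R (pow (Suc n)) (gr_of a i) (gr_of b (n - i)))"
    by (simp only: gr_def monoid.simps)
  also have "\<dots> = (\<Oplus>\<^bsub>R Quot pow (Suc n)\<^esub>i\<in>{..n}. pow (Suc n) +> (a i \<otimes> b (n - i)))"
  proof (rule h.S.finsum_cong')
    fix i assume "i \<in> {..n}"
    thus "rcoset_mult R (pow (Suc n)) (gr_of a i) (gr_of b (n - i)) = pow (Suc n) +> (a i \<otimes> b (n - i))"
      using rcoset_mult_cls[OF rees_pow[OF assms(1), of i] rees_pow[OF assms(2), of "n - i"]]
      by (simp only: gr_of_def cls_def) simp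
  qed (use h.hom_closed rees_closed assms in auto)
  also have "\<dots> = pow (Suc n) +> (\<Oplus>i\<in>{..n}. a i \<otimes> b (n - i))"
    by (subst h.hom_finsum) (use rees_closed assms in \<open>auto simp: comp_def\<close>)
  finally show "(gr_of a \<otimes>\<^bsub>gr R J\<^esub> gr_of b) n = gr_of (\<lambda>n. \<Oplus>i\<in>{..n}. a i \<otimes> b (n - i)) n"
    by (simp only: gr_of_def cls_def)
qed

lemma gr_of_one: "gr_of (\<lambda>n. if n = 0 then \<one> else \<zero>) = \<one>\<^bsub>gr R J\<^esub>"
proof
  fix n
  show "gr_of (\<lambda>n. if n = 0 then \<one> else \<zero>) n = \<one>\<^bsub>gr R J\<^esub> n"
    using cls_zero[of n] unfolding gr_of_def gr_def by (cases n) (simp_all add: cls_def)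
qed

lemma one_rees: "(\<lambda>n. if n = 0 then \<one> else \<zero>) \<in> rees"
  by (rule rees_single) (simp only: ideal_pow_0 one_closed)

text \<open>The axioms are inherited: \<open>rees\<close> is a subring of the univariate polynomial
  ring, and \<open>gr_of\<close> respects the operations and maps it onto
  \<open>gr R J\<close>.\<close>

lemma gr_cring: "cring (gr R J)"
proof -
  interpret U: UP_cring R "UP R" by unfold_locales simp
  have add: "a \<oplus>\<^bsub>UP R\<^esub> b = (\<lambda>n. a n \<oplus> b n)" and mult: "a \<otimes>\<^bsub>UP R\<^esub> b = (\<lambda>n. \<Oplus>i\<in>{..n}. a i \<otimes> b (n - i))"
    if "a \<in> rees" "b \<in> rees" for a b
    using rees_up that by (auto simp: UP_def)
  have one: "\<one>\<^bsub>UP R\<^esub> = (\<lambda>n. if n = 0 then \<one> else \<zero>)" by (simp add: UP_def)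
  have zero: "\<zero>\<^bsub>UP R\<^esub> = (\<lambda>n. \<zero>)" by (simp add: UP_def)
  have sub: "rees \<subseteq> carrier (UP R)" using rees_up by (auto simp: UP_def)
  have neg: "\<ominus>\<^bsub>UP R\<^esub> a \<in> rees" if a: "a \<in> rees" for a
  proof -
    have "(\<lambda>n. \<ominus> a n) \<oplus>\<^bsub>UP R\<^esub> a = \<zero>\<^bsub>UP R\<^esub>"
      using add[OF rees_neg[OF a] a] rees_closed[OF a] by (simp add: zero l_neg)
    hence "\<ominus>\<^bsub>UP R\<^esub> a = (\<lambda>n. \<ominus> a n)"
      using U.P.minus_equality sub a rees_neg[OF a] by blast
    thus ?thesis using rees_neg[OF a] by simp
  qed
  have "subring rees (UP R)"
    by (rule U.P.subringI) (use sub neg one_rees rees_add rees_mult add mult in \<open>auto simp: one\<close>)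
  hence "ring (UP R\<lparr>carrier := rees\<rparr>)" by (rule U.P.subring_is_ring)
  moreover have "gr_of \<in> ring_hom (UP R\<lparr>carrier := rees\<rparr>) (gr R J)"
    by (rule ring_hom_memI) (use add mult one in \<open>auto simp: gr_of_closed gr_of_add gr_of_mult gr_of_one\<close>)
  ultimately have "ring (gr R J\<lparr>carrier := gr_of ` rees, zero := gr_of (\<lambda>n. \<zero>)\<rparr>)"
    using ring.ring_hom_imp_img_ring[of "UP R\<lparr>carrier := rees\<rparr>" gr_of "gr R J"] by (simp add: zero)
  moreover have "gr R J\<lparr>carrier := gr_of ` rees, zero := gr_of (\<lambda>n. \<zero>)\<rparr> = gr R J"
    unfolding gr_of_zero gr_carrier[symmetric] by simp
  ultimately interpret G: ring "gr R J" by simp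
  show ?thesis
  proof (rule cring.intro[OF G.ring_axioms], unfold_locales)
    fix f g assume "f \<in> carrier (gr R J)" "g \<in> carrier (gr R J)"
    then obtain a b where ab: "a \<in> rees" "f = gr_of a" "b \<in> rees" "g = gr_of b"
      by (meson gr_repE)
    have "a \<otimes>\<^bsub>UP R\<^esub> b = b \<otimes>\<^bsub>UP R\<^esub> a" using U.P.m_comm sub ab by blast
    thus "f \<otimes>\<^bsub>gr R J\<^esub> g = g \<otimes>\<^bsub>gr R J\<^esub> f"
      using ab gr_of_mult[OF ab(1,3)] gr_of_mult[OF ab(3,1)] mult by simp
  qed
qed

sublocale G: cring "gr R J"
  by (rule gr_cring)

lemma gr_of_neg:
  assumes "a \<in> rees" shows "\<ominus>\<^bsub>gr R J\<^esub> gr_of a = gr_of (\<lambda>n. \<ominus> a n)"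
proof (rule G.minus_equality)
  show "gr_of (\<lambda>n. \<ominus> a n) \<oplus>\<^bsub>gr R J\<^esub> gr_of a = \<zero>\<^bsub>gr R J\<^esub>"
    using gr_of_add[OF rees_neg[OF assms] assms] rees_closed[OF assms] by (simp add: l_neg gr_of_zero)
qed (use assms rees_neg gr_of_closed in auto)

lemma gr_single_closed: "a \<in> pow n \<Longrightarrow> gr_single n a \<in> carrier (gr R J)"
  unfolding gr_single_def by (rule gr_of_closed[OF rees_single])

lemma gr_mult_single:
  assumes a: "a \<in> rees" and b: "b \<in> pow m"
  shows "(gr_of a \<otimes>\<^bsub>gr R J\<^esub> gr_single m b) n = (if m \<le> n then cls n (a (n - m) \<otimes> b) else pow (Suc n))"
proof -
  have bc: "b \<in> carrier R" using b pow_closed by blast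
  let ?b = "\<lambda>k. if k = m then b else \<zero>"
  have "(\<Oplus>i\<in>{..n}. a i \<otimes> ?b (n - i)) = (if m \<le> n then a (n - m) \<otimes> b else \<zero>)"
  proof (cases "m \<le> n")
    case True
    have "(\<Oplus>i\<in>{..n}. a i \<otimes> ?b (n - i)) = (\<Oplus>i\<in>{..n}. if n - m = i then a i \<otimes> b else \<zero>)"
      by (rule finsum_cong') (use True rees_closed[OF a] bc in auto)
    also have "\<dots> = a (n - m) \<otimes> b"
      by (rule finsum_singleton) (use rees_closed[OF a] bc in auto)
    finally show ?thesis using True by simp
  next
    case False
    have "(\<Oplus>i\<in>{..n}. a i \<otimes> ?b (n - i)) = (\<Oplus>i\<in>{..n}. \<zero>)"
      by (rule finsum_cong') (use False rees_closed[OF a] bc in auto)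
    thus ?thesis using False by simp
  qed
  thus ?thesis
    unfolding gr_single_def gr_of_mult[OF a rees_single[OF b]] unfolding gr_of_def
    by (simp only: cls_zero if_distrib[of "cls n"])
qed

lemma gr_single_mult:
  assumes "a \<in> pow m" "b \<in> pow n"
  shows "gr_single m a \<otimes>\<^bsub>gr R J\<^esub> gr_single n b = gr_single (m + n) (a \<otimes> b)"
proof
  fix k
  have "b \<in> carrier R" using assms pow_closed by blast
  thus "(gr_single m a \<otimes>\<^bsub>gr R J\<^esub> gr_single n b) k = gr_single (m + n) (a \<otimes> b) k"
    unfolding gr_single_def[of m] gr_mult_single[OF rees_single[OF assms(1)] assms(2)]
    unfolding gr_single_def gr_of_def by (auto simp: cls_zero)
qed

section \<open>Initial ideals described degree by degree\<close>

lemma adic_order_eq_iff: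
  assumes "a \<in> carrier R"
  shows "enat n = adic_order R J a \<longleftrightarrow> a \<in> pow n \<and> a \<notin> pow (Suc n)"
proof
  have mono: "a \<in> pow k" if "a \<in> pow l" "k \<le> l" for k l
    using that ideal_pow_antimono[OF J_ideal] by blast
  let ?X = "enat ` {r. a \<in> pow r}"
  show "enat n = adic_order R J a" if "a \<in> pow n \<and> a \<notin> pow (Suc n)"
  proof -
    have "r \<le> n" if "a \<in> pow r" for r
      using mono[OF that, of "Suc n"] \<open>a \<in> pow n \<and> a \<notin> pow (Suc n)\<close> by (meson not_less_eq_eq)
    hence "Sup ?X \<le> enat n" by (intro Sup_least) auto
    moreover have "enat n \<le> Sup ?X" using that by (intro Sup_upper) auto
    ultimately show ?thesis unfolding adic_order_def by (rule order.antisym[rotated])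
  qed
  assume n: "enat n = adic_order R J a"
  have "a \<notin> pow (Suc n)"
  proof
    assume "a \<in> pow (Suc n)"
    hence "enat (Suc n) \<le> Sup ?X" by (intro Sup_upper) auto
    hence "enat (Suc n) \<le> enat n" using n unfolding adic_order_def by (simp only:)
    thus False by simp
  qed
  moreover have "a \<in> pow n"
  proof (rule ccontr)
    assume na: "a \<notin> pow n"
    have "a \<in> pow 0" using assms by (simp only: ideal_pow_0)
    hence "n \<noteq> 0" using na by metis
    have "r \<le> n - 1" if "a \<in> pow r" for r
    proof (rule ccontr)
      assume "\<not> r \<le> n - 1"
      hence "n \<le> r" by simp
      thus False using mono[OF that] na by blast
    qed
    hence "Sup ?X \<le> enat (n - 1)" by (intro Sup_least) auto
    hence "enat n \<le> enat (n - 1)" using n unfolding adic_order_def by (simp only:)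
    thus False using \<open>n \<noteq> 0\<close> by simp
  qed
  ultimately show "a \<in> pow n \<and> a \<notin> pow (Suc n)" by blast
qed

text \<open>In degree \<open>n\<close> this is the image of \<open>K \<inter> J^n\<close> in
  \<open>J^n/J^(n+1)\<close>. It turns out to be the initial ideal, described without
  generators.\<close>

definition graded_part :: "'a set \<Rightarrow> (nat \<Rightarrow> 'a set) set"
  where "graded_part K = {f \<in> carrier (gr R J). \<forall>n. \<exists>a\<in>K \<inter> pow n. f n = cls n a}"

text \<open>Zero components receive the representative zero. This makes the chosen sequence finitely
  supported, and \<open>gr_ge_repE\<close> relies on it again.\<close>

lemma graded_part_repE:
  assumes "f \<in> graded_part K" "\<zero> \<in> K"
  obtains a where "a \<in> rees" "\<And>n. a n \<in> K" "f = gr_of a"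
    "\<And>n. f n = pow (Suc n) \<Longrightarrow> a n = \<zero>"
proof -
  have f: "f \<in> carrier (gr R J)" "\<forall>n. \<exists>a. a \<in> K \<and> a \<in> pow n \<and> f n = cls n a"
    using assms(1) by (auto simp: graded_part_def)
  then obtain a where a: "\<And>n. a n \<in> K \<and> a n \<in> pow n \<and> f n = cls n (a n)" by metis
  define b where "b n = (if f n = pow (Suc n) then \<zero> else a n)" for n
  have "finite {n. f n \<noteq> pow (Suc n)}" using f(1) by (simp add: gr_def)
  then obtain N where N: "\<And>n. f n \<noteq> pow (Suc n) \<Longrightarrow> n \<le> N"
    using finite_nat_set_iff_bounded_le by auto
  have "b \<in> rees"
  proof (rule reesI)
    show "b n \<in> pow n" for n using a[of n] zero_in_pow by (simp add: b_def)
    show "b n = \<zero>" if "N < n" for n using N[of n] that by (auto simp: b_def)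
  qed
  moreover have "b n \<in> K" for n using a assms(2) by (simp add: b_def)
  moreover have "f = gr_of b" using a cls_zero by (auto simp: gr_of_def b_def fun_eq_iff)
  ultimately show ?thesis using that by (simp add: b_def)
qed

lemma gr_of_in_graded_part: "a \<in> rees \<Longrightarrow> (\<And>n. a n \<in> K) \<Longrightarrow> gr_of a \<in> graded_part K"
  unfolding graded_part_def using gr_of_closed rees_pow by (auto simp: gr_of_def)

lemma graded_part_ideal:
  assumes "ideal K R" shows "ideal (graded_part K) (gr R J)"
proof -
  interpret K: ideal K R by fact
  have mult: "f \<otimes>\<^bsub>gr R J\<^esub> g \<in> graded_part K" if fK: "f \<in> graded_part K" and g: "g \<in> carrier (gr R J)" for f g
  proof -
    obtain a where a: "a \<in> rees" "\<And>n. a n \<in> K" "f = gr_of a"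
      using fK by (rule graded_part_repE) auto
    obtain b where b: "b \<in> rees" "g = gr_of b" using g by (rule gr_repE)
    have t: "a i \<otimes> b k \<in> K" for i k using a(2) rees_closed[OF b(1)] by (rule K.I_r_closed)
    have "(\<Oplus>i\<in>{..m}. a i \<otimes> b (n - i)) \<in> K" for m n
    proof (induction m)
      case 0
      show ?case using t[of 0 n] K.Icarr[OF t] by simp
    next
      case (Suc m)
      thus ?case using t[of "Suc m" "n - Suc m"] K.Icarr[OF t] by (simp add: Pi_def K.a_closed)
    qed
    thus ?thesis unfolding a(3) b(2) gr_of_mult[OF a(1) b(1)]
      by (intro gr_of_in_graded_part rees_mult a(1) b(1))
  qed
  show ?thesis
  proof (rule idealI[OF G.ring_axioms])
    show "subgroup (graded_part K) (add_monoid (gr R J))"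
    proof (rule G.add.subgroupI)
      show "graded_part K \<subseteq> carrier (gr R J)" by (auto simp: graded_part_def)
      show "graded_part K \<noteq> {}"
        using gr_of_in_graded_part[OF reesI[of "\<lambda>_. \<zero>" 0], of K] zero_in_pow K.zero_closed by blast
      fix f assume f: "f \<in> graded_part K"
      obtain a where a: "a \<in> rees" "\<And>n. a n \<in> K" "f = gr_of a"
        using f by (rule graded_part_repE) auto
      show "\<ominus>\<^bsub>gr R J\<^esub> f \<in> graded_part K"
        unfolding a(3) gr_of_neg[OF a(1)] using a by (intro gr_of_in_graded_part rees_neg) auto
      fix g assume g: "g \<in> graded_part K"
      obtain b where b: "b \<in> rees" "\<And>n. b n \<in> K" "g = gr_of b"
        using g by (rule graded_part_repE) auto
      show "f \<oplus>\<^bsub>gr R J\<^esub> g \<in> graded_part K"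
        unfolding a(3) b(3) gr_of_add[OF a(1) b(1)] using a b
        by (intro gr_of_in_graded_part rees_add) auto
    qed
    fix f g assume f: "f \<in> graded_part K" and g: "g \<in> carrier (gr R J)"
    show "f \<otimes>\<^bsub>gr R J\<^esub> g \<in> graded_part K" by (rule mult[OF f g])
    moreover have "f \<in> carrier (gr R J)" using f by (simp add: graded_part_def)
    ultimately show "g \<otimes>\<^bsub>gr R J\<^esub> f \<in> graded_part K" using g G.m_comm by metis
  qed
qed

lemma gr_of_mem_if_singles_mem:
  assumes H: "ideal H (gr R J)" and a: "a \<in> rees" and homs: "\<And>n. gr_single n (a n) \<in> H"
  shows "gr_of a \<in> H"
proof -
  interpret H: ideal H "gr R J" by fact
  define t where "t N = (\<lambda>n. if n < N then a n else \<zero>)" for N :: nat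
  have t: "t N \<in> rees" for N
    by (rule reesI[of _ N]) (auto simp: t_def rees_pow[OF a] zero_in_pow)
  have "gr_of (t N) \<in> H" for N
  proof (induction N)
    case 0
    have "t 0 = (\<lambda>n. \<zero>)" by (simp add: t_def)
    thus ?case using H.zero_closed by (simp add: gr_of_zero)
  next
    case (Suc N)
    have "gr_of (t (Suc N)) = gr_of (t N) \<oplus>\<^bsub>gr R J\<^esub> gr_single N (a N)"
      unfolding gr_single_def gr_of_add[OF t rees_single[OF rees_pow[OF a]]]
      by (rule arg_cong[of _ _ gr_of]) (use rees_closed[OF a] in \<open>auto simp: t_def fun_eq_iff less_Suc_eq\<close>)
    thus ?case using Suc homs H.a_closed by simp
  qed
  moreover obtain N where "bound \<zero> N a" using bound_upD[OF rees_up[OF a]] by blast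
  hence "t (Suc N) = a" by (auto simp: t_def fun_eq_iff bound_def)
  ultimately show ?thesis by metis
qed

lemma initial_ideal_eq:
  assumes K: "ideal K R"
  shows "initial_ideal R J K = graded_part K"
proof
  interpret K: ideal K R by fact
  interpret S: ideal "graded_part K" "gr R J" by (rule graded_part_ideal[OF K])
  have init: "initial_form R J a \<in> graded_part K" if a: "a \<in> K" for a
  proof (cases "\<exists>n. enat n = adic_order R J a \<and> a \<noteq> \<zero>")
    case True
    then obtain n where n: "enat n = adic_order R J a" "a \<noteq> \<zero>" by blast
    hence an: "a \<in> pow n" using adic_order_eq_iff a K.Icarr by blast
    have "initial_form R J a = gr_single n a"
      using n by (auto simp: initial_form_def gr_single_def gr_of_def cls_zero gr_zero cls_def[symmetric] n(1)[symmetric] fun_eq_iff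
         )
    thus ?thesis unfolding gr_single_def
      using a K.zero_closed by (auto intro!: gr_of_in_graded_part rees_single an)
  next
    \<comment> \<open>Either \<open>a\<close> is zero or its order is infinite; its initial form
      vanishes in both cases.\<close>
    case False
    hence "initial_form R J a = \<zero>\<^bsub>gr R J\<^esub>" by (auto simp: initial_form_def)
    thus ?thesis using S.zero_closed by simp
  qed
  show "initial_ideal R J K \<subseteq> graded_part K"
    unfolding initial_ideal_def by (rule G.genideal_minimal[OF S.ideal_axioms]) (use init in auto)
  have sub: "initial_form R J ` K \<subseteq> carrier (gr R J)" using init S.Icarr by auto
  interpret H: ideal "initial_ideal R J K" "gr R J"
    unfolding initial_ideal_def by (rule G.genideal_ideal[OF sub])
  show "graded_part K \<subseteq> initial_ideal R J K"
  proof
    fix f assume f: "f \<in> graded_part K"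
    obtain a where a: "a \<in> rees" "\<And>n. a n \<in> K" "f = gr_of a"
      using f by (rule graded_part_repE) auto
    \<comment> \<open>Each homogeneous component is zero or the initial form of its representative,
      which then has order exactly \<open>n\<close>.\<close>
    have "gr_single n (a n) \<in> initial_ideal R J K" for n
    proof (cases "a n \<in> pow (Suc n)")
      case True
      have "gr_single n (a n) = \<zero>\<^bsub>gr R J\<^esub>"
        using cls_eq_pow_iff[OF rees_closed[OF a(1)], of n n] True
        by (auto simp: gr_single_def gr_of_def cls_zero gr_zero fun_eq_iff)
      thus ?thesis using H.zero_closed by simp
    next
      case False
      hence ord: "enat n = adic_order R J (a n)" "a n \<noteq> \<zero>"
        using adic_order_eq_iff[OF rees_closed[OF a(1)]] rees_pow[OF a(1)] zero_in_pow by metis+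
      hence "initial_form R J (a n) = gr_single n (a n)"
        by (auto simp: ord(1)[symmetric] initial_form_def gr_single_def gr_of_def cls_zero gr_zero cls_def[symmetric] fun_eq_iff)
      moreover have "initial_form R J (a n) \<in> initial_ideal R J K"
        unfolding initial_ideal_def using G.genideal_self[OF sub] a(2) by blast
      ultimately show ?thesis by simp
    qed
    thus "f \<in> initial_ideal R J K" unfolding a(3) by (rule gr_of_mem_if_singles_mem[OF H.ideal_axioms a(1)])
  qed
qed

text \<open>An upper bound for the powers of \<open>gr_pos R J\<close> that can be read off from
  components.\<close>

definition gr_ge :: "nat \<Rightarrow> (nat \<Rightarrow> 'a set) set"
  where "gr_ge i = {f \<in> carrier (gr R J). \<forall>n<i. f n = pow (Suc n)}"

lemma gr_ge_repE:
  assumes "f \<in> gr_ge i"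
  obtains a where "a \<in> rees" "f = gr_of a" "\<And>n. n < i \<Longrightarrow> a n = \<zero>"
proof -
  have "f \<in> graded_part (carrier R)"
  proof -
    have "\<exists>a\<in>carrier R \<inter> pow n. f n = cls n a" for n
    proof -
      have "f n \<in> gr_component R J n" using assms by (simp add: gr_ge_def gr_def)
      thus ?thesis using pow_closed unfolding gr_component_def cls_def by blast
    qed
    thus ?thesis using assms by (simp add: graded_part_def gr_ge_def)
  qed
  then obtain a where "a \<in> rees" "f = gr_of a" "\<And>n. f n = pow (Suc n) \<Longrightarrow> a n = \<zero>"
    using zero_closed by (rule graded_part_repE) blast
  thus ?thesis using assms that by (auto simp: gr_ge_def)
qed

lemma gr_of_in_gr_ge: "a \<in> rees \<Longrightarrow> (\<And>n. n < i \<Longrightarrow> a n = \<zero>) \<Longrightarrow> gr_of a \<in> gr_ge i"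
  by (simp add: gr_ge_def gr_of_closed) (simp add: gr_of_def cls_zero)

lemma gr_ge_mult:
  assumes "f \<in> gr_ge i" "g \<in> gr_ge k"
  shows "f \<otimes>\<^bsub>gr R J\<^esub> g \<in> gr_ge (i + k)"
proof -
  obtain a where a: "a \<in> rees" "f = gr_of a" "\<And>n. n < i \<Longrightarrow> a n = \<zero>" using assms(1) by (rule gr_ge_repE) blast
  obtain b where b: "b \<in> rees" "g = gr_of b" "\<And>n. n < k \<Longrightarrow> b n = \<zero>" using assms(2) by (rule gr_ge_repE) blast
  show ?thesis unfolding a(2) b(2) gr_of_mult[OF a(1) b(1)]
  proof (rule gr_of_in_gr_ge[OF rees_mult[OF a(1) b(1)]])
    fix n assume n: "n < i + k"
    have "(\<Oplus>j\<in>{..n}. a j \<otimes> b (n - j)) = (\<Oplus>j\<in>{..n}. \<zero>)"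
    proof (rule finsum_cong')
      fix j assume j: "j \<in> {..n}"
      show "a j \<otimes> b (n - j) = \<zero>"
      proof (cases "j < i")
        case True
        thus ?thesis using a(3) rees_closed[OF b(1)] by simp
      next
        case False
        hence "n - j < k" using n j by (simp add: not_less)
        thus ?thesis using b(3) rees_closed[OF a(1)] by simp
      qed
    qed auto
    thus "(\<Oplus>j\<in>{..n}. a j \<otimes> b (n - j)) = \<zero>" by simp
  qed
qed

lemma gr_ge_ideal: "ideal (gr_ge i) (gr R J)"
proof (rule idealI[OF G.ring_axioms])
  show "subgroup (gr_ge i) (add_monoid (gr R J))"
  proof (rule G.add.subgroupI)
    show "gr_ge i \<subseteq> carrier (gr R J)" by (auto simp: gr_ge_def)
    show "gr_ge i \<noteq> {}"
      using gr_of_in_gr_ge[OF reesI[of "\<lambda>_. \<zero>" 0], of i] zero_in_pow by blast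
    fix f assume f: "f \<in> gr_ge i"
    obtain a where a: "a \<in> rees" "f = gr_of a" "\<And>n. n < i \<Longrightarrow> a n = \<zero>" using f by (rule gr_ge_repE) blast
    show "\<ominus>\<^bsub>gr R J\<^esub> f \<in> gr_ge i"
      unfolding a(2) gr_of_neg[OF a(1)] using a by (intro gr_of_in_gr_ge rees_neg) auto
    fix g assume g: "g \<in> gr_ge i"
    obtain b where b: "b \<in> rees" "g = gr_of b" "\<And>n. n < i \<Longrightarrow> b n = \<zero>" using g by (rule gr_ge_repE) blast
    show "f \<oplus>\<^bsub>gr R J\<^esub> g \<in> gr_ge i"
      unfolding a(2) b(2) gr_of_add[OF a(1) b(1)] using a b by (intro gr_of_in_gr_ge rees_add) auto
  qed
  fix f g assume f: "f \<in> gr_ge i" and g: "g \<in> carrier (gr R J)"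
  have "g \<in> gr_ge 0" using g by (simp add: gr_ge_def)
  thus "g \<otimes>\<^bsub>gr R J\<^esub> f \<in> gr_ge i" "f \<otimes>\<^bsub>gr R J\<^esub> g \<in> gr_ge i"
    using gr_ge_mult[OF _ f, of g 0] gr_ge_mult[OF f, of g 0] by simp_all
qed

lemma gr_pos_eq: "gr_pos R J = gr_ge 1"
  by (auto simp: gr_pos_def gr_ge_def gr_zero)

lemma gr_pos_ideal: "ideal (gr_pos R J) (gr R J)"
  unfolding gr_pos_eq by (rule gr_ge_ideal)

lemma gr_pos_pow_subset: "ideal_pow (gr R J) (gr_pos R J) i \<subseteq> gr_ge i"
proof (induction i)
  case 0
  show ?case by (simp only: G.ideal_pow_0) (simp add: gr_ge_def)
next
  case (Suc i)
  show ?case unfolding G.ideal_pow_Suc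
    by (rule G.ideal_prod_subsetI[OF gr_ge_ideal]) (use Suc gr_ge_mult[of _ i _ 1] gr_pos_eq in auto)
qed

lemma gr_single_in_gr_pos: "y \<in> J \<Longrightarrow> gr_single 1 y \<in> gr_pos R J"
  unfolding gr_pos_eq gr_single_def using ideal_pow_1[OF J_ideal]
  by (intro gr_of_in_gr_ge rees_single) simp_all

lemma gr_single_power:
  assumes "y \<in> J"
  shows "y [^] i \<in> pow i" "gr_single i (y [^] i) \<in> ideal_pow (gr R J) (gr_pos R J) i"
proof -
  have y1: "y \<in> pow 1" using assms ideal_pow_1[OF J_ideal] by simp
  have yc: "y \<in> carrier R" using y1 pow_closed by blast
  show pw: "y [^] i \<in> pow i" for i
  proof (induction i)
    case 0
    show ?case by (simp only: ideal_pow_0) simp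
  next
    case (Suc i)
    show ?case using ideal_pow_mult_mem[OF J_ideal Suc.IH y1] by simp
  qed
  show "gr_single i (y [^] i) \<in> ideal_pow (gr R J) (gr_pos R J) i"
  proof (induction i)
    case 0
    have "gr_single 0 \<one> \<in> carrier (gr R J)" by (rule gr_single_closed) (simp only: ideal_pow_0 one_closed)
    thus ?case by (simp only: G.ideal_pow_0) simp
  next
    case (Suc i)
    have "gr_single (Suc i) (y [^] Suc i) = gr_single i (y [^] i) \<otimes>\<^bsub>gr R J\<^esub> gr_single 1 y"
      using gr_single_mult[OF pw[of i] y1] by simp
    thus ?case unfolding G.ideal_pow_Suc using ideal_prod.prod[OF Suc.IH gr_single_in_gr_pos[OF assms]] by metis
  qed
qed

text \<open>An element has finitely many nonzero components, so a single power of \<open>J\<close>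
  multiplies all chosen representatives into \<open>K\<close>. This direction is independent of
  monomials.\<close>

lemma graded_part_saturation_subset:
  assumes K: "ideal K R"
  shows "graded_part (saturation R J K) \<subseteq> saturation (gr R J) (gr_pos R J) (graded_part K)"
proof
  interpret K: ideal K R by fact
  interpret S: ideal "saturation R J K" R by (rule saturation_ideal[OF J_ideal K])
  fix f assume f: "f \<in> graded_part (saturation R J K)"
  obtain a where a: "a \<in> rees" "\<And>n. a n \<in> saturation R J K" "f = gr_of a"
    using f by (rule graded_part_repE) auto
  obtain N where N: "\<And>n. n > N \<Longrightarrow> a n = \<zero>" using bound_upD[OF rees_up[OF a(1)]] by (auto simp: bound_def)
  have "\<exists>i. \<forall>c\<in>pow i. a n \<otimes> c \<in> K" for n
    using a(2)[of n] unfolding saturation_def ideal_colon_def by blast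
  then obtain i where i: "\<And>n c. c \<in> pow (i n) \<Longrightarrow> a n \<otimes> c \<in> K" by metis
  \<comment> \<open>The sum dominates every \<open>i n\<close> with \<open>n \<le> N\<close>, and
    \<open>Suc\<close> provides the positive exponent required by \<open>saturation\<close>.\<close>
  define M where "M = Suc (\<Sum>n\<le>N. i n)"
  have M: "a n \<otimes> c \<in> K" if "c \<in> pow M" for n c
  proof (cases "n \<le> N")
    case True
    hence "i n \<le> (\<Sum>n\<le>N. i n)" by (intro member_le_sum) auto
    thus ?thesis using i ideal_pow_antimono[OF J_ideal, of "i n" M] that by (auto simp: M_def)
  next
    case False
    thus ?thesis using N[of n] pow_closed[OF that] by simp
  qed
  have "f \<otimes>\<^bsub>gr R J\<^esub> g \<in> graded_part K" if "g \<in> ideal_pow (gr R J) (gr_pos R J) M" for g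
  proof -
    have "g \<in> gr_ge M" using that gr_pos_pow_subset by blast
    then obtain b where b: "b \<in> rees" "g = gr_of b" "\<And>n. n < M \<Longrightarrow> b n = \<zero>" by (rule gr_ge_repE) blast
    have "b n \<in> pow M" for n
    proof (cases "n < M")
      case True
      thus ?thesis using b(3) zero_in_pow by metis
    next
      case False
      thus ?thesis using rees_pow[OF b(1), of n] ideal_pow_antimono[OF J_ideal, of M n] by auto
    qed
    hence t: "a j \<otimes> b k \<in> K" for j k by (rule M)
    have "(\<Oplus>j\<in>{..m}. a j \<otimes> b (n - j)) \<in> K" for m n
    proof (induction m)
      case 0
      show ?case using t[of 0 n] K.Icarr[OF t] by simp
    next
      case (Suc m)
      thus ?case using t[of "Suc m" "n - Suc m"] K.Icarr[OF t] by (simp add: Pi_def K.a_closed)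
    qed
    thus ?thesis unfolding a(3) b(2) gr_of_mult[OF a(1) b(1)]
      by (intro gr_of_in_graded_part rees_mult a(1) b(1))
  qed
  moreover have "f \<in> carrier (gr R J)" using f by (simp add: graded_part_def)
  moreover have "M \<ge> 1" by (simp add: M_def)
  ultimately show "f \<in> saturation (gr R J) (gr_pos R J) (graded_part K)"
    unfolding saturation_def ideal_colon_def by blast
qed

text \<open>\<open>nzd\<close> makes multiplication by the degree-one class of \<open>y\<close>
  injective in every degree, hence on all of \<open>gr R J\<close>, so that this class alone is a
  regular sequence. If \<open>gr_pos R J\<close> is the unit ideal, the grade is infinite by
  convention.\<close>

lemma depth_gr_pos:
  assumes y: "y \<in> J" and nzd: "\<And>n a. a \<in> pow n \<Longrightarrow> a \<otimes> y \<in> pow (Suc (Suc n)) \<Longrightarrow> a \<in> pow (Suc n)"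
  shows "depth_gr R J > 0"
proof (cases "gr_pos R J = carrier (gr R J)")
  case True
  thus ?thesis by (simp add: depth_gr_def grade_def)
next
  case False
  let ?l = "gr_single 1 y"
  interpret P: ideal "gr_pos R J" "gr R J" by (rule gr_pos_ideal)
  have y1: "y \<in> pow 1" using y ideal_pow_1[OF J_ideal] by simp
  have l: "?l \<in> gr_pos R J" by (rule gr_single_in_gr_pos[OF y])
  hence lc: "?l \<in> carrier (gr R J)" by (rule P.Icarr)
  have e: "genideal (gr R J) {} = {\<zero>\<^bsub>gr R J\<^esub>}"
  proof
    show "genideal (gr R J) {} \<subseteq> {\<zero>\<^bsub>gr R J\<^esub>}" by (rule G.genideal_minimal[OF G.zeroideal]) auto
    show "{\<zero>\<^bsub>gr R J\<^esub>} \<subseteq> genideal (gr R J) {}"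
      using additive_subgroup.zero_closed[OF ideal.axioms(1)[OF G.genideal_ideal[of "{}"]]] by auto
  qed
  have "f = \<zero>\<^bsub>gr R J\<^esub>" if f: "f \<in> carrier (gr R J)" "f \<otimes>\<^bsub>gr R J\<^esub> ?l = \<zero>\<^bsub>gr R J\<^esub>" for f
  proof
    fix n
    obtain a where a: "a \<in> rees" "f = gr_of a" using f(1) by (rule gr_repE)
    have ac: "a n \<in> carrier R" "y \<in> carrier R" using rees_closed[OF a(1)] pow_closed[OF y1] by auto
    have "cls (Suc n) (a n \<otimes> y) = pow (Suc (Suc n))"
      using fun_cong[OF f(2), of "Suc n"] gr_mult_single[OF a(1) y1, of "Suc n"] unfolding a(2) gr_zero by simp
    hence "a n \<otimes> y \<in> pow (Suc (Suc n))" using cls_eq_pow_iff[of "a n \<otimes> y" "Suc n"] ac by blast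
    hence "a n \<in> pow (Suc n)" using nzd rees_pow[OF a(1)] by blast
    thus "f n = \<zero>\<^bsub>gr R J\<^esub> n" unfolding a(2) gr_of_def gr_zero using cls_eq_pow_iff[OF ac(1)] by blast
  qed
  moreover have "genideal (gr R J) {?l} \<noteq> carrier (gr R J)"
    using G.genideal_minimal[OF P.ideal_axioms, of "{?l}"] l False P.a_subset by auto
  ultimately have "regular_sequence (gr R J) [?l]"
    unfolding regular_sequence_def using lc e by simp
  hence "enat (length [?l]) \<in> {enat (length xs) | xs. set xs \<subseteq> gr_pos R J \<and> regular_sequence (gr R J) xs}"
    using l by (intro CollectI exI[of _ "[?l]"]) simp
  hence "enat (length [?l]) \<le> Sup {enat (length xs) | xs. set xs \<subseteq> gr_pos R J \<and> regular_sequence (gr R J) xs}"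
    by (rule Sup_upper)
  also have "\<dots> = depth_gr R J" using False by (simp add: depth_gr_def grade_def)
  finally have "enat 1 \<le> depth_gr R J" by simp
  moreover have "0 < enat 1" by (simp add: zero_enat_def)
  ultimately show ?thesis by (rule less_le_trans[rotated])
qed

end

section \<open>Saturations and initial ideals of monomial ideals\<close>

lemma (in ring_hom_ring) image_ideal_prod:
  assumes "ideal A R" "ideal B R"
  shows "ideal_prod S (h ` A) (h ` B) = h ` ideal_prod R A B"
proof
  have sub: "A \<subseteq> carrier R" "B \<subseteq> carrier R" "ideal_prod R A B \<subseteq> carrier R"
    using ideal.Icarr[OF assms(1)] ideal.Icarr[OF assms(2)] R.ideal_prod_in_carrier[OF assms] by auto
  show "ideal_prod S (h ` A) (h ` B) \<subseteq> h ` ideal_prod R A B"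
  proof
    fix s assume "s \<in> ideal_prod S (h ` A) (h ` B)"
    thus "s \<in> h ` ideal_prod R A B"
    proof induction
      case (prod i j)
      then obtain a b where ab: "a \<in> A" "b \<in> B" "i = h a" "j = h b" by blast
      have "a \<in> carrier R" "b \<in> carrier R" using ab(1,2) sub(1,2) by auto
      hence "i \<otimes>\<^bsub>S\<^esub> j = h (a \<otimes> b)" unfolding ab(3,4) by simp
      thus ?case using ideal_prod.prod[OF ab(1,2), of R] by blast
    next
      case (sum s1 s2)
      then obtain a b where ab: "a \<in> ideal_prod R A B" "b \<in> ideal_prod R A B" "s1 = h a" "s2 = h b" by blast
      have "a \<in> carrier R" "b \<in> carrier R" using ab(1,2) sub(3) by auto
      hence "s1 \<oplus>\<^bsub>S\<^esub> s2 = h (a \<oplus> b)" unfolding ab(3,4) by simp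
      thus ?case using ideal_prod.sum[OF ab(1,2)] by blast
    qed
  qed
  show "h ` ideal_prod R A B \<subseteq> ideal_prod S (h ` A) (h ` B)"
  proof
    fix y assume "y \<in> h ` ideal_prod R A B"
    then obtain s where s: "s \<in> ideal_prod R A B" "y = h s" by blast
    from s(1) have "h s \<in> ideal_prod S (h ` A) (h ` B)"
    proof induction
      case (prod i j)
      have "i \<in> carrier R" "j \<in> carrier R" using prod sub(1,2) by auto
      hence "h (i \<otimes> j) = h i \<otimes>\<^bsub>S\<^esub> h j" by simp
      thus ?case using prod by (auto intro: ideal_prod.prod)
    next
      case (sum s1 s2)
      have "s1 \<in> carrier R" "s2 \<in> carrier R" using sum(1,2) sub(3) by auto
      hence "h (s1 \<oplus> s2) = h s1 \<oplus>\<^bsub>S\<^esub> h s2" by simp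
      thus ?case using sum by (auto intro: ideal_prod.sum)
    qed
    thus "y \<in> ideal_prod S (h ` A) (h ` B)" using s(2) by simp
  qed
qed

text \<open>Lets conditions on powers in the quotient ring be pulled back to powers of
  \<open>J\<close> in \<open>R\<close>.\<close>

lemma (in cring) quot_ideal_pow:
  assumes J: "ideal J R" and K: "ideal K R"
  shows "ideal_pow (R Quot K) (quot_ideal R J K) n = (+>) K ` ideal_pow R J n"
proof -
  interpret h: ring_hom_ring R "R Quot K" "(+>) K" by (rule ideal.rcos_ring_hom_ring[OF K])
  interpret Q: cring "R Quot K" by (rule ideal.quotient_is_cring[OF K is_cring])
  have carr: "carrier (R Quot K) = (+>) K ` carrier R"
    unfolding FactRing_def by (simp add: A_RCOSETS_def') blast
  show ?thesis
  proof (induction n)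
    case 0
    show ?case by (simp only: ideal_pow_0 Q.ideal_pow_0 carr)
  next
    case (Suc n)
    have "ideal_pow (R Quot K) (quot_ideal R J K) (Suc n)
        = ideal_prod (R Quot K) ((+>) K ` ideal_pow R J n) ((+>) K ` J)"
      unfolding Q.ideal_pow_Suc Suc by (simp add: quot_ideal_def)
    also have "\<dots> = (+>) K ` ideal_pow R J (Suc n)"
      unfolding ideal_pow_Suc by (rule h.image_ideal_prod[OF ideal_pow_ideal[OF J] J])
    finally show ?case .
  qed
qed

context independent_generators
begin

text \<open>The way back from spans to initial ideals: modulo \<open>\<mm>^(n+1)\<close> the element
  \<open>a\<close> agrees with an element of the saturation that itself lies in
  \<open>\<mm>^n\<close>.\<close>

lemma mon_span_saturated_split:
  assumes S: "upward_closed S" and a: "a \<in> mon_span (saturated_exponents S \<inter> exponents_deg d n) n"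
  shows "\<exists>k \<in> saturation R \<mm> (Idl (mon ` S)) \<inter> ideal_pow R \<mm> n. \<exists>q \<in> ideal_pow R \<mm> (Suc n). a = k \<oplus> q"
proof -
  interpret I: ideal "Idl (mon ` S)" R by (rule genideal_ideal) auto
  have sat: "ideal (saturation R \<mm> (Idl (mon ` S))) R" by (rule saturation_ideal[OF max.is_ideal I.is_ideal])
  let ?V = "saturated_exponents S \<inter> exponents_deg d n"
  obtain k q where kq: "k \<in> Idl (mon ` ?V)" "q \<in> Idl (ideal_pow R \<mm> (Suc n))" "a = k \<oplus> q"
    using a sum_mem_Idl_Un_iff[OF mon_image_closed[of ?V] pow_closed[of "Suc n"], of a]
    unfolding mon_span_def by blast
  have "Idl (mon ` ?V) \<subseteq> saturation R \<mm> (Idl (mon ` S))"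
    using mon_saturated_mem[OF S] by (intro genideal_minimal[OF sat]) auto
  moreover have "Idl (mon ` ?V) \<subseteq> ideal_pow R \<mm> n"
    using mon_in_pow by (intro genideal_minimal[OF pow_ideal]) auto
  ultimately show ?thesis using kq Idl_ideal[OF pow_ideal] by blast
qed

theorem saturation_initial_ideal:
  assumes S: "upward_closed S"
  shows "saturation (gr R \<mm>) (gr_pos R \<mm>) (initial_ideal R \<mm> (Idl (mon ` S)))
    = initial_ideal R \<mm> (saturation R \<mm> (Idl (mon ` S)))"
proof -
  interpret A: adic_ring R \<mm>
    by (intro adic_ring.intro adic_ring_axioms.intro is_cring max.is_ideal)
  interpret I: ideal "Idl (mon ` S)" R by (rule genideal_ideal) auto
  let ?I = "Idl (mon ` S)" and ?K = "saturation R \<mm> (Idl (mon ` S))"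
  have K: "ideal ?K R" by (rule saturation_ideal[OF max.is_ideal I.is_ideal])
  have "saturation (gr R \<mm>) (gr_pos R \<mm>) (A.graded_part ?I) \<subseteq> A.graded_part ?K"
  proof
    fix f assume "f \<in> saturation (gr R \<mm>) (gr_pos R \<mm>) (A.graded_part ?I)"
    then obtain i where f: "f \<in> carrier (gr R \<mm>)" and
      i: "\<And>g. g \<in> ideal_pow (gr R \<mm>) (gr_pos R \<mm>) i \<Longrightarrow> f \<otimes>\<^bsub>gr R \<mm>\<^esub> g \<in> A.graded_part ?I"
      unfolding saturation_def ideal_colon_def by blast
    obtain a where a: "a \<in> A.rees" "f = A.gr_of a" using f by (rule A.gr_repE)
    have "\<exists>k\<in>?K \<inter> ideal_pow R \<mm> n. f n = A.cls n k" for n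
    proof -
      have an: "a n \<in> ideal_pow R \<mm> n" by (rule A.rees_pow[OF a(1)])
      have ac: "a n \<in> carrier R" by (rule A.rees_closed[OF a(1)])
      \<comment> \<open>Multiplying \<open>f\<close> by the class of \<open>x j [^] i\<close> in
        degree \<open>i\<close> moves component \<open>n\<close> to \<open>n + i\<close> without
        mixing components, so each \<open>a n\<close> can be tested separately.\<close>
      have "a n \<otimes> x j [^] i \<in> mon_span (S \<inter> exponents_deg d (n + i)) (n + i)" if j: "j < d" for j
      proof -
        interpret M: ideal "mon_span (S \<inter> exponents_deg d (n + i)) (n + i)" R by (rule mon_span_ideal)
        have xj: "x j \<in> \<mm>" unfolding max_eq using genideal_self[of "x ` {..<d}"] x_closed j by auto
        note pw = A.gr_single_power[OF xj, of i]
        have xc: "x j [^] i \<in> carrier R" by (rule A.pow_closed[OF pw(1)])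
        have "f \<otimes>\<^bsub>gr R \<mm>\<^esub> A.gr_single i (x j [^] i) \<in> A.graded_part ?I" by (rule i[OF pw(2)])
        moreover have "(f \<otimes>\<^bsub>gr R \<mm>\<^esub> A.gr_single i (x j [^] i)) (n + i) = A.cls (n + i) (a n \<otimes> x j [^] i)"
          unfolding a(2) using A.gr_mult_single[OF a(1) pw(1), of "n + i"] by simp
        ultimately obtain c where c: "c \<in> ?I" "c \<in> ideal_pow R \<mm> (n + i)"
            "A.cls (n + i) (a n \<otimes> x j [^] i) = A.cls (n + i) c"
          unfolding A.graded_part_def by force
        have cc: "c \<in> carrier R" by (rule I.Icarr[OF c(1)])
        have "a n \<otimes> x j [^] i \<ominus> c \<in> ideal_pow R \<mm> (Suc (n + i))"
          using c(3) A.cls_eq_iff[of "a n \<otimes> x j [^] i" c "n + i"] ac xc cc by blast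
        hence "a n \<otimes> x j [^] i \<ominus> c \<in> mon_span (S \<inter> exponents_deg d (n + i)) (n + i)"
          using pow_subset_span by blast
        hence "(a n \<otimes> x j [^] i \<ominus> c) \<oplus> c \<in> mon_span (S \<inter> exponents_deg d (n + i)) (n + i)"
          using monomial_ideal_inter_pow[OF S c(1,2)] by (rule M.a_closed)
        moreover have "(a n \<otimes> x j [^] i \<ominus> c) \<oplus> c = a n \<otimes> x j [^] i"
          using ac xc cc by (simp add: a_minus_def a_assoc l_neg)
        ultimately show ?thesis by simp
      qed
      hence "a n \<in> mon_span (saturated_exponents S \<inter> exponents_deg d n) n"
        by (rule mem_span_saturated[OF an])
      then obtain k q where kq: "k \<in> ?K \<inter> ideal_pow R \<mm> n" "q \<in> ideal_pow R \<mm> (Suc n)" "a n = k \<oplus> q"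
        using mon_span_saturated_split[OF S] by blast
      have c: "k \<in> carrier R" "q \<in> carrier R" using kq A.pow_closed by blast+
      have "a n \<ominus> k = q" unfolding kq(3) using c by (simp add: a_minus_def a_comm[of k q] a_assoc r_neg)
      hence "A.cls n (a n) = A.cls n k" using A.cls_eq_iff[OF ac c(1)] kq(2) by simp
      thus ?thesis using kq(1) by (auto simp: a(2) A.gr_of_def)
    qed
    thus "f \<in> A.graded_part ?K" using f unfolding A.graded_part_def by blast
  qed
  thus ?thesis
    unfolding A.initial_ideal_eq[OF I.is_ideal] A.initial_ideal_eq[OF K]
    using A.graded_part_saturation_subset[OF I.is_ideal] by blast
qed

theorem depth_gr_saturation_pos:
  assumes S: "upward_closed S"
  defines "K \<equiv> saturation R \<mm> (Idl (mon ` S))"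
  shows "depth_gr (R Quot K) (quot_ideal R \<mm> K) > 0"
proof -
  interpret I: ideal "Idl (mon ` S)" R by (rule genideal_ideal) auto
  interpret K: ideal K R unfolding K_def by (rule saturation_ideal[OF max.is_ideal I.is_ideal])
  interpret h: ring_hom_ring R "R Quot K" "(+>) K" by (rule K.rcos_ring_hom_ring)
  have QJ: "quot_ideal R \<mm> K = (+>) K ` \<mm>" by (simp add: quot_ideal_def)
  interpret Q: adic_ring "R Quot K" "quot_ideal R \<mm> K"
  proof (intro adic_ring.intro adic_ring_axioms.intro)
    show "cring (R Quot K)" by (rule K.quotient_is_cring[OF is_cring])
    show "ideal (quot_ideal R \<mm> K) (R Quot K)"
      unfolding QJ by (rule ring_ideal_imp_quot_ideal[OF K.is_ideal max.is_ideal])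
  qed
  note pw = quot_ideal_pow[OF max.is_ideal K.is_ideal]
  have lc: "linear_sum \<in> carrier R" using linear_sum_mem max.Icarr by blast
  show ?thesis
  proof (rule Q.depth_gr_pos)
    show "K +> linear_sum \<in> quot_ideal R \<mm> K" unfolding QJ using linear_sum_mem by blast
    fix n b
    assume "b \<in> ideal_pow (R Quot K) (quot_ideal R \<mm> K) n"
    then obtain a where a: "a \<in> ideal_pow R \<mm> n" "b = K +> a" unfolding pw by blast
    have ac: "a \<in> carrier R" using a(1) pow_closed by blast
    assume "b \<otimes>\<^bsub>R Quot K\<^esub> (K +> linear_sum) \<in> ideal_pow (R Quot K) (quot_ideal R \<mm> K) (Suc (Suc n))"
    hence "K +> a \<otimes> linear_sum \<in> (+>) K ` ideal_pow R \<mm> (Suc (Suc n))"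
      unfolding pw a(2) using h.hom_mult[OF ac lc] by simp
    then obtain q where q: "q \<in> ideal_pow R \<mm> (Suc (Suc n))" "K +> a \<otimes> linear_sum = K +> q" by blast
    have qc: "q \<in> carrier R" using q(1) pow_closed by blast
    \<comment> \<open>Modulo \<open>\<mm>^(n+2)\<close> the product
      \<open>a \<otimes> linear_sum\<close> equals \<open>k\<close>, which lies in the saturation
      and in \<open>\<mm>^(n+1)\<close>. The product is therefore spanned by saturated monomials,
      and \<open>linear_sum\<close> can be cancelled.\<close>
    define k where "k = a \<otimes> linear_sum \<ominus> q"
    have kK: "k \<in> K"
      unfolding k_def using quotient_eq_iff_same_a_r_cos[OF K.is_ideal, of "a \<otimes> linear_sum" q] q(2) ac lc qc by blast
    interpret p: ideal "ideal_pow R \<mm> (Suc n)" R by (rule pow_ideal)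
    have al: "a \<otimes> linear_sum \<in> ideal_pow R \<mm> (Suc n)"
      unfolding ideal_pow_Suc by (rule ideal_prod.prod[OF a(1) linear_sum_mem])
    moreover have "q \<in> ideal_pow R \<mm> (Suc n)" using q(1) ideal_pow_Suc_subset[OF max.is_ideal] by blast
    ultimately have "k \<in> ideal_pow R \<mm> (Suc n)" unfolding k_def by (rule p.minus_closed_ideal)
    hence k1: "k \<in> mon_span (saturated_exponents S \<inter> exponents_deg d (Suc n)) (Suc n)"
      using saturation_inter_pow[OF S] kK unfolding K_def by blast
    interpret M: ideal "mon_span (saturated_exponents S \<inter> exponents_deg d (Suc n)) (Suc n)" R
      by (rule mon_span_ideal)
    have "k \<oplus> q \<in> mon_span (saturated_exponents S \<inter> exponents_deg d (Suc n)) (Suc n)"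
      using k1 q(1) pow_subset_span by (intro M.a_closed) auto
    moreover have "k \<oplus> q = a \<otimes> linear_sum"
      unfolding k_def using ac lc qc by (simp add: a_minus_def a_assoc l_neg)
    ultimately have "a \<in> mon_span (saturated_exponents S \<inter> exponents_deg d n) n"
      using linear_sum_cancel[OF S a(1)] by simp
    then obtain k' q' where kq: "k' \<in> K" "q' \<in> ideal_pow R \<mm> (Suc n)" "a = k' \<oplus> q'"
      using mon_span_saturated_split[OF S] unfolding K_def by blast
    have c: "k' \<in> carrier R" "q' \<in> carrier R" using kq(1,2) K.Icarr pow_closed by auto
    have "a \<ominus> q' = k'" unfolding kq(3) using c by (simp add: a_minus_def a_assoc r_neg)
    hence "K +> a = K +> q'"
      using quotient_eq_iff_same_a_r_cos[OF K.is_ideal ac c(2)] kq(1) by simp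
    thus "b \<in> ideal_pow (R Quot K) (quot_ideal R \<mm> K) (Suc n)"
      unfolding pw a(2) using kq(2) by blast
  qed
qed

lemma monomial_set_upward_closure:
  assumes "U \<subseteq> exponents d"
  shows "\<exists>S. upward_closed S \<and> Idl (mon ` U) = Idl (mon ` S)"
proof -
  define S where "S = {u + v | u v. u \<in> U \<and> v \<in> exponents d}"
  have z: "(0 :: nat \<Rightarrow> nat) \<in> exponents d" by (simp add: exponents_def)
  have US: "U \<subseteq> S"
  proof
    fix u assume "u \<in> U"
    thus "u \<in> S" unfolding S_def using z by (intro CollectI exI[of _ u] exI[of _ 0]) auto
  qed
  have "upward_closed S"
    unfolding upward_closed_def
  proof (intro conjI ballI)
    show "S \<subseteq> exponents d" using assms exponents_add by (auto simp: S_def)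
    fix s w assume "s \<in> S" "w \<in> exponents d"
    then obtain u v where "u \<in> U" "v \<in> exponents d" "s = u + v" by (auto simp: S_def)
    thus "s + w \<in> S"
      unfolding S_def using exponents_add[of v d w] \<open>w \<in> exponents d\<close>
      by (intro CollectI exI[of _ u] exI[of _ "v + w"]) (simp add: add.assoc)
  qed
  moreover have "Idl (mon ` U) = Idl (mon ` S)"
  proof
    show "Idl (mon ` U) \<subseteq> Idl (mon ` S)" using US by (intro Idl_mono) auto
    interpret U: ideal "Idl (mon ` U)" R by (rule genideal_ideal) auto
    show "Idl (mon ` S) \<subseteq> Idl (mon ` U)"
    proof (rule genideal_minimal[OF U.is_ideal], rule)
      fix y assume "y \<in> mon ` S"
      then obtain u v where uv: "u \<in> U" "y = mon u \<otimes> mon v" by (auto simp: S_def mon_add)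
      have "mon u \<in> Idl (mon ` U)" using genideal_self[OF mon_image_closed] uv(1) by blast
      thus "y \<in> Idl (mon ` U)" unfolding uv(2) by (rule U.I_r_closed) simp
    qed
  qed
  ultimately show ?thesis by blast
qed

end

section \<open>Regular local rings\<close>

context regular_local_ring
begin

sublocale noetherian_local_ring ..

lemma card_minimal_generating_set:
  assumes "finite \<xx>" "minimal_generating_set R \<xx> \<mm>"
  shows "min_num_generators R \<mm> = card \<xx>"
  unfolding min_num_generators_def
proof (rule Least_equality)
  show "\<exists>S\<subseteq>carrier R. finite S \<and> card S = card \<xx> \<and> Idl S = \<mm>"
    using assms by (auto simp: minimal_generating_set_def)
  fix n assume "\<exists>S\<subseteq>carrier R. finite S \<and> card S = n \<and> Idl S = \<mm>"
  thus "card \<xx> \<le> n" using card_irredundant_le[OF assms(2)] by auto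
qed

text \<open>A finite supremum of natural numbers in \<open>enat\<close> is attained: otherwise every
  chain has length at most \<open>d - 1\<close>. For \<open>d = 0\<close> that subtraction would
  truncate, and the chain consisting of \<mm> alone serves instead.\<close>

lemma exists_prime_chain:
  assumes "krull_dim R = enat d"
  shows "\<exists>P. (\<forall>i\<le>d. primeideal (P i) R) \<and> (\<forall>i<d. P i \<subset> P (Suc i))"
proof (rule ccontr)
  assume none: "\<not> ?thesis"
  have prime: "primeideal \<mm> R" by (rule maximalideal_prime[OF maximal])
  have "d \<noteq> 0"
  proof
    assume "d = 0"
    hence "(\<forall>i\<le>d. primeideal \<mm> R) \<and> (\<forall>i<d. \<mm> \<subset> \<mm>)" using prime by simp
    hence "\<exists>P. (\<forall>i\<le>d. primeideal (P i) R) \<and> (\<forall>i<d. P i \<subset> P (Suc i))"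
      by (rule exI[of _ "\<lambda>_. \<mm>"])
    thus False by (rule notE[OF none])
  qed
  have lt: "n < d" if "\<exists>P. (\<forall>i\<le>n. primeideal (P i) R) \<and> (\<forall>i<n. P i \<subset> P (Suc i))" for n
  proof (rule ccontr)
    assume "\<not> n < d"
    hence "d \<le> n" by simp
    from that obtain P where "(\<forall>i\<le>n. primeideal (P i) R) \<and> (\<forall>i<n. P i \<subset> P (Suc i))" by (rule exE)
    hence "(\<forall>i\<le>d. primeideal (P i) R) \<and> (\<forall>i<d. P i \<subset> P (Suc i))" using \<open>d \<le> n\<close> by simp
    hence "\<exists>P. (\<forall>i\<le>d. primeideal (P i) R) \<and> (\<forall>i<d. P i \<subset> P (Suc i))" by (rule exI[of _ P])
    thus False by (rule notE[OF none])
  qed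
  have "n \<le> d - 1" if "\<exists>P. (\<forall>i\<le>n. primeideal (P i) R) \<and> (\<forall>i<n. P i \<subset> P (Suc i))" for n
    using lt[OF that] by simp
  hence "krull_dim R \<le> enat (d - 1)"
    unfolding krull_dim_def by (intro Sup_least) (elim CollectE exE conjE, simp only: enat_ord_simps, blast)
  thus False using assms \<open>d \<noteq> 0\<close> by simp
qed

end

theorem theorem8p9:
  fixes R :: "('a, 'b) ring_scheme" and \<mm> \<xx> I :: "'a set"
  assumes "regular_local_ring R \<mm>"
    and "finite \<xx>"
    and "minimal_generating_set R \<xx> \<mm>"
    and "monomial_ideal R \<xx> I"
  shows "saturation (gr R \<mm>) (gr_pos R \<mm>) (initial_ideal R \<mm> I)
           = initial_ideal R \<mm> (saturation R \<mm> I)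
       \<and> depth_gr (R Quot saturation R \<mm> I) (quot_ideal R \<mm> (saturation R \<mm> I)) > 0"
proof -
  interpret regular_local_ring R \<mm> by fact
  define d where "d = card \<xx>"
  obtain x where x: "bij_betw x {..<d} \<xx>"
    using ex_bij_betw_nat_finite[OF assms(2)] by (auto simp: d_def atLeast0LessThan)
  have xim: "x ` {..<d} = \<xx>" and inj: "inj_on x {..<d}" using x by (auto simp: bij_betw_def)
  have xc: "\<xx> \<subseteq> carrier R" "genideal R \<xx> = \<mm>" using assms(3) by (auto simp: minimal_generating_set_def)
  interpret G: generated_local_ring R \<mm> x d
    by unfold_locales (use xim xc in auto)
  \<comment> \<open>Regularity turns the number of given generators into a chain of primes with that
    many strict inclusions, just what independence of the monomials requires.\<close>
  have "krull_dim R = enat d"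
    using regular card_minimal_generating_set[OF assms(2,3)] by (simp add: d_def)
  from exists_prime_chain[OF this]
  obtain P where P: "\<forall>i\<le>d. primeideal (P i) R" "\<forall>i<d. P i \<subset> P (Suc i)"
    by (elim exE conjE) (rule that)
  have "G.independent_monomials"
    by (rule G.independent_monomials_if_prime_chain[of P]) (use P in simp_all)
  then interpret H: independent_generators R \<mm> x d by unfold_locales
  obtain T where T: "T \<subseteq> monomials R \<xx>" "I = genideal R T"
    using assms(4) by (auto simp: monomial_ideal_def)
  have "monomials R \<xx> \<subseteq> G.mon ` exponents d"
  proof
    fix m assume "m \<in> monomials R \<xx>"
    then obtain a :: "'a \<Rightarrow> nat" where m: "m = finprod R (\<lambda>y. y [^]\<^bsub>R\<^esub> a y) \<xx>"
      by (auto simp: monomials_def)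
    define u where "u i = (if i < d then a (x i) else 0)" for i
    have "m = finprod R (\<lambda>i. x i [^]\<^bsub>R\<^esub> a (x i)) {..<d}"
      unfolding m xim[symmetric] by (rule finprod_reindex[OF _ inj]) (use xim xc in auto)
    also have "\<dots> = G.mon u"
      unfolding G.mon_def by (rule finprod_cong') (use xim xc in \<open>auto simp: u_def\<close>)
    finally show "m \<in> G.mon ` exponents d" by (auto simp: u_def exponents_def)
  qed
  hence "T \<subseteq> G.mon ` exponents d" using T(1) by blast
  then obtain U where "U \<subseteq> exponents d" "T = G.mon ` U" by (meson subset_imageE)
  then obtain S where S: "H.upward_closed S" "I = genideal R (G.mon ` S)"
    using H.monomial_set_upward_closure T(2) by blast
  show ?thesis
    unfolding S(2) using H.saturation_initial_ideal[OF S(1)] H.depth_gr_saturation_pos[OF S(1)] by blast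
qed

end
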